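(* Let $r>0$, $\kappa>0$, $W=\frac{\kappa}{4\pi r}$, $b_1=(r,0)$, $b_2=(-r,0)$. Suppose $f:\mathbb{R}\to\mathbb{R}$ is a bounded nondecreasing function with $f(s)=0$ for $s\le 0$ and $f(s)>0$ for $s>0$. Then for all sufficiently large $\lambda>0$ there is a travelling solution $(\omega^\lambda,\Psi^\lambda)$ of the planar Euler equations in vorticity-stream form $$\partial_t\omega+\mathbf{v}\cdot\nabla\omega=0,\qquad \mathbf{v}=\nabla^\perp\Psi,\qquad \Psi=(-\Delta)^{-1}\omega \quad\text{on } \mathbb{R}^2,$$ and a constant $\mu^\lambda\ge 0$, such that $\omega^\lambda(x_1,x_2,t)=\zeta^\lambda(x_1,x_2+Wt)$, $\Psi^\lambda(x_1,x_2,t)=\phi^\lambda(x_1,x_2+Wt)$ with $\phi^\lambda=(-\Delta)^{-1}\zeta^\lambda$, and $$\omega^\lambda(x_1,x_2,t)=\zeta^\lambda(x_1,x_2+Wt)=\lambda f\big(\phi^\lambda(x_1,x_2+Wt)-Wx_1-\mu^\lambda\big)\quad\text{for all }(x_1,x_2)\in\Pi=\{x\in\mathbb{R}^2: x_1>0\}.$$ Moreover: (i) $\zeta^\lambda\rightharpoonup \kappa\,\boldsymbol{\delta}(x-b_1)-\kappa\,\boldsymbol{\delta}(x-b_2)$ in the sense of measures as $\lambda\to+\infty$; (ii) there is a constant $L>0$ independent of $\lambda$ such that $\operatorname{supp}(\zeta^\lambda)\subset \bigcup_{i=1}^2 B_{L\lambda^{-1/2}}(b_i)$; (iii) $\zeta^\lambda(x_1,x_2)=-\zeta^\lambda(-x_1,x_2)=\zeta^\lambda(x_1,-x_2)$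 for all $(x_1,x_2)\in\mathbb{R}^2$; (iv) for $\lambda$ large, $\mu^\lambda=\frac{\kappa}{4\pi}\log\lambda+O(1)$.
   Context: Notation: $\nabla^\perp\Psi=(\partial_{x_2}\Psi,-\partial_{x_1}\Psi)$; $\boldsymbol{\delta}$ is the Dirac mass at the origin of $\mathbb{R}^2$; $B_\varrho(b)$ is the open disc of radius $\varrho$ centred at $b$. For a bounded compactly supported $\zeta$, $(-\Delta)^{-1}\zeta(x)=\frac{1}{2\pi}\int_{\mathbb{R}^2}\log\frac{1}{|x-y|}\,\zeta(y)\,dy$. The vorticity equation is understood in the weak (distributional) sense, since $f$ may be discontinuous; identities between $L^\infty$ vorticities are understood almost everywhere. $O(1)$ denotes a quantity bounded uniformly in $\lambda$ as $\lambda\to+\infty$. *)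

theory Defs
  imports "HOL-Analysis.Analysis" "HOL-Library.Landau_Symbols"
begin

type_synonym plane = "real \<times> real"

definition partial :: "'a::euclidean_space \<Rightarrow> ('a \<Rightarrow> real) \<Rightarrow> 'a \<Rightarrow> real"
  where "partial e g x = frechet_derivative g (at x) e"

primrec C_k :: "nat \<Rightarrow> ('a::euclidean_space \<Rightarrow> real) \<Rightarrow> bool" where
  "C_k 0 g \<longleftrightarrow> continuous_on UNIV g"
| "C_k (Suc k) g \<longleftrightarrow> (\<forall>x. g differentiable (at x)) \<and> (\<forall>e\<in>Basis. C_k k (partial e g))"

definition test_function :: "('a::euclidean_space \<Rightarrow> real) \<Rightarrow> bool"
  where "test_function \<eta> \<longleftrightarrow> (\<forall>k. C_k k \<eta>) \<and> compact (closure {x. \<eta> x \<noteq> 0})"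

definition ess_bounded :: "('a::euclidean_space \<Rightarrow> real) \<Rightarrow> bool"
  where "ess_bounded g \<longleftrightarrow> g \<in> borel_measurable lborel \<and> (\<exists>M. AE x in lborel. \<bar>g x\<bar> \<le> M)"

text \<open>The support of an \<open>L\<^sup>\<infinity>\<close> class: the complement of the union of all open sets on which the
  function vanishes almost everywhere.\<close>

definition ess_support :: "('a::euclidean_space \<Rightarrow> real) \<Rightarrow> 'a set"
  where "ess_support g =
    - \<Union>{U. open U \<and> (AE x in lborel. x \<in> U \<longrightarrow> g x = 0)}"

definition ess_bounded_compact_support :: "('a::euclidean_space \<Rightarrow> real) \<Rightarrow> bool"
  where "ess_bounded_compact_support g \<longleftrightarrow> ess_bounded g \<and> compact (ess_support g)"

text \<open>On the null set \<open>y = x\<close> the kernel takes the irrelevant value \<open>ln (1 / 0) = 0\<close>.\<close>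

definition inv_neg_laplacian :: "(plane \<Rightarrow> real) \<Rightarrow> plane \<Rightarrow> real"
  where "inv_neg_laplacian \<zeta> x =
    1 / (2 * pi) * (\<integral>y. ln (1 / dist x y) * \<zeta> y \<partial>lborel)"

definition perp_grad :: "(plane \<Rightarrow> real) \<Rightarrow> plane \<Rightarrow> plane"
  where "perp_grad \<Psi> x = (partial (0, 1) \<Psi> x, - partial (1, 0) \<Psi> x)"

text \<open>Weak form of \<open>\<partial>\<^sub>t\<omega> + v \<cdot> \<nabla>\<omega> = 0\<close> on the whole space-time \<open>\<real>\<^sup>2 \<times> \<real>\<close>. The field \<open>v = perp_grad \<Psi>\<close>
  is divergence free, so \<open>v \<cdot> \<nabla>\<omega> = div (\<omega> v)\<close>, and both derivatives are moved to the test
  function. Stating this with \<open>has_bochner_integral\<close> includes integrability, which an equation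
  between Bochner integrals would not.\<close>

definition weak_transport :: "(plane \<Rightarrow> real \<Rightarrow> real) \<Rightarrow> (plane \<Rightarrow> real \<Rightarrow> plane) \<Rightarrow> bool"
  where "weak_transport \<omega> v \<longleftrightarrow>
    (\<forall>\<eta> :: plane \<times> real \<Rightarrow> real. test_function \<eta> \<longrightarrow>
      has_bochner_integral lborel
        (\<lambda>(x, t). \<omega> x t *
          (partial ((0, 0), 1) \<eta> (x, t)
           + v x t \<bullet> (partial ((1, 0), 0) \<eta> (x, t), partial ((0, 1), 0) \<eta> (x, t))))
        0)"

text \<open>Differentiability of \<open>\<Psi>\<close> in space is required explicitly because \<open>frechet_derivative\<close>, hence
  \<open>perp_grad\<close>, is unspecified without it.\<close>

definition euler_vorticity_stream ::
    "(plane \<Rightarrow> real \<Rightarrow> real) \<Rightarrow> (plane \<Rightarrow> real \<Rightarrow> real) \<Rightarrow> bool"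
  where "euler_vorticity_stream \<omega> \<Psi> \<longleftrightarrow>
    ess_bounded (\<lambda>(x, t). \<omega> x t) \<and>
    (\<forall>t. ess_bounded_compact_support (\<lambda>x. \<omega> x t)) \<and>
    (\<forall>x t. \<Psi> x t = inv_neg_laplacian (\<lambda>y. \<omega> y t) x) \<and>
    (\<forall>x t. (\<lambda>y. \<Psi> y t) differentiable (at x)) \<and>
    weak_transport \<omega> (\<lambda>x t. perp_grad (\<lambda>y. \<Psi> y t) x)"

text \<open>\<open>\<zeta> \<lambda> dx \<rightharpoonup> m\<close> as \<open>\<lambda> \<rightarrow> \<infinity>\<close>, where the limit measure is given by its action \<open>m\<close> on bounded
  continuous functions.\<close>

definition converges_as_measures ::
    "(real \<Rightarrow> 'a::euclidean_space \<Rightarrow> real) \<Rightarrow> (('a \<Rightarrow> real) \<Rightarrow> real) \<Rightarrow> bool"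
  where "converges_as_measures \<zeta> m \<longleftrightarrow>
    (\<forall>g. continuous_on UNIV g \<and> bounded (range g) \<longrightarrow>
      ((\<lambda>lam. \<integral>x. g x * \<zeta> lam x \<partial>lborel) \<longlongrightarrow> m g) at_top)"

end

theory Submission
  imports Defs "HOL-Complex_Analysis.Great_Picard"
begin

text \<open>
  Proof idea. In the half plane, maximize the kinetic energy minus the linear term \<open>W \<integral> x\<^sub>1 \<zeta>\<close> minus a convex
  penalty (the conjugate of a primitive of \<open>f\<close>) among densities of mass \<open>\<kappa>\<close> that are supported in a fixed
  rectangle around \<open>b\<^sub>1\<close> and Steiner symmetric in \<open>x\<^sub>2\<close>. The Green function is positive definite, so replacing
  a density by the bathtub maximizer for its own potential does not decrease the energy; together with
  equicontinuity of the potentials this gives a maximizer, and a maximizer is its own bathtub maximizer, which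
  is the equation \<open>\<zeta> = \<lambda> f (\<phi> - W x\<^sub>1 - \<mu>)\<close>. Since potentials of Steiner symmetric densities are strictly
  decreasing in \<open>\<bar>x\<^sub>2\<bar>\<close>, each discontinuity of \<open>f\<close> is met on a null set only. Comparison with a small square
  patch bounds \<open>\<mu>\<close> from below; this forces more than half of the mass into the disc of radius \<open>R \<lambda>\<^sup>-\<^sup>1\<^sup>/\<^sup>2\<close>
  around every point of the support, hence the support has diameter \<open>O(\<lambda>\<^sup>-\<^sup>1\<^sup>/\<^sup>2)\<close>. Translations in \<open>x\<^sub>1\<close> preserve
  the self-energy, so maximality balances the image vortex against \<open>W\<close> and places the support at \<open>b\<^sub>1\<close>.
  For the bound on \<open>\<phi> - W x\<^sub>1 - \<mu>\<close>, \<open>f\<close> is truncated at a level \<open>T\<close> that does not depend on \<open>\<lambda>\<close> and that the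
  solution does not reach.
\<close>

section \<open>Elementary integrals in the plane\<close>

text \<open>Both constraints on the admissible densities are artificial and must be shown not to
  act. Steiner symmetry is harmless because the potential of a symmetric density decreases in
  \<bar>x2\<bar>, so its bathtub maximizer is admissible again. The rectangle is harmless because
  away from b1 the potential stays below 3 \<kappa> while \<mu> grows like ln \<open>lam\<close>: in
  the rest of the half plane the relative stream function is negative and both sides of the equation
  vanish. The weak vorticity equation cannot come from a chain rule, since f may jump. For
  continuous p, however, p(\<Theta> - \<mu>) \<nabla>\<Theta> is the gradient of a C1 function, and
  the rotated pairing of two gradients integrates to zero. Backward averages of f are such p, and
  they converge to f at the values met off a null set. Near the axis these functions vanish
  identically, so the odd extension glues without a boundary term. A shear of space-time turns the
  steady identity into the travelling one. The value f T entering the choice of T is at most the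
  bound of f, so that choice is not circular.\<close>

lemma borel_measurable_fst_snd [measurable (raw)]:
  fixes g :: "'a \<Rightarrow> 'b::topological_space \<times> 'c::topological_space"
  assumes "g \<in> borel_measurable M"
  shows "(\<lambda>x. fst (g x)) \<in> borel_measurable M" "(\<lambda>x. snd (g x)) \<in> borel_measurable M"
  by (rule measurable_compose[OF assms], intro borel_measurable_continuous_onI continuous_intros)+

text \<open>One family serves all symmetries of the problem: the mirror image at x1 = 0, the
  reflections of x2 at 0 and at (a + b) / 2, the substitution of x - y for y, and the translations
  along either axis.\<close>

lemma lborel_distr_signed_translation:
  fixes t1 t2 s1 s2 :: real
  assumes "\<bar>s1\<bar> = 1" "\<bar>s2\<bar> = 1"
  shows "distr lborel borel (\<lambda>x::plane. (t1 + s1 * fst x, t2 + s2 * snd x)) = lborel"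
proof -
  define c :: "plane \<Rightarrow> real" where "c = (\<lambda>j. if j = (1, 0) then s1 else s2)"
  have B: "(Basis :: plane set) = {(1, 0), (0, 1)}"
    by (auto simp: Basis_prod_def)
  have c0: "c j \<noteq> 0" for j using assms by (auto simp: c_def)
  have "(lborel :: plane measure) = density (distr lborel borel
      (\<lambda>x. (t1, t2) + (\<Sum>j\<in>Basis. (c j * (x \<bullet> j)) *\<^sub>R j))) (\<lambda>_. (\<Prod>j\<in>Basis. \<bar>c j\<bar>))"
    by (rule lborel_affine_euclidean) (use c0 in auto)
  also have "(\<lambda>x. (t1, t2) + (\<Sum>j\<in>Basis. (c j * (x \<bullet> j)) *\<^sub>R j))
      = (\<lambda>x::plane. (t1 + s1 * fst x, t2 + s2 * snd x))"
    by (auto simp: B c_def fun_eq_iff inner_prod_def)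
  also have "(\<Prod>j\<in>(Basis::plane set). \<bar>c j\<bar>) = 1" using assms by (simp add: B c_def)
  finally show ?thesis by (simp add: density_1)
qed

lemma measurable_signed_translation:
  "(\<lambda>x::plane. (t1 + s1 * fst x, t2 + s2 * snd x)) \<in> lborel \<rightarrow>\<^sub>M borel"
proof -
  have "(\<lambda>x::plane. (t1 + s1 * fst x, t2 + s2 * snd x)) \<in> borel_measurable borel"
    by (intro borel_measurable_continuous_onI continuous_intros)
  then show ?thesis by simp
qed

lemma
  fixes g :: "plane \<Rightarrow> real"
  assumes "\<bar>s1\<bar> = 1" "\<bar>s2\<bar> = 1" "g \<in> borel_measurable borel"
  shows integral_signed_translation:
      "(\<integral>x. g (t1 + s1 * fst x, t2 + s2 * snd x) \<partial>lborel) = (\<integral>x. g x \<partial>lborel)"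
    and integrable_signed_translation:
      "integrable lborel (\<lambda>x. g (t1 + s1 * fst x, t2 + s2 * snd x)) \<longleftrightarrow> integrable lborel g"
proof -
  note m = measurable_signed_translation[of t1 s1 t2 s2]
  show "(\<integral>x. g (t1 + s1 * fst x, t2 + s2 * snd x) \<partial>lborel) = (\<integral>x. g x \<partial>lborel)"
    using integral_distr[OF m assms(3)] lborel_distr_signed_translation[OF assms(1,2)] by simp
  show "integrable lborel (\<lambda>x. g (t1 + s1 * fst x, t2 + s2 * snd x)) \<longleftrightarrow> integrable lborel g"
    using integrable_distr_eq[OF m assms(3)] lborel_distr_signed_translation[OF assms(1,2)] by simp
qed

lemma nn_integral_signed_translation:
  fixes g :: "plane \<Rightarrow> ennreal"
  assumes "\<bar>s1\<bar> = 1" "\<bar>s2\<bar> = 1" "g \<in> borel_measurable borel"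
  shows "(\<integral>\<^sup>+x. g (t1 + s1 * fst x, t2 + s2 * snd x) \<partial>lborel) = (\<integral>\<^sup>+x. g x \<partial>lborel)"
proof -
  note m = measurable_signed_translation[of t1 s1 t2 s2]
  show ?thesis
    using nn_integral_distr[OF m, of g] assms(3) lborel_distr_signed_translation[OF assms(1,2)] by simp
qed

lemma AE_signed_translation:
  fixes P :: "plane \<Rightarrow> bool"
  assumes "\<bar>s1\<bar> = 1" "\<bar>s2\<bar> = 1" and P: "AE x in lborel. P x"
  shows "AE x in lborel. P (t1 + s1 * fst x, t2 + s2 * snd x)"
proof -
  note m = measurable_signed_translation[of t1 s1 t2 s2]
  have "AE x in distr lborel borel (\<lambda>x::plane. (t1 + s1 * fst x, t2 + s2 * snd x)). P x"
    using P by (simp only: lborel_distr_signed_translation[OF assms(1,2)])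
  then show ?thesis by (rule AE_distrD[OF m])
qed

lemma has_integral_abs_powr_symmetric:
  fixes q \<rho> :: real
  assumes "q < 1" "\<rho> > 0"
  shows "((\<lambda>t. \<bar>t\<bar> powr - q) has_integral 2 * \<rho> powr (1 - q) / (1 - q)) {-\<rho>..\<rho>}"
proof -
  have 1: "((\<lambda>t. \<bar>t\<bar> powr - q) has_integral \<rho> powr (1 - q) / (1 - q)) {0..\<rho>}"
    using has_integral_powr_from_0[of "-q" \<rho>] assms
    by (subst has_integral_cong[where g="\<lambda>t. t powr -q"]) (auto simp: add.commute)
  then have "((\<lambda>t. \<bar>-t\<bar> powr - q) has_integral \<rho> powr (1 - q) / (1 - q)) {-\<rho>..-0}"
    by (subst has_integral_reflect_real) (use 1 in auto)
  then have 2: "((\<lambda>t. \<bar>t\<bar> powr - q) has_integral \<rho> powr (1 - q) / (1 - q)) {-\<rho>..0}" by simp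
  show ?thesis
    using has_integral_combine[OF _ _ 2 1] assms by simp
qed

text \<open>The square of the integral of \<bar>t\<bar> to the power -p/2 over [-1, 1], hence an
  upper bound for the integral of \<bar>z\<bar> to the power -p over the unit disc.\<close>

definition sing_const :: "real \<Rightarrow> real" where
  "sing_const p = (2 / (1 - p / 2))\<^sup>2"

text \<open>Uses \<open>\<bar>z\<bar>\<^sup>-\<^sup>p \<le> \<bar>z\<^sub>1\<bar>\<^sup>-\<^sup>p\<^sup>/\<^sup>2 \<bar>z\<^sub>2\<bar>\<^sup>-\<^sup>p\<^sup>/\<^sup>2\<close>, which replaces polar coordinates by a product of one-dimensional
  integrals.\<close>

lemma nn_integral_norm_powr_le:
  fixes p \<rho> :: real
  assumes "0 < p" "p < 2" "\<rho> > 0"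
  shows "(\<integral>\<^sup>+z. ennreal (norm (z::plane) powr - p * indicator (cball 0 \<rho>) z) \<partial>lborel)
    \<le> ennreal (sing_const p * \<rho> powr (2 - p))"
proof -
  let ?q = "p / 2"
  let ?h = "\<lambda>t. indicator {-\<rho>..\<rho>} t * \<bar>t\<bar> powr - ?q :: real"
  let ?I = "2 * \<rho> powr (1 - ?q) / (1 - ?q)"
  have I0: "?I \<ge> 0" using assms by simp
  have hI: "(\<integral>\<^sup>+t. ennreal (?h t) \<partial>lborel) = ennreal ?I"
    using nn_integral_has_integral_lebesgue[OF _ has_integral_abs_powr_symmetric[of ?q \<rho>]] assms 
    by simp
  \<comment> \<open>On the coordinate axes \<open>0 powr - ?q\<close> is 0, so the product bound
    would fail there; they form a null set.\<close>
  have n0: "AE z in (lborel :: plane measure). fst z \<noteq> 0 \<and> snd z \<noteq> 0"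
  proof -
    have "AE z in (lborel :: plane measure). z \<bullet> (1, 0) \<noteq> 0"
      using AE_lborel_inner_neq[of "(1, 0) :: plane" 0] by (simp add: Basis_prod_def)
    moreover have "AE z in (lborel :: plane measure). z \<bullet> (0, 1) \<noteq> 0"
      using AE_lborel_inner_neq[of "(0, 1) :: plane" 0] by (simp add: Basis_prod_def)
    ultimately show ?thesis by eventually_elim (auto simp: inner_prod_def)
  qed
  have "(\<integral>\<^sup>+z. ennreal (norm (z::plane) powr - p * indicator (cball 0 \<rho>) z) \<partial>lborel)
      \<le> (\<integral>\<^sup>+z. ennreal (?h (fst z)) * ennreal (?h (snd z)) \<partial>lborel)"
  proof (rule nn_integral_mono_AE, use n0 in eventually_elim)
    fix z :: plane assume z: "fst z \<noteq> 0 \<and> snd z \<noteq> 0"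
    show "ennreal (norm z powr - p * indicator (cball 0 \<rho>) z)
      \<le> ennreal (?h (fst z)) * ennreal (?h (snd z))"
    proof (cases "z \<in> cball 0 \<rho>")
      case True
      have a: "\<bar>fst z\<bar> \<le> norm z" "\<bar>snd z\<bar> \<le> norm z"
        using norm_fst_le[of "fst z" "snd z"] norm_snd_le[of "snd z" "fst z"] by auto
      have "norm z powr - p = norm z powr - ?q * norm z powr - ?q"
        by (simp flip: powr_add)
      also have "\<dots> \<le> \<bar>fst z\<bar> powr - ?q * \<bar>snd z\<bar> powr - ?q"
        using a z assms by (intro mult_mono powr_mono2') auto
      finally show ?thesis using a True by (auto simp: indicator_def simp flip: ennreal_mult')
    qed simp
  qed
  also have "\<dots> = (\<integral>\<^sup>+a. \<integral>\<^sup>+b. ennreal (?h a) * ennreal (?h b) \<partial>lborel \<partial>lborel)"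
    by (subst lborel_prod[symmetric], subst lborel.nn_integral_fst[symmetric]) simp_all
  also have "\<dots> = ennreal ?I * ennreal ?I"
    by (simp add: nn_integral_cmult nn_integral_multc hI)
  also have "\<dots> = ennreal (?I * ?I)" by (rule ennreal_mult[OF I0 I0, symmetric])
  also have "?I * ?I = sing_const p * \<rho> powr (2 - p)"
  proof -
    have e: "\<rho> powr (2 - p) = \<rho> powr (1 - p / 2) * \<rho> powr (1 - p / 2)" by (simp flip: powr_add)
    show ?thesis unfolding e sing_const_def power2_eq_square by (simp add: field_simps)
  qed
  finally show ?thesis .
qed

lemma nn_integral_dist_powr_le:
  fixes p \<rho> :: real and x :: plane
  assumes "0 < p" "p < 2" "\<rho> > 0"
  shows "(\<integral>\<^sup>+y. ennreal (dist x y powr - p * indicator (cball x \<rho>) y) \<partial>lborel)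
    \<le> ennreal (sing_const p * \<rho> powr (2 - p))"
proof -
  let ?g = "\<lambda>z::plane. ennreal (norm z powr - p * indicator (cball 0 \<rho>) z)"
  have "(\<integral>\<^sup>+y. ?g (fst x + (-1) * fst y, snd x + (-1) * snd y) \<partial>lborel) = (\<integral>\<^sup>+z. ?g z \<partial>lborel)"
    by (rule nn_integral_signed_translation) (auto intro!: measurable_compose[OF _ measurable_ennreal]
        borel_measurable_times borel_measurable_indicator)
  moreover have "(fst x + (-1) * fst y, snd x + (-1) * snd y) = x - y" for y
    by (simp add: prod_eq_iff)
  moreover have "?g (x - y) = ennreal (dist x y powr - p * indicator (cball x \<rho>) y)" for y
    by (auto simp: dist_norm indicator_def norm_minus_commute)
  ultimately show ?thesis using nn_integral_norm_powr_le[OF assms] by simp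
qed

lemma
  fixes p \<sigma> :: real and x :: plane
  assumes "0 < p" "p < 2" "\<sigma> > 0"
  shows integrable_dist_powr_cball:
      "integrable lborel (\<lambda>y. dist x y powr - p * indicator (cball x \<sigma>) y)"
    and integral_dist_powr_cball_le:
      "(\<integral>y. dist x y powr - p * indicator (cball x \<sigma>) y \<partial>lborel) \<le> sing_const p * \<sigma> powr (2 - p)"
proof -
  let ?g = "\<lambda>y. dist x y powr - p * indicator (cball x \<sigma>) y :: real"
  have m: "?g \<in> borel_measurable lborel"
    by (intro borel_measurable_times borel_measurable_indicator) auto
  have b: "(\<integral>\<^sup>+y. ennreal (?g y) \<partial>lborel) \<le> ennreal (sing_const p * \<sigma> powr (2 - p))"
    by (rule nn_integral_dist_powr_le[OF assms])
  have c: "0 \<le> sing_const p * \<sigma> powr (2 - p)" by (simp add: sing_const_def)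
  show i: "integrable lborel ?g"
    by (rule integrableI_nonneg[OF m]) (use b in \<open>auto simp: less_top[symmetric] top_unique intro: order_le_less_trans\<close>)
  have "ennreal (integral\<^sup>L lborel ?g) = (\<integral>\<^sup>+y. ennreal (?g y) \<partial>lborel)"
    by (rule nn_integral_eq_integral[symmetric, OF i]) auto
  with b have "ennreal (integral\<^sup>L lborel ?g) \<le> ennreal (sing_const p * \<sigma> powr (2 - p))" by simp
  then show "integral\<^sup>L lborel ?g \<le> sing_const p * \<sigma> powr (2 - p)"
    using c by (simp add: ennreal_le_iff)
qed

section \<open>Bounded densities of bounded support and their singular integrals\<close>

declare split_paired_All [simp del] split_paired_Ex [simp del]

definition bounded_density :: "real \<Rightarrow> real \<Rightarrow> (plane \<Rightarrow> real) \<Rightarrow> bool" where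
  "bounded_density B \<rho> \<zeta> \<longleftrightarrow> \<zeta> \<in> borel_measurable borel \<and> (\<forall>x. \<bar>\<zeta> x\<bar> \<le> B) \<and> (\<forall>x. norm x > \<rho> \<longrightarrow> \<zeta> x = 0)"

lemma dens_measurable [measurable_dest]: "bounded_density B \<rho> \<zeta> \<Longrightarrow> \<zeta> \<in> borel_measurable borel"
  by (simp add: bounded_density_def)

lemma dens_bound: "bounded_density B \<rho> \<zeta> \<Longrightarrow> \<bar>\<zeta> x\<bar> \<le> B"
  by (simp add: bounded_density_def)

lemma dens_bound_nonneg: "bounded_density B \<rho> \<zeta> \<Longrightarrow> 0 \<le> B"
  using dens_bound[of B \<rho> \<zeta> 0] by simp

lemma integral_norm_bound_AE:
  fixes f :: "'a \<Rightarrow> 'b::{banach, second_countable_topology}"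
  assumes "integrable M f" "integrable M g" "AE x in M. norm (f x) \<le> g x"
  shows "norm (integral\<^sup>L M f) \<le> integral\<^sup>L M g"
  by (rule order_trans[OF integral_norm_bound integral_mono_AE]) (use assms in auto)

lemma dens_integrable_bounded:
  fixes g :: "'a::euclidean_space \<Rightarrow> 'b::{banach, second_countable_topology}"
  assumes "g \<in> borel_measurable borel" "\<And>x. norm (g x) \<le> B" "\<And>x. norm x > \<rho> \<Longrightarrow> g x = 0"
  shows "integrable lborel g"
proof (rule Bochner_Integration.integrable_bound[of _ "\<lambda>x. B * indicator (cball 0 \<rho>) x"])
  show "integrable lborel (\<lambda>x::'a. B * indicator (cball 0 \<rho>) x)"
    using emeasure_lborel_cball_finite[of "0::'a" \<rho>]
    by (intro integrable_mult_right integrable_real_indicator) auto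
  show "AE x in lborel. norm (g x) \<le> norm (B * indicator (cball 0 \<rho>) x)"
    using assms(2,3) by (intro AE_I2) (auto simp: indicator_def not_le intro: order_trans[OF _ abs_ge_self])
qed (use assms in auto)

lemma dens_integrable: "bounded_density B \<rho> \<zeta> \<Longrightarrow> integrable lborel \<zeta>"
  by (rule dens_integrable_bounded[of _ B \<rho>]) (auto simp: bounded_density_def)

text \<open>Split at distance \<sigma> from x: inside, \<zeta> is bounded by B and the singularity
  is integrated; outside, the kernel is at most \<sigma> to the power -p. The free radius \<sigma>
  separates the sup bound from the mass.\<close>

lemma
  assumes d: "bounded_density B \<rho> \<zeta>" and p: "0 < p" "p < 2"
  shows dens_integrable_dist_powr: "integrable lborel (\<lambda>y. dist x y powr - p * \<bar>\<zeta> y\<bar>)"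
    and dens_integral_dist_powr_le: "\<sigma> > 0 \<Longrightarrow> (\<integral>y. dist x y powr - p * \<bar>\<zeta> y\<bar> \<partial>lborel)
      \<le> B * sing_const p * \<sigma> powr (2 - p) + \<sigma> powr - p * (\<integral>y. \<bar>\<zeta> y\<bar> \<partial>lborel)"
proof -
  note [measurable] = dens_measurable[OF d]
  let ?b = "\<lambda>\<sigma> y. B * (dist x y powr - p * indicator (cball x \<sigma>) y) + \<sigma> powr - p * \<bar>\<zeta> y\<bar>"
  have bi: "integrable lborel (?b \<sigma>)" if "\<sigma> > 0" for \<sigma>
    using integrable_dist_powr_cball[OF p that, of x] dens_integrable[OF d] by simp
  have le: "dist x y powr - p * \<bar>\<zeta> y\<bar> \<le> ?b \<sigma> y" if s: "\<sigma> > 0" for \<sigma> y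
  proof (cases "y \<in> cball x \<sigma>")
    case True
    then show ?thesis using dens_bound[OF d, of y]
      by (auto simp: mult.commute[of B] intro!: add_increasing2 mult_left_mono)
  next
    case False
    then show ?thesis using p s by (auto intro!: mult_right_mono powr_mono2')
  qed
  show i: "integrable lborel (\<lambda>y. dist x y powr - p * \<bar>\<zeta> y\<bar>)"
    by (rule Bochner_Integration.integrable_bound[OF bi[of 1]])
      (measurable, intro AE_I2, unfold real_norm_def abs_mult abs_abs,
        rule order_trans[OF _ abs_ge_self], use le[of 1] in simp)
  show "(\<integral>y. dist x y powr - p * \<bar>\<zeta> y\<bar> \<partial>lborel)
      \<le> B * sing_const p * \<sigma> powr (2 - p) + \<sigma> powr - p * (\<integral>y. \<bar>\<zeta> y\<bar> \<partial>lborel)" if s: "\<sigma> > 0"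
  proof -
    have "(\<integral>y. dist x y powr - p * \<bar>\<zeta> y\<bar> \<partial>lborel) \<le> integral\<^sup>L lborel (?b \<sigma>)"
      by (rule integral_mono[OF i bi[OF s] le[OF s]])
    also have "\<dots> = B * (\<integral>y. dist x y powr - p * indicator (cball x \<sigma>) y \<partial>lborel) + \<sigma> powr - p * (\<integral>y. \<bar>\<zeta> y\<bar> \<partial>lborel)"
      using integrable_dist_powr_cball[OF p s, of x] dens_integrable[OF d] by simp
    also have "\<dots> \<le> B * (sing_const p * \<sigma> powr (2 - p)) + \<sigma> powr - p * (\<integral>y. \<bar>\<zeta> y\<bar> \<partial>lborel)"
      using integral_dist_powr_cball_le[OF p s, of x] dens_bound_nonneg[OF d]
      by (intro add_right_mono mult_left_mono) auto
    finally show ?thesis by (simp add: mult.assoc)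
  qed
qed

text \<open>From ln d \<le> d and - ln d \<le> 1 / d; at d = 0 both sides are 0 by convention. It
  reduces integrability of the logarithmic kernel to that of the inverse distance.\<close>

lemma abs_ln_inverse_le:
  fixes d :: real
  assumes "d \<ge> 0"
  shows "\<bar>ln (1 / d)\<bar> \<le> d + d powr - 1"
proof (cases "d = 0")
  case False
  then have d: "d > 0" using assms by simp
  have "ln d \<le> d" using ln_le_minus_one[OF d] by simp
  moreover have "- ln d \<le> 1 / d" using ln_le_minus_one[of "1 / d"] d by (simp add: ln_div)
  moreover have "d powr - 1 = 1 / d" using d by (simp add: powr_minus_divide)
  moreover have "0 \<le> 1 / d" using d by simp
  moreover have "ln (1 / d) = - ln d" using d by (simp add: ln_div)
  ultimately show ?thesis using d by linarith
qed simp

lemma dens_integrable_log: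
  assumes d: "bounded_density B \<rho> \<zeta>"
  shows "integrable lborel (\<lambda>y. ln (1 / dist x y) * \<zeta> y)"
proof (rule Bochner_Integration.integrable_bound)
  note [measurable] = dens_measurable[OF d]
  show "integrable lborel (\<lambda>y. (norm x + \<bar>\<rho>\<bar>) * \<bar>\<zeta> y\<bar> + dist x y powr - 1 * \<bar>\<zeta> y\<bar>)"
    using dens_integrable[OF d] dens_integrable_dist_powr[OF d, of 1 x] by simp
  show "AE y in lborel. norm (ln (1 / dist x y) * \<zeta> y)
      \<le> norm ((norm x + \<bar>\<rho>\<bar>) * \<bar>\<zeta> y\<bar> + dist x y powr - 1 * \<bar>\<zeta> y\<bar>)"
  proof (rule AE_I2)
    fix y
    show "norm (ln (1 / dist x y) * \<zeta> y)
      \<le> norm ((norm x + \<bar>\<rho>\<bar>) * \<bar>\<zeta> y\<bar> + dist x y powr - 1 * \<bar>\<zeta> y\<bar>)"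
    proof (cases "norm y \<le> \<rho>")
      case True
      have "\<bar>ln (1 / dist x y)\<bar> \<le> dist x y + dist x y powr - 1" by (rule abs_ln_inverse_le) simp
      moreover have "dist x y \<le> norm x + \<bar>\<rho>\<bar>"
        using norm_triangle_ineq4[of x y] True by (simp add: dist_norm)
      ultimately have "\<bar>ln (1 / dist x y)\<bar> * \<bar>\<zeta> y\<bar> \<le> (norm x + \<bar>\<rho>\<bar> + dist x y powr - 1) * \<bar>\<zeta> y\<bar>"
        by (intro mult_right_mono) linarith+
      then show ?thesis by (simp add: abs_mult algebra_simps)
    qed (use d in \<open>simp add: bounded_density_def\<close>)
  qed
  show "(\<lambda>y. ln (1 / dist x y) * \<zeta> y) \<in> borel_measurable lborel" by measurable
qed

lemma ln_diff_le_inverse: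
  fixes a b :: real
  assumes "a > 0" "b > 0"
  shows "\<bar>ln a - ln b\<bar> \<le> \<bar>a - b\<bar> * (1 / a + 1 / b)"
proof -
  have "ln a - ln b \<le> (a - b) / b" using ln_le_minus_one[of "a / b"] assms by (simp add: ln_div field_simps)
  also have "\<dots> \<le> \<bar>a - b\<bar> * (1 / b)" using assms by (simp add: divide_simps)
  finally have 1: "ln a - ln b \<le> \<bar>a - b\<bar> * (1 / b)" .
  have "ln b - ln a \<le> (b - a) / a" using ln_le_minus_one[of "b / a"] assms by (simp add: ln_div field_simps)
  also have "\<dots> \<le> \<bar>a - b\<bar> * (1 / a)" using assms by (simp add: divide_simps)
  finally have 2: "ln b - ln a \<le> \<bar>a - b\<bar> * (1 / a)" .
  have 3: "0 \<le> \<bar>a - b\<bar> * (1 / a)" "0 \<le> \<bar>a - b\<bar> * (1 / b)" using assms by auto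
  show ?thesis using 1 2 3 by (simp add: distrib_left)
qed

text \<open>The exponent 3/2 is a compromise: it exceeds 1, so the remainder is o(\<bar>h\<bar>),
  and it is below 2, so the singularities on the right are integrable in the plane. Both points z
  and z + h occur because h may lead close to the origin.\<close>

lemma ln_norm_remainder:
  fixes z h :: "'a::real_inner"
  assumes z: "z \<noteq> 0" and zh: "z + h \<noteq> 0"
  shows "\<bar>ln (norm (z + h)) - ln (norm z) - (z \<bullet> h) / (norm z)\<^sup>2\<bar>
    \<le> 13 * norm h powr (3/2) * (norm z powr - (3/2) + norm (z + h) powr - (3/2))"
proof -
  define a where "a = norm z"
  define b where "b = norm (z + h)"
  define q where "q = norm h / a"
  have a: "a > 0" and b: "b > 0" using z zh by (auto simp: a_def b_def)
  have q0: "q \<ge> 0" using a by (simp add: q_def)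
  have p32: "t powr (3/2) = t * sqrt t" if "t \<ge> 0" for t :: real
  proof -
    have "t powr (3/2) = t powr 1 * t powr (1/2)" by (subst powr_add[symmetric]) simp
    then show ?thesis using that by (simp add: powr_half_sqrt del: powr_add)
  qed
  have qq: "norm h powr (3/2) * a powr - (3/2) = q powr (3/2)"
    using a by (simp add: q_def powr_divide powr_minus_divide)
  have qb: "norm h powr (3/2) * b powr - (3/2) = (norm h / b) powr (3/2)"
    using b by (simp add: powr_divide powr_minus_divide)
  have ih: "\<bar>z \<bullet> h\<bar> / a\<^sup>2 \<le> q"
    using Cauchy_Schwarz_ineq2[of z h] a by (simp add: q_def a_def divide_simps power2_eq_square mult.commute)
  have "\<bar>ln b - ln a - (z \<bullet> h) / a\<^sup>2\<bar> \<le> 13 * (q powr (3/2) + (norm h / b) powr (3/2))"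
  proof (cases "q \<le> 1/2")
    case True
    \<comment> \<open>\<open>v\<close> is the relative change of the squared norm, so ln b - ln a is
      half of ln (1 + v), which is expanded to second order; \<open>q \<le> 1/2\<close> keeps 1 + v
      away from 0.\<close>
    define v where "v = (2 * (z \<bullet> h) + (norm h)\<^sup>2) / a\<^sup>2"
    have bv: "b\<^sup>2 = a\<^sup>2 * (1 + v)"
      using a unfolding b_def a_def v_def by (simp add: power2_norm_eq_inner inner_add inner_commute field_simps)
    have "a - norm h \<le> b" unfolding a_def b_def by (metis norm_diff_ineq)
    moreover have "a - norm h \<ge> a / 2" using True a by (simp add: q_def field_simps)
    ultimately have "(a / 2)\<^sup>2 \<le> b\<^sup>2" using a by (intro power_mono) auto
    then have "a\<^sup>2 * (1/4) \<le> a\<^sup>2 * (1 + v)" using bv by (simp add: power_divide)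
    then have v4: "1 + v \<ge> 1/4" using a by (subst (asm) mult_le_cancel_left_pos) auto
    have vz: "(z \<bullet> h) / a\<^sup>2 = (v - q\<^sup>2) / 2"
      using a by (simp add: v_def q_def power_divide field_simps)
    have "\<bar>v\<bar> \<le> 2 * q + q\<^sup>2"
    proof -
      have "\<bar>(z \<bullet> h) / a\<^sup>2\<bar> \<le> q" using ih by simp
      then have "\<bar>v - q\<^sup>2\<bar> \<le> 2 * q" unfolding vz abs_divide by simp
      then show ?thesis using abs_triangle_ineq[of "v - q\<^sup>2" "q\<^sup>2"] by simp
    qed
    also have "q\<^sup>2 \<le> q / 2" using True q0 by (simp add: power2_eq_square mult_left_mono[of q "1/2" q, simplified])
    finally have "\<bar>v\<bar> \<le> 5/2 * q" by simp
    then have "\<bar>v\<bar>\<^sup>2 \<le> (5/2 * q)\<^sup>2" by (intro power_mono) auto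
    then have vv: "v\<^sup>2 \<le> 25/4 * q\<^sup>2" by (simp add: power_mult_distrib power2_eq_square)
    have "ln (1 + v) \<le> v" using ln_le_minus_one[of "1 + v"] v4 by simp
    moreover have "v - ln (1 + v) \<le> 4 * v\<^sup>2"
    proof -
      have "- ln (1 + v) \<le> 1 / (1 + v) - 1" using ln_le_minus_one[of "1 / (1 + v)"] v4 by (simp add: ln_div)
      then have "v - ln (1 + v) \<le> v\<^sup>2 / (1 + v)" using v4 by (simp add: field_simps power2_eq_square)
      also have "\<dots> \<le> v\<^sup>2 / (1/4)" using v4 by (intro divide_left_mono) auto
      finally show ?thesis by simp
    qed
    ultimately have l: "\<bar>ln (1 + v) - v\<bar> \<le> 25 * q\<^sup>2" using vv by (simp add: abs_if)
    have "2 * ln b = ln (b\<^sup>2)" "2 * ln a = ln (a\<^sup>2)" using a b by (auto simp: ln_realpow)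
    then have "2 * ln b = 2 * ln a + ln (1 + v)"
      using bv a v4 by (simp add: ln_mult)
    then have "2 * (ln b - ln a - (z \<bullet> h) / a\<^sup>2) = ln (1 + v) - v + q\<^sup>2" using vz by simp
    then have "\<bar>2 * (ln b - ln a - (z \<bullet> h) / a\<^sup>2)\<bar> \<le> 26 * q\<^sup>2" using l by (simp add: abs_if split: if_splits)
    then have "\<bar>ln b - ln a - (z \<bullet> h) / a\<^sup>2\<bar> \<le> 13 * q\<^sup>2" by simp
    also have "q\<^sup>2 \<le> q powr (3/2)"
    proof -
      have "sqrt q * sqrt q \<le> sqrt q * 1" using True q0 by (intro mult_left_mono) auto
      then show ?thesis using q0 unfolding p32[OF q0] power2_eq_square by (intro mult_left_mono) auto
    qed
    finally show ?thesis by (simp add: add_increasing2)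
  next
    case False
    \<comment> \<open>For large h there is no cancellation: both relative increments
      \<open>q\<close> and \<open>norm h / b\<close> are at least 1/4, and from there on a first
      power is dominated by twice the power 3/2.\<close>
    have key: "t \<le> 2 * t powr (3/2)" if "t \<ge> 1/4" for t :: real
    proof -
      have "sqrt (1/4) \<le> sqrt t" using that by (intro real_sqrt_le_mono) auto
      then have "1/2 \<le> sqrt t" by (simp add: real_sqrt_divide)
      then have "t * (1/2) \<le> t * sqrt t" using that by (intro mult_left_mono) auto
      then show ?thesis using that p32[of t] by simp
    qed
    have "b \<le> a + norm h" unfolding a_def b_def by (rule norm_triangle_ineq)
    also have "a < 2 * norm h" using False a by (simp add: q_def field_simps)
    finally have b3: "norm h / b \<ge> 1/4" using b by (simp add: field_simps)
    have "\<bar>ln b - ln a\<bar> \<le> \<bar>b - a\<bar> * (1 / b + 1 / a)" by (rule ln_diff_le_inverse[OF b a])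
    also have "\<dots> \<le> norm h * (1 / b + 1 / a)"
      using norm_triangle_ineq3[of "z + h" z] a b unfolding a_def b_def by (intro mult_right_mono) auto
    finally have "\<bar>ln b - ln a\<bar> \<le> norm h / b + q" using a b by (simp add: q_def field_simps)
    moreover have "\<bar>(z \<bullet> h) / a\<^sup>2\<bar> \<le> q" using ih by simp
    ultimately have "\<bar>ln b - ln a - (z \<bullet> h) / a\<^sup>2\<bar> \<le> norm h / b + 2 * q"
      using abs_triangle_ineq4[of "ln b - ln a" "(z \<bullet> h) / a\<^sup>2"] by linarith
    also have "\<dots> \<le> 2 * (norm h / b) powr (3/2) + 4 * q powr (3/2)"
      using key[OF b3] key[of q] False by simp
    also have "\<dots> \<le> 13 * (q powr (3/2) + (norm h / b) powr (3/2))"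
      using powr_ge_zero[of q "3/2"] powr_ge_zero[of "norm h / b" "3/2"] by argo
    finally show ?thesis .
  qed
  also have "\<dots> = 13 * norm h powr (3/2) * (a powr - (3/2) + b powr - (3/2))"
    by (simp add: qq[symmetric] qb[symmetric] algebra_simps)
  finally show ?thesis by (simp add: a_def b_def)
qed

section \<open>Regularity of the logarithmic potential\<close>

text \<open>The bound of \<open>dens_integral_dist_powr_le\<close> at radius 1. It involves \<zeta>
  only through its sup bound and its mass and holds at every point x.\<close>

definition pot_const :: "real \<Rightarrow> real \<Rightarrow> (plane \<Rightarrow> real) \<Rightarrow> real" where
  "pot_const p B \<zeta> = B * sing_const p + (\<integral>y. \<bar>\<zeta> y\<bar> \<partial>lborel)"

lemma pot_const_nonneg: "0 \<le> B \<Longrightarrow> 0 \<le> pot_const p B \<zeta>"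
  by (simp add: pot_const_def sing_const_def)

lemma dens_integral_dist_powr_le_pot_const:
  assumes "bounded_density B \<rho> \<zeta>" "0 < p" "p < 2"
  shows "(\<integral>y. dist x y powr - p * \<bar>\<zeta> y\<bar> \<partial>lborel) \<le> pot_const p B \<zeta>"
  using dens_integral_dist_powr_le[OF assms, of 1 x] by (simp add: pot_const_def)

definition grad_pot :: "(plane \<Rightarrow> real) \<Rightarrow> plane \<Rightarrow> plane" where
  "grad_pot \<zeta> x = (- 1 / (2 * pi)) *\<^sub>R (\<integral>y. (\<zeta> y / (dist x y)\<^sup>2) *\<^sub>R (x - y) \<partial>lborel)"

lemma dens_integrable_grad:
  assumes d: "bounded_density B \<rho> \<zeta>"
  shows "integrable lborel (\<lambda>y. (\<zeta> y / (dist x y)\<^sup>2) *\<^sub>R (x - y))"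
proof (rule Bochner_Integration.integrable_bound[OF dens_integrable_dist_powr[OF d, of 1 x]])
  note [measurable] = dens_measurable[OF d]
  show "(\<lambda>y. (\<zeta> y / (dist x y)\<^sup>2) *\<^sub>R (x - y)) \<in> borel_measurable lborel" by measurable
  have "norm ((\<zeta> y / (dist x y)\<^sup>2) *\<^sub>R (x - y)) \<le> norm (dist x y powr - 1 * \<bar>\<zeta> y\<bar>)" for y
    by (cases "x = y") (auto simp: dist_norm powr_minus_divide divide_simps power2_eq_square)
  then show "AE y in lborel. norm ((\<zeta> y / (dist x y)\<^sup>2) *\<^sub>R (x - y)) \<le> norm (dist x y powr - 1 * \<bar>\<zeta> y\<bar>)"
    by (intro AE_I2)
qed auto

text \<open>The remainder of ln is integrated against \<zeta>, which justifies differentiation under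
  the integral. The estimate is uniform in x, and this uniformity also yields continuity of the
  gradient.\<close>

lemma inv_neg_laplacian_remainder:
  assumes d: "bounded_density B \<rho> \<zeta>"
  shows "\<bar>inv_neg_laplacian \<zeta> (x + h) - inv_neg_laplacian \<zeta> x - grad_pot \<zeta> x \<bullet> h\<bar>
    \<le> (13 / pi * pot_const (3/2) B \<zeta>) * norm h powr (3/2)"
proof -
  let ?g = "\<lambda>y. (\<zeta> y / (dist x y)\<^sup>2) *\<^sub>R (x - y)"
  let ?l = "\<lambda>x y. ln (1 / dist x y) * \<zeta> y"
  let ?r = "\<lambda>y. ?l (x + h) y - ?l x y + ?g y \<bullet> h"
  let ?b = "\<lambda>y. 13 * norm h powr (3/2) * (dist x y powr - (3/2) * \<bar>\<zeta> y\<bar> + dist (x + h) y powr - (3/2) * \<bar>\<zeta> y\<bar>)"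
  note il = dens_integrable_log[OF d] and ig = dens_integrable_grad[OF d, of x]
  have ib: "integrable lborel ?b"
    using dens_integrable_dist_powr[OF d, of "3/2"] by simp
  have bd: "AE y in lborel. norm (?r y) \<le> ?b y"
    using AE_lborel_singleton[of x] AE_lborel_singleton[of "x + h"]
  proof eventually_elim
    fix y assume y: "y \<noteq> x" "y \<noteq> x + h"
    have e: "?r y = - \<zeta> y * (ln (norm (x - y + h)) - ln (norm (x - y)) - ((x - y) \<bullet> h) / (norm (x - y))\<^sup>2)"
    proof -
      have 1: "dist (x + h) y = norm (x - y + h)" "dist x y = norm (x - y)"
        by (simp_all add: dist_norm algebra_simps)
      have 2: "?g y \<bullet> h = \<zeta> y * (((x - y) \<bullet> h) / (norm (x - y))\<^sup>2)" by (simp add: dist_norm)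
      have "x - y + h \<noteq> 0" "x - y \<noteq> 0" using y by (auto simp: algebra_simps)
      then show ?thesis unfolding 2 unfolding 1 by (simp add: ln_div right_diff_distrib)
    qed
    have "\<bar>ln (norm (x - y + h)) - ln (norm (x - y)) - ((x - y) \<bullet> h) / (norm (x - y))\<^sup>2\<bar>
      \<le> 13 * norm h powr (3/2) * (norm (x - y) powr - (3/2) + norm (x - y + h) powr - (3/2))"
      by (rule ln_norm_remainder) (use y in \<open>auto simp: algebra_simps\<close>)
    then have "\<bar>\<zeta> y\<bar> * \<bar>ln (norm (x - y + h)) - ln (norm (x - y)) - ((x - y) \<bullet> h) / (norm (x - y))\<^sup>2\<bar>
      \<le> \<bar>\<zeta> y\<bar> * (13 * norm h powr (3/2) * (norm (x - y) powr - (3/2) + norm (x - y + h) powr - (3/2)))"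
      by (intro mult_left_mono) auto
    also have "\<dots> = ?b y"
      by (simp add: dist_norm algebra_simps)
    finally show "norm (?r y) \<le> ?b y" unfolding e by (simp add: abs_mult)
  qed
  have ir: "integrable lborel ?r"
    by (intro Bochner_Integration.integrable_add Bochner_Integration.integrable_diff il
        integrable_inner_left) (rule ig)
  have "norm (integral\<^sup>L lborel ?r) \<le> integral\<^sup>L lborel ?b"
    by (rule integral_norm_bound_AE[OF ir ib bd])
  also have "integral\<^sup>L lborel ?b = 13 * norm h powr (3/2) * ((\<integral>y. dist x y powr - (3/2) * \<bar>\<zeta> y\<bar> \<partial>lborel)
      + (\<integral>y. dist (x + h) y powr - (3/2) * \<bar>\<zeta> y\<bar> \<partial>lborel))"
    using dens_integrable_dist_powr[OF d, of "3/2"] by simp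
  also have "\<dots> \<le> 13 * norm h powr (3/2) * (pot_const (3/2) B \<zeta> + pot_const (3/2) B \<zeta>)"
    by (intro mult_left_mono add_mono dens_integral_dist_powr_le_pot_const[OF d]) auto
  finally have 1: "\<bar>integral\<^sup>L lborel ?r\<bar> \<le> 26 * norm h powr (3/2) * pot_const (3/2) B \<zeta>" by simp
  have "integral\<^sup>L lborel ?r = (\<integral>y. ?l (x + h) y \<partial>lborel) - (\<integral>y. ?l x y \<partial>lborel) + (\<integral>y. ?g y \<partial>lborel) \<bullet> h"
    by (subst Bochner_Integration.integral_add, intro Bochner_Integration.integrable_diff il,
        rule integrable_inner_left, rule ig, subst Bochner_Integration.integral_diff[OF il il],
        subst integral_inner_left[OF ig], rule refl)
  moreover have "grad_pot \<zeta> x \<bullet> h = - (1 / (2 * pi)) * ((\<integral>y. ?g y \<partial>lborel) \<bullet> h)"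
    unfolding grad_pot_def inner_scaleR_left by simp
  moreover have "c * u - c * v - (- c * w) = c * (u - v + w)" for c u v w :: real by algebra
  ultimately have "inv_neg_laplacian \<zeta> (x + h) - inv_neg_laplacian \<zeta> x - grad_pot \<zeta> x \<bullet> h
      = 1 / (2 * pi) * integral\<^sup>L lborel ?r"
    unfolding inv_neg_laplacian_def by presburger
  also have "\<bar>\<dots>\<bar> \<le> 1 / (2 * pi) * (26 * norm h powr (3/2) * pot_const (3/2) B \<zeta>)"
    unfolding abs_mult using 1 by (intro mult_mono) auto
  finally show ?thesis by (simp add: field_simps)
qed

text \<open>For the continuity of g, reach the point x + h + k both from x and from x + h. The
  difference of the expansions is (g (x + h) - g x) \<bullet> k up to remainders, and k of length
  \<bar>h\<bar> along g (x + h) - g x gives a Hoelder bound with exponent 1/2.\<close>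

lemma has_derivative_if_remainder_powr:
  fixes F :: "plane \<Rightarrow> real"
  assumes R: "\<And>x h. \<bar>F (x + h) - F x - g x \<bullet> h\<bar> \<le> C * norm h powr (3/2)"
  shows "(F has_derivative (\<lambda>h. g x \<bullet> h)) (at x)"
    and "continuous_on UNIV g"
proof -
  have C: "C \<ge> 0" using order_trans[OF abs_ge_zero R[of 0 "(1, 0)"]] by simp
  show "(F has_derivative (\<lambda>h. g x \<bullet> h)) (at x)"
  proof (rule has_derivativeI_sandwich[where e = 1 and H = "\<lambda>y. C * norm (y - x) powr (1/2)"])
    show "bounded_linear (\<lambda>h. g x \<bullet> h)" by (rule bounded_linear_inner_right)
    have "((\<lambda>y. C * norm (y - x) powr (1/2)) \<longlongrightarrow> C * norm (x - x) powr (1/2)) (at x)"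
      by (intro tendsto_intros) auto
    then show "((\<lambda>y. C * norm (y - x) powr (1/2)) \<longlongrightarrow> 0) (at x)" by simp
    fix y assume y: "y \<noteq> x"
    have "norm (y - x) powr (3/2) = norm (y - x) powr 1 * norm (y - x) powr (1/2)"
      by (subst powr_add[symmetric]) simp
    then have "C * norm (y - x) powr (3/2) / norm (y - x) = C * norm (y - x) powr (1/2)"
      using y by simp
    moreover have "norm (F y - F x - g x \<bullet> (y - x)) / norm (y - x) \<le> C * norm (y - x) powr (3/2) / norm (y - x)"
      using R[of x "y - x"] by (intro divide_right_mono) auto
    ultimately show "norm (F y - F x - g x \<bullet> (y - x)) / norm (y - x) \<le> C * norm (y - x) powr (1/2)" by simp
  qed auto
  have hold: "norm (g (x + h) - g x) \<le> 6 * C * norm h powr (1/2)" for x h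
  proof (cases "g (x + h) = g x \<or> h = 0")
    case False
    define w where "w = g (x + h) - g x"
    define k where "k = (norm h / norm w) *\<^sub>R w"
    have w: "norm w > 0" and h: "norm h > 0" using False by (auto simp: w_def)
    have nk: "norm k = norm h" using w by (simp add: k_def)
    have "w \<bullet> k = norm h * norm w" using w by (simp add: k_def power2_norm_eq_inner[symmetric] power2_eq_square)
    moreover have "w \<bullet> k = (F (x + h + k) - F x - g x \<bullet> (h + k)) - (F (x + h) - F x - g x \<bullet> h)
        - (F (x + h + k) - F (x + h) - g (x + h) \<bullet> k)"
      by (simp add: w_def inner_add_right inner_diff_left)
    ultimately have "norm h * norm w \<le> \<bar>F (x + (h + k)) - F x - g x \<bullet> (h + k)\<bar> + \<bar>F (x + h) - F x - g x \<bullet> h\<bar>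
        + \<bar>F (x + h + k) - F (x + h) - g (x + h) \<bullet> k\<bar>" by (simp add: add.assoc)
    also have "\<dots> \<le> C * norm (h + k) powr (3/2) + C * norm h powr (3/2) + C * norm k powr (3/2)"
      by (intro add_mono R)
    also have "\<dots> \<le> C * (4 * norm h powr (3/2)) + C * norm h powr (3/2) + C * norm h powr (3/2)"
    proof -
      have "norm (h + k) powr (3/2) \<le> (2 * norm h) powr (3/2)"
        using norm_triangle_ineq[of h k] nk by (intro powr_mono2) auto
      also have "\<dots> = 2 powr (3/2) * norm h powr (3/2)" by (simp add: powr_mult)
      also have "\<dots> \<le> 2 powr 2 * norm h powr (3/2)" by (intro mult_right_mono powr_mono) auto
      finally have "norm (h + k) powr (3/2) \<le> 4 * norm h powr (3/2)" by simp
      then have "C * norm (h + k) powr (3/2) \<le> C * (4 * norm h powr (3/2))" by (rule mult_left_mono[OF _ C])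
      then show ?thesis using nk by simp
    qed
    also have "\<dots> = norm h * (6 * C * norm h powr (1/2))"
    proof -
      have "norm h powr (3/2) = norm h powr 1 * norm h powr (1/2)"
        by (subst powr_add[symmetric]) simp
      then show ?thesis by simp
    qed
    finally have "norm h * norm w \<le> norm h * (6 * C * norm h powr (1/2))" .
    then show ?thesis using h unfolding w_def by simp
  qed (use C in auto)
  show "continuous_on UNIV g"
  proof (rule continuous_at_imp_continuous_on, rule ballI)
    fix x :: plane
    have "((\<lambda>y. 6 * C * norm (y - x) powr (1/2)) \<longlongrightarrow> 6 * C * norm (x - x) powr (1/2)) (at x)"
      by (intro tendsto_intros) auto
    then have "((\<lambda>y. 6 * C * norm (y - x) powr (1/2)) \<longlongrightarrow> 0) (at x)" by simp
    then have "((\<lambda>y. g y - g x) \<longlongrightarrow> 0) (at x)"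
      by (rule Lim_null_comparison[rotated]) (use hold[of x "_ - x"] in \<open>auto intro!: always_eventually\<close>)
    then show "isCont g x" unfolding isCont_def by (simp add: LIM_zero_iff)
  qed
qed

lemma inv_neg_laplacian_has_derivative:
  assumes "bounded_density B \<rho> \<zeta>"
  shows "(inv_neg_laplacian \<zeta> has_derivative (\<lambda>h. grad_pot \<zeta> x \<bullet> h)) (at x)"
    and "continuous_on UNIV (grad_pot \<zeta>)"
  using has_derivative_if_remainder_powr[OF inv_neg_laplacian_remainder[OF assms]] by auto

text \<open>The constant depends only on the sup bound and the mass of \<zeta>, so all potentials of
  the admissible class are equicontinuous.\<close>

lemma inv_neg_laplacian_lipschitz:
  assumes d: "bounded_density B \<rho> \<zeta>"
  shows "\<bar>inv_neg_laplacian \<zeta> x - inv_neg_laplacian \<zeta> x'\<bar> \<le> pot_const 1 B \<zeta> * dist x x'"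
proof -
  let ?l = "\<lambda>x y. ln (1 / dist x y) * \<zeta> y"
  let ?b = "\<lambda>y. dist x x' * (dist x y powr - 1 * \<bar>\<zeta> y\<bar> + dist x' y powr - 1 * \<bar>\<zeta> y\<bar>)"
  note il = dens_integrable_log[OF d]
  have ib: "integrable lborel ?b" using dens_integrable_dist_powr[OF d, of 1] by simp
  have bd: "AE y in lborel. norm (?l x y - ?l x' y) \<le> ?b y"
    using AE_lborel_singleton[of x] AE_lborel_singleton[of x']
  proof eventually_elim
    fix y assume y: "y \<noteq> x" "y \<noteq> x'"
    have "\<bar>ln (dist x y) - ln (dist x' y)\<bar> \<le> \<bar>dist x y - dist x' y\<bar> * (1 / dist x y + 1 / dist x' y)"
      using y by (intro ln_diff_le_inverse) auto
    also have "\<dots> \<le> dist x x' * (1 / dist x y + 1 / dist x' y)"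
      using dist_triangle[of x y x'] dist_triangle[of x' y x]
      by (intro mult_right_mono) (auto simp: dist_commute abs_le_iff)
    finally have "\<bar>ln (dist x y) - ln (dist x' y)\<bar> * \<bar>\<zeta> y\<bar> \<le> dist x x' * (1 / dist x y + 1 / dist x' y) * \<bar>\<zeta> y\<bar>"
      by (intro mult_right_mono) auto
    moreover have e: "?l x y - ?l x' y = - (ln (dist x y) - ln (dist x' y)) * \<zeta> y"
      using y by (simp add: ln_div algebra_simps)
    ultimately show "norm (?l x y - ?l x' y) \<le> ?b y"
      unfolding e real_norm_def abs_mult abs_minus_cancel using y by (simp add: powr_minus_divide algebra_simps)
  qed
  have "norm (integral\<^sup>L lborel (\<lambda>y. ?l x y - ?l x' y)) \<le> integral\<^sup>L lborel ?b"
    by (rule integral_norm_bound_AE[OF _ ib bd]) (use il in simp)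
  also have "\<dots> \<le> dist x x' * (pot_const 1 B \<zeta> + pot_const 1 B \<zeta>)"
  proof -
    have "integral\<^sup>L lborel ?b = dist x x' * ((\<integral>y. dist x y powr - 1 * \<bar>\<zeta> y\<bar> \<partial>lborel) + (\<integral>y. dist x' y powr - 1 * \<bar>\<zeta> y\<bar> \<partial>lborel))"
      using dens_integrable_dist_powr[OF d, of 1] by simp
    then show ?thesis
      by (simp only:) (intro mult_left_mono add_mono dens_integral_dist_powr_le_pot_const[OF d], auto)
  qed
  finally have 1: "\<bar>integral\<^sup>L lborel (?l x) - integral\<^sup>L lborel (?l x')\<bar> \<le> 2 * (dist x x' * pot_const 1 B \<zeta>)"
    using il by simp
  have "\<bar>inv_neg_laplacian \<zeta> x - inv_neg_laplacian \<zeta> x'\<bar>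
      = 1 / (2 * pi) * \<bar>integral\<^sup>L lborel (?l x) - integral\<^sup>L lborel (?l x')\<bar>"
    unfolding inv_neg_laplacian_def right_diff_distrib[symmetric] abs_mult by simp
  also have "\<dots> \<le> 1 / (2 * pi) * (2 * (dist x x' * pot_const 1 B \<zeta>))"
    using 1 by (intro mult_left_mono) auto
  also have "\<dots> = 1 / pi * (dist x x' * pot_const 1 B \<zeta>)" by simp
  also have "\<dots> \<le> 1 * (dist x x' * pot_const 1 B \<zeta>)"
    using pi_ge_two pot_const_nonneg[OF dens_bound_nonneg[OF d]]
    by (intro mult_right_mono) auto
  finally show ?thesis by (simp add: mult.commute)
qed

lemma dens_integral_abs_log_le:
  assumes d: "bounded_density B \<rho> \<zeta>"
  shows "(\<integral>y. \<bar>ln (1 / dist x y) * \<zeta> y\<bar> \<partial>lborel)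
    \<le> (norm x + \<bar>\<rho>\<bar>) * (\<integral>y. \<bar>\<zeta> y\<bar> \<partial>lborel) + pot_const 1 B \<zeta>"
proof -
  let ?b = "\<lambda>y. (norm x + \<bar>\<rho>\<bar>) * \<bar>\<zeta> y\<bar> + dist x y powr - 1 * \<bar>\<zeta> y\<bar>"
  note i1 = integrable_mult_right[OF integrable_abs[OF dens_integrable[OF d]], of "norm x + \<bar>\<rho>\<bar>"]
    and i2 = dens_integrable_dist_powr[OF d, of 1 x]
  have "\<bar>ln (1 / dist x y) * \<zeta> y\<bar> \<le> ?b y" for y
  proof (cases "norm y \<le> \<rho>")
    case True
    have "\<bar>ln (1 / dist x y)\<bar> \<le> dist x y + dist x y powr - 1" by (rule abs_ln_inverse_le) simp
    moreover have "dist x y \<le> norm x + \<bar>\<rho>\<bar>"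
      using norm_triangle_ineq4[of x y] True by (simp add: dist_norm)
    ultimately have "\<bar>ln (1 / dist x y)\<bar> * \<bar>\<zeta> y\<bar> \<le> (norm x + \<bar>\<rho>\<bar> + dist x y powr - 1) * \<bar>\<zeta> y\<bar>"
      by (intro mult_right_mono) linarith+
    then show ?thesis by (simp add: abs_mult algebra_simps)
  qed (use d in \<open>simp add: bounded_density_def\<close>)
  then have "(\<integral>y. \<bar>ln (1 / dist x y) * \<zeta> y\<bar> \<partial>lborel) \<le> integral\<^sup>L lborel ?b"
    by (intro integral_mono integrable_abs dens_integrable_log[OF d] Bochner_Integration.integrable_add i1 i2) auto
  also have "\<dots> = (norm x + \<bar>\<rho>\<bar>) * (\<integral>y. \<bar>\<zeta> y\<bar> \<partial>lborel) + (\<integral>y. dist x y powr - 1 * \<bar>\<zeta> y\<bar> \<partial>lborel)"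
    using Bochner_Integration.integral_add[OF i1 i2] by simp
  finally show ?thesis using dens_integral_dist_powr_le_pot_const[OF d, of 1 x] by linarith
qed

lemma inv_neg_laplacian_bound:
  assumes d: "bounded_density B \<rho> \<zeta>"
  shows "\<bar>inv_neg_laplacian \<zeta> x\<bar> \<le> (norm x + \<bar>\<rho>\<bar>) * (\<integral>y. \<bar>\<zeta> y\<bar> \<partial>lborel) + pot_const 1 B \<zeta>"
proof -
  have "\<bar>inv_neg_laplacian \<zeta> x\<bar> = 1 / (2 * pi) * \<bar>\<integral>y. ln (1 / dist x y) * \<zeta> y \<partial>lborel\<bar>"
    unfolding inv_neg_laplacian_def abs_mult by simp
  also have "\<dots> \<le> 1 * \<bar>\<integral>y. ln (1 / dist x y) * \<zeta> y \<partial>lborel\<bar>"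
    using pi_ge_two by (intro mult_right_mono) (auto simp: divide_simps)
  also have "\<dots> \<le> 1 * (\<integral>y. \<bar>ln (1 / dist x y) * \<zeta> y\<bar> \<partial>lborel)"
    by (intro mult_left_mono integral_abs_bound) simp
  finally show ?thesis using dens_integral_abs_log_le[OF d, of x] by simp
qed

lemma inv_neg_laplacian_signed_translation:
  assumes d: "bounded_density B \<rho> \<zeta>" and s: "\<bar>s1\<bar> = 1" "\<bar>s2\<bar> = 1"
  shows "inv_neg_laplacian (\<lambda>y. \<zeta> (t1 + s1 * fst y, t2 + s2 * snd y)) x
    = inv_neg_laplacian \<zeta> (t1 + s1 * fst x, t2 + s2 * snd x)"
proof -
  note [measurable] = dens_measurable[OF d]
  have s': "s1\<^sup>2 = 1" "s2\<^sup>2 = 1" using s by (metis one_power2 power2_abs)+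
  have e: "dist (t1 + s1 * fst x, t2 + s2 * snd x) (t1 + s1 * fst y, t2 + s2 * snd y) = dist x y" for y
  proof -
    have "(s1 * fst x - s1 * fst y)\<^sup>2 = (fst x - fst y)\<^sup>2" "(s2 * snd x - s2 * snd y)\<^sup>2 = (snd x - snd y)\<^sup>2"
      using s' by (simp_all add: right_diff_distrib[symmetric] power_mult_distrib)
    then show ?thesis by (simp add: dist_prod_def dist_real_def)
  qed
  have "(\<integral>y. ln (1 / dist (t1 + s1 * fst x, t2 + s2 * snd x) (t1 + s1 * fst y, t2 + s2 * snd y))
        * \<zeta> (t1 + s1 * fst y, t2 + s2 * snd y) \<partial>lborel)
    = (\<integral>y. ln (1 / dist (t1 + s1 * fst x, t2 + s2 * snd x) y) * \<zeta> y \<partial>lborel)"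
    by (rule integral_signed_translation[OF s, where g = "\<lambda>y. ln (1 / dist (t1 + s1 * fst x, t2 + s2 * snd x) y) * \<zeta> y"])
      measurable
  then show ?thesis unfolding inv_neg_laplacian_def e by simp
qed

section \<open>The Green function of the half plane\<close>

definition reflect :: "plane \<Rightarrow> plane" where
  "reflect x = (- fst x, snd x)"

lemma reflect_simps [simp]:
  "fst (reflect x) = - fst x" "snd (reflect x) = snd x" "reflect (reflect x) = x"
  "norm (reflect x) = norm x" "reflect (a, b) = (- a, b)"
  by (auto simp: reflect_def norm_prod_def)

lemma reflect_measurable [measurable]: "reflect \<in> borel_measurable borel"
  unfolding reflect_def by (intro borel_measurable_continuous_onI continuous_intros)

lemma dist_reflect: "dist (reflect x) y = dist x (reflect y)"
proof -
  have "(- fst x - fst y)\<^sup>2 = (fst x + fst y)\<^sup>2" by (simp add: power2_eq_square algebra_simps)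
  then show ?thesis by (simp add: dist_prod_def dist_real_def)
qed

text \<open>2 \<pi> times the Dirichlet Green function of the half plane, by the method of images;
  the factor 1 / (2 \<pi>) enters in \<open>green\<close>.\<close>

definition green_kernel :: "plane \<Rightarrow> plane \<Rightarrow> real" where
  "green_kernel x y = ln (1 / dist x y) - ln (1 / dist (reflect x) y)"

text \<open>Reflecting the point instead of the density lets the regularity of the planar potential
  carry over; \<open>inv_neg_laplacian_odd_ext\<close> identifies the result with the potential of
  the odd extension.\<close>

definition green :: "(plane \<Rightarrow> real) \<Rightarrow> plane \<Rightarrow> real" where
  "green \<zeta> x = inv_neg_laplacian \<zeta> x - inv_neg_laplacian \<zeta> (reflect x)"

lemma green_kernel_sym: "green_kernel x y = green_kernel y x"
  unfolding green_kernel_def using dist_reflect[of x y] by (metis dist_commute)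

lemma green_kernel_eq:
  assumes "y \<noteq> x" "y \<noteq> reflect x"
  shows "green_kernel x y = ln (dist (reflect x) y / dist x y)"
    and "green_kernel x y = 1 / 2 * ln (((fst x + fst y)\<^sup>2 + (snd x - snd y)\<^sup>2) / ((fst x - fst y)\<^sup>2 + (snd x - snd y)\<^sup>2))"
proof -
  have p: "dist x y > 0" "dist (reflect x) y > 0" using assms by auto
  then show e: "green_kernel x y = ln (dist (reflect x) y / dist x y)"
    by (simp add: green_kernel_def ln_div)
  have "(dist (reflect x) y)\<^sup>2 = (fst x + fst y)\<^sup>2 + (snd x - snd y)\<^sup>2" "(dist x y)\<^sup>2 = (fst x - fst y)\<^sup>2 + (snd x - snd y)\<^sup>2"
    using power2_minus[of "fst x + fst y"] by (auto simp: dist_prod_def dist_real_def)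
  moreover have "ln ((dist (reflect x) y)\<^sup>2 / (dist x y)\<^sup>2) = 2 * ln (dist (reflect x) y / dist x y)"
    using p by (simp add: power_divide[symmetric] ln_realpow)
  ultimately show "green_kernel x y = 1 / 2 * ln (((fst x + fst y)\<^sup>2 + (snd x - snd y)\<^sup>2) / ((fst x - fst y)\<^sup>2 + (snd x - snd y)\<^sup>2))"
    unfolding e by simp
qed

lemma dist_le_dist_reflect:
  assumes "fst x \<ge> 0" "fst y \<ge> 0" shows "dist x y \<le> dist (reflect x) y"
proof -
  have "0 \<le> fst x * fst y" using assms by simp
  then have "(fst x - fst y)\<^sup>2 \<le> (- fst x - fst y)\<^sup>2" by (simp add: power2_eq_square algebra_simps)
  then show ?thesis by (simp add: dist_prod_def dist_real_def)
qed

lemma green_kernel_nonneg: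
  assumes "fst x > 0" "fst y > 0" "y \<noteq> x" shows "green_kernel x y \<ge> 0"
proof -
  have "y \<noteq> reflect x" using assms by auto
  then have "green_kernel x y = ln (dist (reflect x) y / dist x y)" by (rule green_kernel_eq(1)[OF assms(3)])
  then show ?thesis using dist_le_dist_reflect[of x y] assms by simp
qed

lemma dens_integrable_green_kernel:
  assumes "bounded_density B \<rho> \<zeta>" shows "integrable lborel (\<lambda>y. green_kernel x y * \<zeta> y)"
  using dens_integrable_log[OF assms] by (simp add: green_kernel_def left_diff_distrib)

lemma green_eq_integral:
  assumes "bounded_density B \<rho> \<zeta>"
  shows "green \<zeta> x = 1 / (2 * pi) * (\<integral>y. green_kernel x y * \<zeta> y \<partial>lborel)"
  using dens_integrable_log[OF assms]
  by (simp add: green_kernel_def left_diff_distrib green_def inv_neg_laplacian_def right_diff_distrib)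

lemma green_reflect [simp]: "green \<zeta> (reflect x) = - green \<zeta> x"
  by (simp add: green_def)

definition odd_ext :: "(plane \<Rightarrow> real) \<Rightarrow> plane \<Rightarrow> real" where
  "odd_ext \<zeta> x = \<zeta> x - \<zeta> (reflect x)"

lemma dens_reflect: "bounded_density B \<rho> \<zeta> \<Longrightarrow> bounded_density B \<rho> (\<lambda>x. \<zeta> (reflect x))"
  by (auto simp: bounded_density_def intro!: measurable_compose[OF reflect_measurable])

lemma inv_neg_laplacian_odd_ext:
  assumes d: "bounded_density B \<rho> \<zeta>"
  shows "inv_neg_laplacian (odd_ext \<zeta>) = green \<zeta>"
proof
  fix x
  have "inv_neg_laplacian (odd_ext \<zeta>) x = inv_neg_laplacian \<zeta> x - inv_neg_laplacian (\<lambda>y. \<zeta> (reflect y)) x"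
    using dens_integrable_log[OF d] dens_integrable_log[OF dens_reflect[OF d]]
    by (simp add: inv_neg_laplacian_def odd_ext_def right_diff_distrib)
  also have "inv_neg_laplacian (\<lambda>y. \<zeta> (reflect y)) x = inv_neg_laplacian \<zeta> (reflect x)"
    using inv_neg_laplacian_signed_translation[OF d, of "-1" 1 0 0 x] by (simp add: reflect_def)
  finally show "inv_neg_laplacian (odd_ext \<zeta>) x = green \<zeta> x" by (simp add: green_def)
qed

text \<open>\<open>T\<close> will be the identity and the reflection, which gives the two terms of
  the Green kernel.\<close>

lemma integrable_pair_log:
  assumes d: "bounded_density B \<rho> \<zeta>" and e: "bounded_density B' \<rho>' \<eta>"
    and T[measurable]: "T \<in> borel_measurable borel" and nT: "\<And>x. norm (T x) = norm x"
  shows "integrable (lborel \<Otimes>\<^sub>M lborel) (\<lambda>(x, y). ln (1 / dist (T x) y) * (\<eta> x * \<zeta> y))"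
proof (rule lborel_pair.Fubini_integrable)
  note [measurable] = dens_measurable[OF d] dens_measurable[OF e]
  show "(\<lambda>(x, y). ln (1 / dist (T x) y) * (\<eta> x * \<zeta> y)) \<in> borel_measurable (lborel \<Otimes>\<^sub>M lborel)" by measurable
  let ?C = "(\<bar>\<rho>'\<bar> + \<bar>\<rho>\<bar>) * (\<integral>y. \<bar>\<zeta> y\<bar> \<partial>lborel) + pot_const 1 B \<zeta>"
  have eq: "(\<integral>y. norm (ln (1 / dist (T x) y) * (\<eta> x * \<zeta> y)) \<partial>lborel)
      = \<bar>\<eta> x\<bar> * (\<integral>y. \<bar>ln (1 / dist (T x) y) * \<zeta> y\<bar> \<partial>lborel)" for x
    by (subst integral_mult_right_zero[symmetric]) (simp add: abs_mult mult_ac)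
  have "integrable lborel (\<lambda>x. \<bar>\<eta> x\<bar> * (\<integral>y. \<bar>ln (1 / dist (T x) y) * \<zeta> y\<bar> \<partial>lborel))"
  proof (rule Bochner_Integration.integrable_bound)
    show "integrable lborel (\<lambda>x. \<bar>\<eta> x\<bar> * ?C)" using dens_integrable[OF e] by simp
    have "\<bar>\<eta> x\<bar> * (\<integral>y. \<bar>ln (1 / dist (T x) y) * \<zeta> y\<bar> \<partial>lborel) \<le> \<bar>\<eta> x\<bar> * ?C" for x
    proof (cases "norm x \<le> \<rho>'")
      case True
      have "(\<integral>y. \<bar>ln (1 / dist (T x) y) * \<zeta> y\<bar> \<partial>lborel) \<le> (norm (T x) + \<bar>\<rho>\<bar>) * (\<integral>y. \<bar>\<zeta> y\<bar> \<partial>lborel) + pot_const 1 B \<zeta>"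
        by (rule dens_integral_abs_log_le[OF d])
      also have "\<dots> \<le> ?C" using True by (intro add_right_mono mult_right_mono) (auto simp: nT)
      finally show ?thesis by (intro mult_left_mono) auto
    qed (use e in \<open>auto simp: bounded_density_def\<close>)
    moreover have "0 \<le> \<bar>\<eta> x\<bar> * (\<integral>y. \<bar>ln (1 / dist (T x) y) * \<zeta> y\<bar> \<partial>lborel)" for x by simp
    ultimately show "AE x in lborel. norm (\<bar>\<eta> x\<bar> * (\<integral>y. \<bar>ln (1 / dist (T x) y) * \<zeta> y\<bar> \<partial>lborel)) \<le> norm (\<bar>\<eta> x\<bar> * ?C)"
      by (intro AE_I2) (smt (verit, best) real_norm_def)
  qed measurable
  then show "integrable lborel (\<lambda>x. \<integral>y. norm (case (x, y) of (x, y) \<Rightarrow> ln (1 / dist (T x) y) * (\<eta> x * \<zeta> y)) \<partial>lborel)"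
    by (simp only: prod.case eq)
  show "AE x in lborel. integrable lborel (\<lambda>y. case (x, y) of (x, y) \<Rightarrow> ln (1 / dist (T x) y) * (\<eta> x * \<zeta> y))"
  proof (rule AE_I2)
    fix x
    show "integrable lborel (\<lambda>y. case (x, y) of (x, y) \<Rightarrow> ln (1 / dist (T x) y) * (\<eta> x * \<zeta> y))"
      using integrable_mult_right[OF dens_integrable_log[OF d, of "T x"], of "\<eta> x"] by (simp add: mult_ac)
  qed
qed

lemma integrable_pair_green:
  assumes d: "bounded_density B \<rho> \<zeta>" and e: "bounded_density B' \<rho>' \<eta>"
  shows "integrable (lborel \<Otimes>\<^sub>M lborel) (\<lambda>(x, y). green_kernel x y * (\<eta> x * \<zeta> y))"
  using Bochner_Integration.integrable_diff[OF integrable_pair_log[OF d e, of "\<lambda>x. x"] integrable_pair_log[OF d e reflect_measurable]]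
  by (simp add: green_kernel_def left_diff_distrib split_def)

definition energy_form :: "(plane \<Rightarrow> real) \<Rightarrow> (plane \<Rightarrow> real) \<Rightarrow> real" where
  "energy_form \<eta> \<zeta> = (\<integral>x. \<eta> x * green \<zeta> x \<partial>lborel)"

lemma energy_form_eq_pair:
  assumes d: "bounded_density B \<rho> \<zeta>" and e: "bounded_density B' \<rho>' \<eta>"
  shows "energy_form \<eta> \<zeta> = 1 / (2 * pi) * (\<integral>(x, y). green_kernel x y * (\<eta> x * \<zeta> y) \<partial>(lborel \<Otimes>\<^sub>M lborel))"
    and "energy_form \<eta> \<zeta> = energy_form \<zeta> \<eta>"
proof -
  let ?k = "\<lambda>x y. green_kernel x y * (\<eta> x * \<zeta> y)"
  note i = integrable_pair_green[OF d e]
  have 1: "energy_form \<eta> \<zeta> = (\<integral>x. (\<integral>y. 1 / (2 * pi) * ?k x y \<partial>lborel) \<partial>lborel)"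
    unfolding energy_form_def green_eq_integral[OF d]
    by (subst integral_mult_right_zero[symmetric])+ (simp add: mult_ac)
  then have 2: "energy_form \<eta> \<zeta> = 1 / (2 * pi) * (\<integral>x. (\<integral>y. ?k x y \<partial>lborel) \<partial>lborel)" by simp
  show "energy_form \<eta> \<zeta> = 1 / (2 * pi) * (\<integral>(x, y). ?k x y \<partial>(lborel \<Otimes>\<^sub>M lborel))"
    unfolding 2 using lborel_pair.integral_fst'[OF i] by simp
  have "energy_form \<zeta> \<eta> = (\<integral>y. (\<integral>x. 1 / (2 * pi) * ?k x y \<partial>lborel) \<partial>lborel)"
    unfolding energy_form_def green_eq_integral[OF e]
    by (subst integral_mult_right_zero[symmetric])+ (simp add: mult_ac green_kernel_sym)
  then have "energy_form \<zeta> \<eta> = 1 / (2 * pi) * (\<integral>y. (\<integral>x. ?k x y \<partial>lborel) \<partial>lborel)" by simp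
  also have "\<dots> = energy_form \<eta> \<zeta>" unfolding 2 using lborel_pair.Fubini_integral[OF i] by simp
  finally show "energy_form \<eta> \<zeta> = energy_form \<zeta> \<eta>" by simp
qed

section \<open>Potentials of Steiner symmetric densities\<close>

text \<open>Comparing \<bar>a\<bar> with \<bar>b\<bar> encodes evenness in x2 and monotonicity away
  from the axis x2 = 0 at once, and at every point rather than almost everywhere.\<close>

definition steiner_sym :: "(plane \<Rightarrow> real) \<Rightarrow> bool" where
  "steiner_sym \<zeta> \<longleftrightarrow> (\<forall>x1 a b. \<bar>a\<bar> \<le> \<bar>b\<bar> \<longrightarrow> \<zeta> (x1, b) \<le> \<zeta> (x1, a))"

lemma steiner_symD: "steiner_sym \<zeta> \<Longrightarrow> \<bar>a\<bar> \<le> \<bar>b\<bar> \<Longrightarrow> \<zeta> (x1, b) \<le> \<zeta> (x1, a)"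
  by (auto simp: steiner_sym_def)

lemma steiner_sym_even: "steiner_sym \<zeta> \<Longrightarrow> \<zeta> (x1, - a) = \<zeta> (x1, a)"
  by (rule antisym) (auto simp: steiner_sym_def)

text \<open>A rectangle about b1. Its distance r / 2 from the axis x1 = 0 keeps the interaction with
  the image bounded, and its symmetry in x2 is compatible with Steiner symmetry.\<close>

definition Dom :: "real \<Rightarrow> plane set" where
  "Dom r = {x. r / 2 \<le> fst x \<and> fst x \<le> 3 * r / 2 \<and> \<bar>snd x\<bar> \<le> r}"

lemma green_even:
  assumes d: "bounded_density B \<rho> \<zeta>" and s: "steiner_sym \<zeta>"
  shows "green \<zeta> (x1, - a) = green \<zeta> (x1, a)"
proof -
  have e: "(\<lambda>y. \<zeta> (0 + 1 * fst y, 0 + (- 1) * snd y)) = \<zeta>"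
    using steiner_sym_even[OF s] by (auto simp: fun_eq_iff)
  have "inv_neg_laplacian \<zeta> x = inv_neg_laplacian \<zeta> (0 + 1 * fst x, 0 + (- 1) * snd x)" for x
    using inv_neg_laplacian_signed_translation[OF d, of 1 "-1" 0 0 x] unfolding e by simp
  from this[of "(x1, a)"] this[of "(- x1, a)"] show ?thesis by (simp add: green_def)
qed

text \<open>Both kernels are half the logarithm of (s + t) / (d + t), with the same s and d. The
  inequality - ln Q \<ge> 1 - Q for the ratio Q of the two quotients produces (s - d) (t2 - t1) /
  ((s + t1) (d + t2)). In the rectangle s - d is at least the square of r, and the two denominators
  are at most 13 and 5 times it, whence 65.\<close>

lemma green_kernel_diff_lower:
  assumes r: "r > 0" and x1: "r / 2 \<le> x1" "x1 \<le> 3 * r / 2" and ab: "0 \<le> a" "a < b" "b \<le> r"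
    and y: "y \<in> Dom r" "snd y \<le> (a + b) / 2" "y \<noteq> (x1, a)" "y \<noteq> (x1, b)"
  shows "(b - a) * ((a + b) / 2 - snd y) / (65 * r\<^sup>2) \<le> green_kernel (x1, a) y - green_kernel (x1, b) y"
proof -
  define s d t1 t2 where "s = (x1 + fst y)\<^sup>2" and "d = (x1 - fst y)\<^sup>2"
    and "t1 = (a - snd y)\<^sup>2" and "t2 = (b - snd y)\<^sup>2"
  have fy: "r / 2 \<le> fst y" "fst y \<le> 3 * r / 2" "\<bar>snd y\<bar> \<le> r" using y by (auto simp: Dom_def)
  have sd: "s - d = 4 * (x1 * fst y)" by (simp add: s_def d_def power2_eq_square algebra_simps)
  have "(r / 2) * (r / 2) \<le> x1 * fst y" using x1 fy r by (intro mult_mono) auto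
  then have sd1: "r\<^sup>2 \<le> s - d" unfolding sd by (simp add: power2_eq_square)
  have tt: "t2 - t1 = 2 * ((b - a) * ((a + b) / 2 - snd y))"
    by (simp add: t1_def t2_def power2_eq_square field_simps)
  have tt0: "t2 - t1 \<ge> 0" unfolding tt using ab y by (intro mult_nonneg_nonneg) auto
  have d0: "0 \<le> d" "0 \<le> t1" "0 \<le> t2" by (auto simp: d_def t1_def t2_def)
  have nz1: "d + t1 > 0" and nz2: "d + t2 > 0"
    using y(3,4) unfolding d_def t1_def t2_def by (auto simp: prod_eq_iff sum_power2_gt_zero_iff)
  have s0: "s > d" using sd1 r by (metis diff_gt_0_iff_gt less_le_trans zero_less_power)
  have bs: "s \<le> (3 * r)\<^sup>2" "d \<le> r\<^sup>2" "t1 \<le> (2 * r)\<^sup>2" "t2 \<le> (2 * r)\<^sup>2"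
  proof -
    have "\<bar>x1 + fst y\<bar> \<le> \<bar>3 * r\<bar>" "\<bar>x1 - fst y\<bar> \<le> \<bar>r\<bar>" "\<bar>a - snd y\<bar> \<le> \<bar>2 * r\<bar>" "\<bar>b - snd y\<bar> \<le> \<bar>2 * r\<bar>"
      using x1 fy ab r by linarith+
    from this[THEN abs_le_square_iff[THEN iffD1]]
    show "s \<le> (3 * r)\<^sup>2" "d \<le> r\<^sup>2" "t1 \<le> (2 * r)\<^sup>2" "t2 \<le> (2 * r)\<^sup>2"
      unfolding s_def d_def t1_def t2_def .
  qed
  have nr: "y \<noteq> reflect (x1, a)" "y \<noteq> reflect (x1, b)" using fy x1 r by auto
  have g1: "green_kernel (x1, a) y = 1/2 * ln ((s + t1) / (d + t1))"
    using green_kernel_eq(2)[OF y(3) nr(1)] by (simp add: s_def d_def t1_def)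
  have g2: "green_kernel (x1, b) y = 1/2 * ln ((s + t2) / (d + t2))"
    using green_kernel_eq(2)[OF y(4) nr(2)] by (simp add: s_def d_def t2_def)
  define Q where "Q = (d + t1) * (s + t2) / ((s + t1) * (d + t2))"
  have pos: "s + t1 > 0" "s + t2 > 0" using s0 d0 by auto
  have Q: "Q > 0" unfolding Q_def using nz1 nz2 pos by simp
  have e1: "green_kernel (x1, a) y - green_kernel (x1, b) y = 1/2 * (- ln Q)"
  proof -
    have "ln Q = ln (d + t1) + ln (s + t2) - (ln (s + t1) + ln (d + t2))"
      unfolding Q_def using nz1 nz2 pos by (simp add: ln_div ln_mult)
    moreover have "ln ((s + t1) / (d + t1)) = ln (s + t1) - ln (d + t1)" "ln ((s + t2) / (d + t2)) = ln (s + t2) - ln (d + t2)"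
      using nz1 nz2 pos by (simp_all add: ln_div)
    ultimately show ?thesis unfolding g1 g2 by argo
  qed
  have e2: "- ln Q \<ge> 1 - Q" using ln_le_minus_one[OF Q] by simp
  have e3: "1 - Q = (s - d) * (t2 - t1) / ((s + t1) * (d + t2))"
  proof -
    have "(s + t1) * (d + t2) \<noteq> 0" using nz2 pos by simp
    then have "1 - Q = ((s + t1) * (d + t2) - (d + t1) * (s + t2)) / ((s + t1) * (d + t2))"
      unfolding Q_def diff_divide_distrib by simp
    also have "(s + t1) * (d + t2) - (d + t1) * (s + t2) = (s - d) * (t2 - t1)" by algebra
    finally show ?thesis .
  qed
  have e4: "(s - d) * (t2 - t1) / ((s + t1) * (d + t2)) \<ge> r\<^sup>2 * (t2 - t1) / (65 * r\<^sup>2 * r\<^sup>2)"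
  proof (rule frac_le)
    show "r\<^sup>2 * (t2 - t1) \<le> (s - d) * (t2 - t1)" using sd1 tt0 by (rule mult_right_mono)
    show "0 < (s + t1) * (d + t2)" using nz2 pos by simp
    have "(s + t1) * (d + t2) \<le> (13 * r\<^sup>2) * (5 * r\<^sup>2)"
      using bs d0 pos nz2 by (intro mult_mono) (auto simp: power_mult_distrib)
    then show "(s + t1) * (d + t2) \<le> 65 * r\<^sup>2 * r\<^sup>2" by (simp add: mult.assoc)
    show "0 \<le> (s - d) * (t2 - t1)" using s0 tt0 by simp
  qed
  have "(t2 - t1) / (65 * r\<^sup>2) = r\<^sup>2 * (t2 - t1) / (65 * r\<^sup>2 * r\<^sup>2)" using r by simp
  also have "\<dots> \<le> (s - d) * (t2 - t1) / ((s + t1) * (d + t2))" by (rule e4)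
  also have "\<dots> \<le> - ln Q" using e2 e3 by simp
  also have "\<dots> = 2 * (green_kernel (x1, a) y - green_kernel (x1, b) y)" using e1 by simp
  finally have "(t2 - t1) / (65 * r\<^sup>2) \<le> 2 * (green_kernel (x1, a) y - green_kernel (x1, b) y)" .
  then show ?thesis unfolding tt times_divide_eq_right[symmetric] by simp
qed

text \<open>Reflection at \<open>x\<^sub>2 = (a + b) / 2\<close> makes both the kernel difference and \<open>\<zeta>\<close> minus its reflection
  odd, with the same sign; the linear lower bound for the kernel difference then integrates exactly.\<close>

lemma green_strict_decreasing_nonneg:
  assumes r: "r > 0" and x1: "r / 2 \<le> x1" "x1 \<le> 3 * r / 2" and ab: "0 \<le> a" "a < b" "b \<le> r"
    and d: "bounded_density B \<rho> \<zeta>" and s: "steiner_sym \<zeta>" and z0: "\<And>x. 0 \<le> \<zeta> x" and zD: "\<And>x. x \<notin> Dom r \<Longrightarrow> \<zeta> x = 0"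
  shows "(b\<^sup>2 - a\<^sup>2) * (integral\<^sup>L lborel \<zeta>) / (260 * pi * r\<^sup>2) \<le> green \<zeta> (x1, a) - green \<zeta> (x1, b)"
proof -
  define m where "m = (a + b) / 2"
  define R where "R = (\<lambda>y::plane. (fst y, 2 * m - snd y))"
  define \<Delta> where "\<Delta> y = green_kernel (x1, a) y - green_kernel (x1, b) y" for y
  define c where "c = (b - a) / (65 * r\<^sup>2)"
  note [measurable] = dens_measurable[OF d]
  have m2: "2 * m = a + b" by (simp add: m_def)
  have Rt: "g (R y) = g (0 + 1 * fst y, 2 * m + (- 1) * snd y)" for g :: "plane \<Rightarrow> real" and y by (simp add: R_def)
  have RR: "R (R y) = y" for y by (simp add: R_def)
  have iR: "(\<integral>y. g (R y) \<partial>lborel) = integral\<^sup>L lborel g" "integrable lborel (\<lambda>y. g (R y)) \<longleftrightarrow> integrable lborel g"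
    if "g \<in> borel_measurable borel" for g :: "plane \<Rightarrow> real"
    unfolding Rt using integral_signed_translation[of 1 "-1" g 0 "2 * m"] integrable_signed_translation[of 1 "-1" g 0 "2 * m"] that by auto
  have dr: "dist (u, a) (R y) = dist (u, b) y" "dist (u, b) (R y) = dist (u, a) y" for u y
  proof -
    have "(a - (2 * m - snd y))\<^sup>2 = (b - snd y)\<^sup>2" "(b - (2 * m - snd y))\<^sup>2 = (a - snd y)\<^sup>2"
      unfolding m2 by (simp_all add: power2_eq_square algebra_simps)
    then show "dist (u, a) (R y) = dist (u, b) y" "dist (u, b) (R y) = dist (u, a) y"
      by (simp_all add: dist_prod_def dist_real_def R_def)
  qed
  have \<Delta>R: "\<Delta> (R y) = - \<Delta> y" for y
    by (simp add: \<Delta>_def green_kernel_def dr)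
  have \<Delta>m[measurable]: "\<Delta> \<in> borel_measurable borel"
    unfolding \<Delta>_def green_kernel_def by measurable
  have i1: "integrable lborel (\<lambda>y. \<Delta> y * \<zeta> y)"
    unfolding \<Delta>_def left_diff_distrib using dens_integrable_green_kernel[OF d] by simp
  have i2: "integrable lborel (\<lambda>y. (m - snd y) * \<zeta> y)"
  proof (rule dens_integrable_bounded[where B = "(\<bar>m\<bar> + \<bar>\<rho>\<bar>) * B" and \<rho> = \<rho>])
    fix y :: plane
    show "norm ((m - snd y) * \<zeta> y) \<le> (\<bar>m\<bar> + \<bar>\<rho>\<bar>) * B"
    proof (cases "norm y \<le> \<rho>")
      case True
      have "\<bar>snd y\<bar> \<le> norm y" using norm_snd_le[of "snd y" "fst y"] by simp
      then have "\<bar>m - snd y\<bar> \<le> \<bar>m\<bar> + \<bar>\<rho>\<bar>" using True by linarith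
      then show ?thesis unfolding real_norm_def abs_mult using dens_bound[OF d, of y] by (intro mult_mono) auto
    next
      case False
      then show ?thesis using d dens_bound_nonneg[OF d] by (auto simp: bounded_density_def)
    qed
  qed (measurable, use d in \<open>auto simp: bounded_density_def\<close>)
  have m\<Delta>: "(\<lambda>y. \<Delta> y * \<zeta> y) \<in> borel_measurable borel" "(\<lambda>y. (m - snd y) * \<zeta> y) \<in> borel_measurable borel" by measurable
  have i1R: "integrable lborel (\<lambda>y. \<Delta> y * \<zeta> (R y))" and e1: "(\<integral>y. \<Delta> y * \<zeta> (R y) \<partial>lborel) = - (\<integral>y. \<Delta> y * \<zeta> y \<partial>lborel)"
    using iR[OF m\<Delta>(1)] i1 by (auto simp: \<Delta>R)
  have mR: "m - snd (R y) = - (m - snd y)" for y by (simp add: R_def)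
  have mR': "(m - snd (R y)) * \<zeta> (R y) = - ((m - snd y) * \<zeta> (R y))" for y
    unfolding mR by (rule mult_minus_left)
  have i2R: "integrable lborel (\<lambda>y. (m - snd y) * \<zeta> (R y))" and e2: "(\<integral>y. (m - snd y) * \<zeta> (R y) \<partial>lborel) = - (\<integral>y. (m - snd y) * \<zeta> y \<partial>lborel)"
    using iR[OF m\<Delta>(2)] i2 unfolding mR' by (simp_all add: equation_minus_iff minus_equation_iff)
  \<comment> \<open>If the values at \<open>y\<close> and its mirror point differ, the larger one
    \<open>\<zeta> y\<close> is positive, so \<open>y\<close> lies in the rectangle and the kernel
    bound is available.\<close>
  have pw: "c * (m - snd y) * (\<zeta> y - \<zeta> (R y)) \<le> \<Delta> y * (\<zeta> y - \<zeta> (R y))"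
    if y: "snd y \<le> m" "y \<noteq> (x1, a)" "y \<noteq> (x1, b)" for y
  proof (cases "\<zeta> y = \<zeta> (R y)")
    case False
    have "\<bar>snd y\<bar> \<le> \<bar>2 * m - snd y\<bar>" using y ab by (simp add: m_def abs_if)
    then have ge: "\<zeta> (R y) \<le> \<zeta> y" using steiner_symD[OF s, of "snd y" "2 * m - snd y" "fst y"] by (simp add: R_def)
    then have "\<zeta> y > 0" using False z0[of "R y"] by linarith
    then have "y \<in> Dom r" using zD[of y] by force
    then have "(b - a) * ((a + b) / 2 - snd y) / (65 * r\<^sup>2) \<le> green_kernel (x1, a) y - green_kernel (x1, b) y"
      using y by (intro green_kernel_diff_lower[OF r x1 ab]) (auto simp: m_def)
    then have "c * (m - snd y) \<le> \<Delta> y" by (simp add: c_def m_def \<Delta>_def)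
    then show ?thesis using ge by (intro mult_right_mono) auto
  qed simp
  have "AE y in lborel. c * ((m - snd y) * \<zeta> y - (m - snd y) * \<zeta> (R y)) \<le> \<Delta> y * \<zeta> y - \<Delta> y * \<zeta> (R y)"
    using AE_lborel_singleton[of "(x1, a)"] AE_lborel_singleton[of "(x1, b)"]
  proof eventually_elim
    fix y assume y: "y \<noteq> (x1, a)" "y \<noteq> (x1, b)"
    show "c * ((m - snd y) * \<zeta> y - (m - snd y) * \<zeta> (R y)) \<le> \<Delta> y * \<zeta> y - \<Delta> y * \<zeta> (R y)"
    proof (cases "snd y \<le> m")
      case True
      then show ?thesis using pw[of y] y by (simp add: algebra_simps)
    next
      case False
      have "R y \<noteq> (x1, a)" "R y \<noteq> (x1, b)" using y m2 by (auto simp: R_def prod_eq_iff)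
      moreover have "snd (R y) \<le> m" using False by (simp add: R_def)
      ultimately have "c * (m - snd (R y)) * (\<zeta> (R y) - \<zeta> y) \<le> \<Delta> (R y) * (\<zeta> (R y) - \<zeta> y)"
        using pw[of "R y"] by (simp add: RR)
      then show ?thesis unfolding mR \<Delta>R by (simp add: algebra_simps)
    qed
  qed
  then have "(\<integral>y. c * ((m - snd y) * \<zeta> y - (m - snd y) * \<zeta> (R y)) \<partial>lborel) \<le> (\<integral>y. \<Delta> y * \<zeta> y - \<Delta> y * \<zeta> (R y) \<partial>lborel)"
    by (intro integral_mono_AE Bochner_Integration.integrable_diff integrable_mult_right i1 i1R i2 i2R)
  then have main: "c * (\<integral>y. (m - snd y) * \<zeta> y \<partial>lborel) \<le> (\<integral>y. \<Delta> y * \<zeta> y \<partial>lborel)"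
    using Bochner_Integration.integral_diff[OF i1 i1R] Bochner_Integration.integral_diff[OF i2 i2R] e1 e2 by simp
  \<comment> \<open>The first moment of \<zeta> in x2 vanishes by evenness, so only the constant
    \<open>m\<close> contributes.\<close>
  have "(\<integral>y. (m - snd y) * \<zeta> y \<partial>lborel) = m * integral\<^sup>L lborel \<zeta>"
  proof -
    have "(\<integral>y. (m - snd y) * \<zeta> y \<partial>lborel) = (\<integral>y. (m - snd (0 + 1 * fst y, 0 + (- 1) * snd y)) * \<zeta> (0 + 1 * fst y, 0 + (- 1) * snd y) \<partial>lborel)"
      by (rule integral_signed_translation[symmetric, where g = "\<lambda>y. (m - snd y) * \<zeta> y"]) auto
    also have "\<dots> = (\<integral>y. (m + snd y) * \<zeta> y \<partial>lborel)"
      using steiner_sym_even[OF s] by simp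
    finally have e: "(\<integral>y. (m - snd y) * \<zeta> y \<partial>lborel) = (\<integral>y. (m + snd y) * \<zeta> y \<partial>lborel)" .
    have f: "(m + snd y) * \<zeta> y = 2 * m * \<zeta> y - (m - snd y) * \<zeta> y" for y by (simp add: algebra_simps)
    have "(\<integral>y. (m + snd y) * \<zeta> y \<partial>lborel) = 2 * m * integral\<^sup>L lborel \<zeta> - (\<integral>y. (m - snd y) * \<zeta> y \<partial>lborel)"
      unfolding f using i2 dens_integrable[OF d] by (subst Bochner_Integration.integral_diff) auto
    with e show ?thesis by simp
  qed
  with main have "c * (m * integral\<^sup>L lborel \<zeta>) \<le> (\<integral>y. \<Delta> y * \<zeta> y \<partial>lborel)" by simp
  then have "1 / (2 * pi) * (c * (m * integral\<^sup>L lborel \<zeta>)) \<le> 1 / (2 * pi) * (\<integral>y. \<Delta> y * \<zeta> y \<partial>lborel)"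
    by (intro mult_left_mono) auto
  also have "\<dots> = green \<zeta> (x1, a) - green \<zeta> (x1, b)"
    unfolding green_eq_integral[OF d] \<Delta>_def left_diff_distrib
    using dens_integrable_green_kernel[OF d] by (simp add: right_diff_distrib)
  \<comment> \<open>260 is 65 times 2 from the mean \<open>m\<close> times 2 from the factor 1 / (2
    \<pi>).\<close>
  also have "1 / (2 * pi) * (c * (m * integral\<^sup>L lborel \<zeta>)) = (b\<^sup>2 - a\<^sup>2) * (integral\<^sup>L lborel \<zeta>) / (260 * pi * r\<^sup>2)"
    by (simp add: c_def m_def power2_eq_square field_simps)
  finally show ?thesis .
qed

lemma green_strict_decreasing:
  assumes r: "r > 0" and x1: "r / 2 \<le> x1" "x1 \<le> 3 * r / 2" and ab: "\<bar>a\<bar> \<le> \<bar>b\<bar>" "\<bar>b\<bar> \<le> r"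
    and d: "bounded_density B \<rho> \<zeta>" and s: "steiner_sym \<zeta>" and z0: "\<And>x. 0 \<le> \<zeta> x" and zD: "\<And>x. x \<notin> Dom r \<Longrightarrow> \<zeta> x = 0"
  shows "(b\<^sup>2 - a\<^sup>2) * (integral\<^sup>L lborel \<zeta>) / (260 * pi * r\<^sup>2) \<le> green \<zeta> (x1, a) - green \<zeta> (x1, b)"
proof -
  have e: "green \<zeta> (x1, \<bar>u\<bar>) = green \<zeta> (x1, u)" for u
    using green_even[OF d s, of x1 u] by (cases "u \<ge> 0") auto
  show ?thesis
  proof (cases "\<bar>a\<bar> = \<bar>b\<bar>")
    case True
    then have "a\<^sup>2 = b\<^sup>2" by (metis power2_abs)
    moreover have "green \<zeta> (x1, a) = green \<zeta> (x1, b)" using e[of a] e[of b] True by simp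
    ultimately show ?thesis by simp
  next
    case False
    then have "(\<bar>b\<bar>\<^sup>2 - \<bar>a\<bar>\<^sup>2) * (integral\<^sup>L lborel \<zeta>) / (260 * pi * r\<^sup>2) \<le> green \<zeta> (x1, \<bar>a\<bar>) - green \<zeta> (x1, \<bar>b\<bar>)"
      using ab by (intro green_strict_decreasing_nonneg[OF r x1 _ _ _ d s z0 zD]) auto
    then show ?thesis by (simp add: e)
  qed
qed

section \<open>Positive definiteness of the Green function\<close>

text \<open>Frullani's integral: integrate exp (- t u) over u in [d, s] and t > 0 in both orders;
  the integrand is nonnegative, so Tonelli applies.\<close>

lemma ln_div_eq_nn_integral:
  fixes d s :: real
  assumes "0 < d" "d \<le> s"
  shows "(\<integral>\<^sup>+t. ennreal ((exp (- t * d) - exp (- t * s)) / t) * indicator {0<..} t \<partial>lborel) = ennreal (ln (s / d))"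
proof -
  have 1: "(\<integral>\<^sup>+u. ennreal (exp (- t * u)) * indicator {d..s} u \<partial>lborel) = ennreal ((exp (- t * d) - exp (- t * s)) / t)"
    if t: "t > 0" for t
  proof -
    have "(\<integral>\<^sup>+u. ennreal (exp (- t * u)) * indicator {d..s} u \<partial>lborel) = ennreal ((- exp (- t * s) / t) - (- exp (- t * d) / t))"
      by (rule nn_integral_FTC_Icc) (use t assms in \<open>auto intro!: derivative_eq_intros simp: has_real_derivative_iff_has_vector_derivative[symmetric]\<close>)
    then show ?thesis by (simp add: diff_divide_distrib)
  qed
  have 2: "(\<integral>\<^sup>+t. ennreal (exp (- t * u)) * indicator {0..} t \<partial>lborel) = ennreal (1 / u)" if u: "u > 0" for u
  proof -
    have lim: "((\<lambda>t. - exp (- t * u) / u) \<longlongrightarrow> - 0 / u) at_top"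
    proof (intro tendsto_intros)
      have "filterlim (\<lambda>t. - t * u) at_bot at_top"
        using filterlim_tendsto_pos_mult_at_top[OF tendsto_const u filterlim_ident]
        by (simp add: filterlim_uminus_at_bot mult.commute)
      then show "((\<lambda>t. exp (- t * u)) \<longlongrightarrow> 0) at_top"
        by (rule filterlim_compose[OF exp_at_bot])
    qed (use u in auto)
    have "(\<integral>\<^sup>+t. ennreal (exp (- t * u)) * indicator {0..} t \<partial>lborel) = ennreal (- 0 / u - (- exp (- 0 * u) / u))"
      by (rule nn_integral_FTC_atLeast[OF _ _ _ lim]) (use u in \<open>auto intro!: derivative_eq_intros\<close>)
    then show ?thesis by simp
  qed
  have "(\<integral>\<^sup>+t. ennreal ((exp (- t * d) - exp (- t * s)) / t) * indicator {0<..} t \<partial>lborel)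
    = (\<integral>\<^sup>+t. (\<integral>\<^sup>+u. ennreal (exp (- t * u)) * indicator {d..s} u * indicator {0<..} t \<partial>lborel) \<partial>lborel)"
  proof (rule nn_integral_cong)
    fix t :: real
    show "ennreal ((exp (- t * d) - exp (- t * s)) / t) * indicator {0<..} t
      = (\<integral>\<^sup>+u. ennreal (exp (- t * u)) * indicator {d..s} u * indicator {0<..} t \<partial>lborel)"
      using 1[of t] by (cases "t > 0") (auto simp: nn_integral_multc)
  qed
  also have "\<dots> = (\<integral>\<^sup>+u. (\<integral>\<^sup>+t. ennreal (exp (- t * u)) * indicator {d..s} u * indicator {0<..} t \<partial>lborel) \<partial>lborel)"
    by (rule lborel_pair.Fubini') measurable
  also have "\<dots> = (\<integral>\<^sup>+u. ennreal (1 / u) * indicator {d..s} u \<partial>lborel)"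
  proof (rule nn_integral_cong)
    fix u :: real
    have "(\<integral>\<^sup>+t. ennreal (exp (- t * u)) * indicator {0<..} t \<partial>lborel) = (\<integral>\<^sup>+t. ennreal (exp (- t * u)) * indicator {0..} t \<partial>lborel)"
      by (rule nn_integral_cong_AE) (use AE_lborel_singleton[of "0::real"] in eventually_elim, auto simp: indicator_def)
    then have "u > 0 \<Longrightarrow> (\<integral>\<^sup>+t. ennreal (exp (- t * u)) * indicator {0<..} t \<partial>lborel) = ennreal (1 / u)" using 2[of u] by simp
    then show "(\<integral>\<^sup>+t. ennreal (exp (- t * u)) * indicator {d..s} u * indicator {0<..} t \<partial>lborel) = ennreal (1 / u) * indicator {d..s} u"
      using assms by (auto simp: indicator_def)
  qed
  also have "\<dots> = ennreal (ln s - ln d)"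
    by (rule nn_integral_FTC_Icc)
      (use assms in \<open>auto intro!: DERIV_subset[OF DERIV_ln_divide] simp: has_real_derivative_iff_has_vector_derivative[symmetric]\<close>)
  finally show ?thesis using assms by (simp add: ln_div)
qed

text \<open>The Dirichlet heat kernel of the half plane without its normalization, with t playing
  the part of the reciprocal of four times the time.\<close>

definition heat_kernel_odd :: "real \<Rightarrow> plane \<Rightarrow> plane \<Rightarrow> real" where
  "heat_kernel_odd t x y = exp (- t * (dist x y)\<^sup>2) - exp (- t * (dist (reflect x) y)\<^sup>2)"

lemma dist_plane_squared:
  fixes x y :: plane
  shows "(dist x y)\<^sup>2 = (fst x - fst y)\<^sup>2 + (snd x - snd y)\<^sup>2"
    and "(dist (reflect x) y)\<^sup>2 = (fst x + fst y)\<^sup>2 + (snd x - snd y)\<^sup>2"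
  using power2_minus[of "fst x + fst y"] by (auto simp: dist_prod_def dist_real_def)

text \<open>Frullani's integral at the squared distances, which is the origin of the factor 2,
  exhibits the Green kernel as a superposition of odd heat kernels.\<close>

lemma green_kernel_eq_nn_integral:
  assumes "fst x > 0" "fst y > 0" "y \<noteq> x"
  shows "(\<integral>\<^sup>+t. ennreal (heat_kernel_odd t x y / t) * indicator {0<..} t \<partial>lborel) = ennreal (2 * green_kernel x y)"
proof -
  have n: "y \<noteq> reflect x" using assms by auto
  have "0 \<le> fst x * fst y" using assms by simp
  then have "(fst x - fst y)\<^sup>2 + (snd x - snd y)\<^sup>2 \<le> (fst x + fst y)\<^sup>2 + (snd x - snd y)\<^sup>2"
    by (simp add: power2_eq_square algebra_simps)
  moreover have "0 < (fst x - fst y)\<^sup>2 + (snd x - snd y)\<^sup>2"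
    using assms by (auto simp: prod_eq_iff sum_power2_gt_zero_iff)
  ultimately show ?thesis
    using ln_div_eq_nn_integral[of "(fst x - fst y)\<^sup>2 + (snd x - snd y)\<^sup>2" "(fst x + fst y)\<^sup>2 + (snd x - snd y)\<^sup>2"]
    unfolding heat_kernel_odd_def green_kernel_eq(2)[OF assms(3) n] dist_plane_squared(2)
    unfolding dist_plane_squared(1) by simp
qed

text \<open>The Gaussian factors depend on x or y alone and can be absorbed into the density. What
  remains is an exponential times twice a hyperbolic sine of products of coordinates, both with
  nonnegative Taylor coefficients.\<close>

lemma heat_kernel_odd_factor:
  "heat_kernel_odd t x y = exp (- t * (norm x)\<^sup>2) * exp (- t * (norm y)\<^sup>2) *
     (exp (2 * t * (snd x * snd y)) * (exp (2 * t * (fst x * fst y)) - exp (- (2 * t * (fst x * fst y)))))"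
  unfolding heat_kernel_odd_def dist_plane_squared(2) unfolding dist_plane_squared(1)
  by (simp add: norm_prod_def right_diff_distrib exp_add[symmetric] power2_eq_square algebra_simps)

lemma
  fixes f g :: "plane \<Rightarrow> real"
  assumes f: "bounded_density B \<rho> f" and g: "bounded_density B' \<rho>' g"
  shows integrable_pair_product: "integrable lborel (\<lambda>p::plane \<times> plane. f (fst p) * g (snd p))"
    and integral_pair_product: "(\<integral>p. f (fst p) * g (snd p) \<partial>lborel) = integral\<^sup>L lborel f * integral\<^sup>L lborel g"
proof -
  note [measurable] = dens_measurable[OF f] dens_measurable[OF g]
  have m: "(\<lambda>p. f (fst p) * g (snd p)) \<in> borel_measurable (lborel \<Otimes>\<^sub>M lborel)" by measurable
  have i: "integrable (lborel \<Otimes>\<^sub>M lborel) (\<lambda>p::plane \<times> plane. f (fst p) * g (snd p))"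
    by (rule lborel_pair.Fubini_integrable[OF m])
      (use dens_integrable[OF f] dens_integrable[OF g] in \<open>auto simp: abs_mult\<close>)
  then show "integrable lborel (\<lambda>p::plane \<times> plane. f (fst p) * g (snd p))" by (simp add: lborel_prod)
  show "(\<integral>p. f (fst p) * g (snd p) \<partial>lborel) = integral\<^sup>L lborel f * integral\<^sup>L lborel g"
    using lborel_pair.integral_fst'[OF i] by (simp add: lborel_prod)
qed

text \<open>Each term of the Taylor expansion is a nonnegative coefficient times a monomial in x
  times the same monomial in y, so its integral against h(x) h(y) is a squared moment. Bounded
  support makes the expansion converge under a common bound.\<close>

lemma heat_kernel_odd_positive_definite:
  assumes d: "bounded_density B \<rho> h" and t: "t > 0"
  shows "integrable lborel (\<lambda>p::plane \<times> plane. heat_kernel_odd t (fst p) (snd p) * (h (fst p) * h (snd p)))"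
    and "0 \<le> (\<integral>p. heat_kernel_odd t (fst p) (snd p) * (h (fst p) * h (snd p)) \<partial>lborel)"
proof -
  note hm[measurable] = dens_measurable[OF d]
  define H where "H x = h x * exp (- t * (norm x)\<^sup>2)" for x
  define u where "u p = 2 * t * (snd (fst p) * snd (snd p))" for p :: "plane \<times> plane"
  define v where "v p = 2 * t * (fst (fst p) * fst (snd p))" for p :: "plane \<times> plane"
  \<comment> \<open>Partial sums of exp u and of exp v - exp (- v); in the latter the coefficient 1
    - (- 1)^j is 0 or 2, hence nonnegative.\<close>
  define P where "P N p = (\<Sum>i<N. u p ^ i / fact i)" for N p
  define S where "S N p = (\<Sum>j<N. (v p ^ j - (- v p) ^ j) / fact j)" for N p
  have um[measurable]: "u \<in> borel_measurable borel" "v \<in> borel_measurable borel"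
    unfolding u_def v_def by (intro borel_measurable_continuous_onI continuous_intros)+
  have dH: "bounded_density B \<rho> H"
  proof -
    have "\<bar>H x\<bar> \<le> B" for x
    proof -
      have "\<bar>h x\<bar> * exp (- t * (norm x)\<^sup>2) \<le> B * 1"
        using dens_bound[OF d, of x] t by (intro mult_mono) (auto simp: dens_bound_nonneg[OF d])
      then show ?thesis by (simp add: H_def abs_mult)
    qed
    moreover have "H \<in> borel_measurable borel" unfolding H_def by measurable
    ultimately show ?thesis using d by (auto simp: bounded_density_def H_def)
  qed
  have H0: "H x = 0" if "norm x > \<rho>" for x using dH that by (simp add: bounded_density_def)
  define HH where "HH p = H (fst p) * H (snd p)" for p
  have HHi: "integrable lborel HH" unfolding HH_def by (rule integrable_pair_product[OF dH dH])
  have HHm[measurable]: "HH \<in> borel_measurable borel" using borel_measurable_integrable[OF HHi] by simp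
  have comp: "\<bar>x1 * y1\<bar> \<le> \<rho>\<^sup>2" if "\<bar>x1\<bar> \<le> \<rho>" "\<bar>y1\<bar> \<le> \<rho>" for x1 y1 :: real
    using mult_mono[OF that] that by (simp add: abs_mult power2_eq_square)
  have uv: "\<bar>u p\<bar> \<le> 2 * t * \<rho>\<^sup>2" "\<bar>v p\<bar> \<le> 2 * t * \<rho>\<^sup>2" if "HH p \<noteq> 0" for p
  proof -
    have n: "norm (fst p) \<le> \<rho>" "norm (snd p) \<le> \<rho>" using that H0[of "fst p"] H0[of "snd p"] by (force simp: HH_def)+
    have c: "\<bar>fst x\<bar> \<le> norm x" "\<bar>snd x\<bar> \<le> norm x" for x :: plane
      using norm_fst_le[of "fst x" "snd x"] norm_snd_le[of "snd x" "fst x"] by auto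
    show "\<bar>u p\<bar> \<le> 2 * t * \<rho>\<^sup>2"
      using comp[OF order_trans[OF c(2)[of "fst p"] n(1)] order_trans[OF c(2)[of "snd p"] n(2)]] t
      by (simp add: u_def abs_mult[of "2 * t"])
    show "\<bar>v p\<bar> \<le> 2 * t * \<rho>\<^sup>2"
      using comp[OF order_trans[OF c(1)[of "fst p"] n(1)] order_trans[OF c(1)[of "snd p"] n(2)]] t
      by (simp add: v_def abs_mult[of "2 * t"])
  qed
  \<comment> \<open>Bounds exp at \<bar>u\<bar> and \<bar>v\<bar> over the support of
    \<open>HH\<close>, and thus every partial sum: the dominating function for the limit.\<close>
  define K where "K = exp (2 * t * \<rho>\<^sup>2)"
  have Kp: "K > 0" by (simp add: K_def)
  have exs: "(\<lambda>i. w ^ i / fact i) sums exp w" for w :: real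
    using exp_converges[of w] by (simp add: divide_inverse_commute)
  have Pb: "\<bar>\<Sum>i<N. w ^ i / fact i\<bar> \<le> K" if "\<bar>w\<bar> \<le> 2 * t * \<rho>\<^sup>2" for w :: real and N
  proof -
    have "\<bar>\<Sum>i<N. w ^ i / fact i\<bar> \<le> (\<Sum>i<N. \<bar>w\<bar> ^ i / fact i)"
      by (rule order_trans[OF sum_abs]) (simp add: power_abs)
    also have "\<dots> \<le> (\<Sum>i. \<bar>w\<bar> ^ i / fact i)"
      by (intro sum_le_suminf sums_summable[OF exs]) auto
    also have "\<dots> = exp \<bar>w\<bar>" by (rule sums_unique[OF exs, symmetric])
    also have "\<dots> \<le> K" using that by (simp add: K_def)
    finally show ?thesis .
  qed
  have Slim: "(\<lambda>N. \<Sum>i<N. w ^ i / fact i) \<longlonglongrightarrow> exp w" for w :: real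
    using exs[of w] by (simp add: sums_def)
  have Seq: "S N p = (\<Sum>i<N. v p ^ i / fact i) - (\<Sum>i<N. (- v p) ^ i / fact i)" for N p
    by (simp add: S_def diff_divide_distrib sum_subtractf)
  have PSb: "\<bar>P N p * S N p * HH p\<bar> \<le> 2 * K\<^sup>2 * \<bar>HH p\<bar>" for N p
  proof (cases "HH p = 0")
    case False
    have "\<bar>P N p\<bar> \<le> K" unfolding P_def by (rule Pb[OF uv(1)[OF False]])
    moreover have "\<bar>S N p\<bar> \<le> K + K" unfolding Seq
      by (rule order_trans[OF abs_triangle_ineq4]) (intro add_mono Pb, use uv(2)[OF False] in auto)
    ultimately have "\<bar>P N p\<bar> * \<bar>S N p\<bar> \<le> K * (K + K)" using Kp by (intro mult_mono) auto
    then have "\<bar>P N p\<bar> * \<bar>S N p\<bar> * \<bar>HH p\<bar> \<le> K * (K + K) * \<bar>HH p\<bar>" by (rule mult_right_mono) simp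
    then show ?thesis by (simp add: abs_mult power2_eq_square)
  qed simp
  have mono: "bounded_density (B * \<bar>\<rho>\<bar> ^ (i + j)) \<rho> (\<lambda>x. H x * (fst x ^ j * snd x ^ i))" for i j
    unfolding bounded_density_def
  proof (intro conjI allI impI)
    show "(\<lambda>x. H x * (fst x ^ j * snd x ^ i)) \<in> borel_measurable borel"
      using dens_measurable[OF dH] by measurable
    fix x :: plane
    show "H x * (fst x ^ j * snd x ^ i) = 0" if "norm x > \<rho>" using H0[OF that] by simp
    show "\<bar>H x * (fst x ^ j * snd x ^ i)\<bar> \<le> B * \<bar>\<rho>\<bar> ^ (i + j)"
    proof (cases "norm x > \<rho>")
      case True
      then show ?thesis using H0[OF True] dens_bound_nonneg[OF d] by simp
    next
      case False
      have "\<bar>fst x\<bar> \<le> \<bar>\<rho>\<bar>" "\<bar>snd x\<bar> \<le> \<bar>\<rho>\<bar>"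
        using norm_fst_le[of "fst x" "snd x"] norm_snd_le[of "snd x" "fst x"] False by auto
      then have pw: "\<bar>fst x\<bar> ^ j * \<bar>snd x\<bar> ^ i \<le> \<bar>\<rho>\<bar> ^ j * \<bar>\<rho>\<bar> ^ i" by (intro mult_mono power_mono) auto
      have "\<bar>H x\<bar> * (\<bar>fst x\<bar> ^ j * \<bar>snd x\<bar> ^ i) \<le> B * (\<bar>\<rho>\<bar> ^ j * \<bar>\<rho>\<bar> ^ i)"
        by (rule mult_mono[OF dens_bound[OF dH, of x] pw dens_bound_nonneg[OF d]]) simp
      then show ?thesis by (simp add: abs_mult power_abs power_add mult_ac)
    qed
  qed
  have expand: "P N p * S N p * HH p = (\<Sum>i<N. \<Sum>j<N. ((2 * t) ^ i / fact i * ((2 * t) ^ j * (1 - (- 1) ^ j) / fact j)) *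
      ((H (fst p) * (fst (fst p) ^ j * snd (fst p) ^ i)) * (H (snd p) * (fst (snd p) ^ j * snd (snd p) ^ i))))" for N p
  proof -
    have a: "v p ^ j - (- v p) ^ j = (1 - (- 1) ^ j) * v p ^ j" for j
      by (subst power_minus) (simp add: left_diff_distrib)
    have "P N p * S N p = (\<Sum>i<N. \<Sum>j<N. u p ^ i / fact i * ((v p ^ j - (- v p) ^ j) / fact j))"
      unfolding P_def S_def by (rule sum_product)
    then show ?thesis
      unfolding HH_def a sum_distrib_right
      by (simp only: sum_distrib_right)
        (intro sum.cong refl, simp add: u_def v_def power_mult_distrib mult_ac)
  qed
  have PSi: "0 \<le> (\<integral>p. P N p * S N p * HH p \<partial>lborel)" for N
  proof -
    have "(\<integral>p. P N p * S N p * HH p \<partial>lborel) = (\<Sum>i<N. \<Sum>j<N. ((2 * t) ^ i / fact i * ((2 * t) ^ j * (1 - (- 1) ^ j) / fact j)) *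
      (\<integral>x. H x * (fst x ^ j * snd x ^ i) \<partial>lborel)\<^sup>2)"
      unfolding expand
      by (subst Bochner_Integration.integral_sum, intro Bochner_Integration.integrable_sum integrable_mult_right integrable_pair_product[OF mono mono],
          subst Bochner_Integration.integral_sum, intro integrable_mult_right integrable_pair_product[OF mono mono],
          subst integral_mult_right_zero, subst integral_pair_product[OF mono mono], simp add: power2_eq_square)
    also have "\<dots> \<ge> 0"
    proof (intro sum_nonneg mult_nonneg_nonneg divide_nonneg_pos)
      fix j :: nat
      show "0 \<le> 1 - (- 1 :: real) ^ j" by (cases "even j") auto
    qed (use t in auto)
    finally show ?thesis .
  qed
  have lim: "(\<lambda>N. P N p * S N p * HH p) \<longlonglongrightarrow> exp (u p) * (exp (v p) - exp (- v p)) * HH p" for p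
    unfolding Seq P_def by (intro tendsto_intros Slim)
  have eq: "exp (u p) * (exp (v p) - exp (- v p)) * HH p = heat_kernel_odd t (fst p) (snd p) * (h (fst p) * h (snd p))" for p
    unfolding heat_kernel_odd_factor by (simp add: u_def v_def HH_def H_def mult_ac)
  have PSm: "(\<lambda>p. P N p * S N p * HH p) \<in> borel_measurable lborel" for N
    unfolding P_def S_def by measurable
  have bm: "(\<lambda>p. exp (u p) * (exp (v p) - exp (- v p)) * HH p) \<in> borel_measurable lborel" by measurable
  have limAE: "AE p in lborel. (\<lambda>N. P N p * S N p * HH p) \<longlonglongrightarrow> exp (u p) * (exp (v p) - exp (- v p)) * HH p"
    using lim by (intro AE_I2)
  have dom: "AE p in lborel. norm (P N p * S N p * HH p) \<le> 2 * K\<^sup>2 * \<bar>HH p\<bar>" for N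
    using PSb by (intro AE_I2) simp
  have di: "integrable lborel (\<lambda>p. 2 * K\<^sup>2 * \<bar>HH p\<bar>)" using HHi by simp
  show "integrable lborel (\<lambda>p::plane \<times> plane. heat_kernel_odd t (fst p) (snd p) * (h (fst p) * h (snd p)))"
    using integrable_dominated_convergence[OF bm PSm di limAE dom] unfolding eq .
  have "(\<lambda>N. \<integral>p. P N p * S N p * HH p \<partial>lborel) \<longlonglongrightarrow> (\<integral>p. exp (u p) * (exp (v p) - exp (- v p)) * HH p \<partial>lborel)"
    by (rule integral_dominated_convergence[OF bm PSm di limAE dom])
  then have "0 \<le> (\<integral>p. exp (u p) * (exp (v p) - exp (- v p)) * HH p \<partial>lborel)"
    by (rule LIMSEQ_le_const) (use PSi in auto)
  then show "0 \<le> (\<integral>p. heat_kernel_odd t (fst p) (snd p) * (h (fst p) * h (snd p)) \<partial>lborel)"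
    unfolding eq .
qed

text \<open>Superpose the positive definite heat forms over t. The exchange of integrals needs
  absolute integrability: as h lives in the right half plane, the heat kernels there are nonnegative
  and the t-integral of the modulus is again the Green kernel times \<bar>h(x) h(y)\<bar>, off the
  diagonal.\<close>

lemma energy_form_nonneg:
  assumes d: "bounded_density B \<rho> h" and hp: "\<And>x. fst x \<le> 0 \<Longrightarrow> h x = 0"
  shows "0 \<le> energy_form h h"
proof -
  note hm[measurable] = dens_measurable[OF d]
  let ?gh = "\<lambda>p::plane \<times> plane. green_kernel (fst p) (snd p) * (h (fst p) * h (snd p))"
  let ?f = "\<lambda>(p::plane \<times> plane) t::real. indicator {0<..} t * (heat_kernel_odd t (fst p) (snd p) / t) * (h (fst p) * h (snd p))"
  have i: "integrable lborel ?gh"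
    using integrable_pair_green[OF d d] by (simp add: split_def lborel_prod)
  have ne: "AE p in (lborel :: (plane \<times> plane) measure). snd p \<noteq> fst p"
  proof -
    have "AE p in (lborel \<Otimes>\<^sub>M lborel) :: (plane \<times> plane) measure. snd p \<noteq> fst p"
    proof (rule lborel_pair.AE_pair_measure)
      show "{p \<in> space (lborel \<Otimes>\<^sub>M lborel). snd p \<noteq> fst p} \<in> sets ((lborel \<Otimes>\<^sub>M lborel) :: (plane \<times> plane) measure)"
        by measurable
    qed (simp add: AE_lborel_singleton)
    then show ?thesis unfolding lborel_prod .
  qed
  have hb: "has_bochner_integral lborel (?f p) (2 * green_kernel (fst p) (snd p) * (h (fst p) * h (snd p)))
      \<and> has_bochner_integral lborel (\<lambda>t. norm (?f p t)) (2 * \<bar>?gh p\<bar>)"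
    if p: "snd p \<noteq> fst p" for p
  proof (cases "h (fst p) * h (snd p) = 0")
    case False
    then have pos: "fst (fst p) > 0" "fst (snd p) > 0" using hp[of "fst p"] hp[of "snd p"] by (force simp: not_le[symmetric])+
    have g0: "green_kernel (fst p) (snd p) \<ge> 0" by (rule green_kernel_nonneg[OF pos p])
    have k0: "heat_kernel_odd t (fst p) (snd p) \<ge> 0" if "t > 0" for t
      using dist_le_dist_reflect[of "fst p" "snd p"] pos that by (simp add: heat_kernel_odd_def power_mono)
    have "(\<integral>\<^sup>+t. ennreal (indicator {0<..} t * (heat_kernel_odd t (fst p) (snd p) / t)) \<partial>lborel) = ennreal (2 * green_kernel (fst p) (snd p))"
      by (subst green_kernel_eq_nn_integral[OF pos p, symmetric], rule nn_integral_cong) (auto simp: indicator_def)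
    then have b: "has_bochner_integral lborel (\<lambda>t. indicator {0<..} t * (heat_kernel_odd t (fst p) (snd p) / t)) (2 * green_kernel (fst p) (snd p))"
      using g0 k0 by (intro has_bochner_integral_nn_integral) (auto simp: indicator_def heat_kernel_odd_def)
    have n: "norm (?f p t) = indicator {0<..} t * (heat_kernel_odd t (fst p) (snd p) / t) * \<bar>h (fst p) * h (snd p)\<bar>" for t
      using k0[of t] by (auto simp: indicator_def abs_mult)
    have a: "2 * \<bar>?gh p\<bar> = 2 * green_kernel (fst p) (snd p) * \<bar>h (fst p) * h (snd p)\<bar>"
      using g0 by (simp add: abs_mult)
    show ?thesis unfolding n a by (intro conjI has_bochner_integral_mult_left b)
  qed auto
  have fm: "(\<lambda>(p, t). ?f p t) \<in> borel_measurable (lborel \<Otimes>\<^sub>M lborel)"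
    unfolding heat_kernel_odd_def split_def by measurable
  have I: "integrable (lborel \<Otimes>\<^sub>M lborel) (\<lambda>(p, t). ?f p t)"
  proof (rule lborel_pair.Fubini_integrable[OF fm])
    have e: "AE p in lborel. 2 * \<bar>?gh p\<bar> = (\<integral>t. norm (?f p t) \<partial>lborel)"
      using ne by eventually_elim (rule has_bochner_integral_integral_eq[OF conjunct2[OF hb], symmetric])
    have "integrable lborel (\<lambda>p. 2 * \<bar>?gh p\<bar>)" using i by simp
    moreover have "(\<lambda>p. \<integral>t. norm (?f p t) \<partial>lborel) \<in> borel_measurable lborel"
      using measurable_compose[OF fm borel_measurable_norm] by (intro lborel.borel_measurable_lebesgue_integral) (simp only: split_def)
    ultimately have "integrable lborel (\<lambda>p. \<integral>t. norm (?f p t) \<partial>lborel)"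
      using integrable_cong_AE[OF _ _ e] borel_measurable_integrable by blast
    then show "integrable lborel (\<lambda>p. \<integral>t. norm (case (p, t) of (p, t) \<Rightarrow> ?f p t) \<partial>lborel)" by simp
    show "AE p in lborel. integrable lborel (\<lambda>t. case (p, t) of (p, t) \<Rightarrow> ?f p t)"
      using ne by eventually_elim (simp only: prod.case, rule integrable.intros[OF conjunct1[OF hb]])
  qed
  have "0 \<le> (\<integral>t. (\<integral>p. ?f p t \<partial>lborel) \<partial>lborel)"
  proof (rule Bochner_Integration.integral_nonneg)
    fix t :: real
    show "0 \<le> (\<integral>p. ?f p t \<partial>lborel)"
    proof (cases "t > 0")
      case True
      have "(\<integral>p. ?f p t \<partial>lborel) = 1 / t * (\<integral>p. heat_kernel_odd t (fst p) (snd p) * (h (fst p) * h (snd p)) \<partial>lborel)"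
        using True by (subst integral_mult_right_zero[symmetric]) simp
      then show ?thesis using heat_kernel_odd_positive_definite(2)[OF d True] True by simp
    qed simp
  qed
  also have "\<dots> = (\<integral>p. (\<integral>t. ?f p t \<partial>lborel) \<partial>lborel)"
    using lborel_pair.Fubini_integral[OF I] by simp
  also have "\<dots> = (\<integral>p. 2 * ?gh p \<partial>lborel)"
  proof (rule integral_cong_AE)
    show "AE p in lborel. (\<integral>t. ?f p t \<partial>lborel) = 2 * ?gh p"
      using ne by eventually_elim (use has_bochner_integral_integral_eq[OF conjunct1[OF hb]] in simp)
    show "(\<lambda>p. \<integral>t. ?f p t \<partial>lborel) \<in> borel_measurable lborel"
      using fm by (intro lborel.borel_measurable_lebesgue_integral) (simp add: split_def)
  qed (use i in auto)
  also have "\<dots> = 2 * (2 * pi * energy_form h h)"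
    unfolding energy_form_eq_pair(1)[OF d d] by (simp add: split_def lborel_prod)
  finally show ?thesis using pi_gt_zero by (auto simp: zero_le_mult_iff)
qed

section \<open>The profile function and its conjugate\<close>

locale profile =
  fixes f :: "real \<Rightarrow> real" and T :: real
  assumes mono_f: "mono f" and f_nonpos: "\<And>s. s \<le> 0 \<Longrightarrow> f s = 0"
    and f_const: "\<And>s. T \<le> s \<Longrightarrow> f s = f T" and T_ge_1: "1 \<le> T"
begin

text \<open>For negative t the interval is empty; the resulting value 0 is the correct one, because
  f vanishes there.\<close>

definition F :: "real \<Rightarrow> real" where
  "F t = integral {0..t} f"

text \<open>The convex conjugate of \<^term>\<open>F\<close>; restricting the supremum to \<open>[0, T]\<close> keeps it finite and
  Lipschitz.\<close>

definition \<Phi> :: "real \<Rightarrow> real" where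
  "\<Phi> s = (SUP t\<in>{0..T}. s * t - F t)"

lemma f_nonneg: "0 \<le> f s"
proof (cases "s \<le> 0")
  case False
  then have "f 0 \<le> f s" by (intro monoD[OF mono_f]) simp
  then show ?thesis by (simp add: f_nonpos)
qed (simp add: f_nonpos)

lemma f_le_T: "f s \<le> f T"
  using monoD[OF mono_f, of s T] f_const[of s] by (cases "s \<le> T") auto

lemma f_integrable: "f integrable_on {a..b}"
  by (rule integrable_on_mono_on) (use mono_f in \<open>auto simp: mono_on_def mono_def\<close>)

lemma f_measurable [measurable]: "f \<in> borel_measurable borel"
  by (rule borel_measurable_mono[OF mono_f])

lemma F_nonpos: "t \<le> 0 \<Longrightarrow> F t = 0"
  by (cases "t = 0") (auto simp: F_def)

lemma F_diff: "0 \<le> u \<Longrightarrow> u \<le> v \<Longrightarrow> F v - F u = integral {u..v} f"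
  unfolding F_def using Henstock_Kurzweil_Integration.integral_combine[of 0 u v f, OF _ _ f_integrable] by simp

lemma F_diff_bounds:
  assumes "0 \<le> u" "u \<le> v"
  shows "f u * (v - u) \<le> F v - F u" "F v - F u \<le> f v * (v - u)"
proof -
  have "integral {u..v} (\<lambda>x. f u) \<le> integral {u..v} f"
    by (rule integral_le) (auto intro: f_integrable monoD[OF mono_f])
  then show "f u * (v - u) \<le> F v - F u" using assms by (simp add: F_diff mult.commute)
  have "integral {u..v} f \<le> integral {u..v} (\<lambda>x. f v)"
    by (rule integral_le) (auto intro: f_integrable monoD[OF mono_f])
  then show "F v - F u \<le> f v * (v - u)" using assms by (simp add: F_diff mult.commute)
qed

text \<open>Convexity of the primitive: f u is a subgradient at u even where f jumps. The case
  distinction only accounts for the empty intervals at negative arguments.\<close>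

lemma F_subgradient: "f u * (v - u) \<le> F v - F u"
proof -
  consider "u \<ge> 0" "u \<le> v" | "v \<ge> 0" "v \<le> u" | "u \<le> 0" "v \<ge> 0" | "u \<ge> 0" "v \<le> 0" | "u \<le> 0" "v \<le> 0" by linarith
  then show ?thesis
  proof cases
    case 1
    then show ?thesis by (rule F_diff_bounds(1))
  next
    case 2
    then have "F u - F v \<le> f u * (u - v)" by (rule F_diff_bounds(2))
    then show ?thesis by (simp add: algebra_simps)
  next
    case 3
    then have "0 \<le> F v - F 0" using F_diff_bounds(1)[of 0 v] by (simp add: f_nonpos)
    then show ?thesis using 3 by (simp add: f_nonpos F_nonpos)
  next
    case 4
    then have "F u - F 0 \<le> f u * u" using F_diff_bounds(2)[of 0 u] by simp
    moreover have "f u * v \<le> 0" using 4 f_nonneg[of u] by (intro mult_nonneg_nonpos)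
    ultimately show ?thesis using 4 by (simp add: F_nonpos algebra_simps)
  next
    case 5
    then show ?thesis by (simp add: f_nonpos F_nonpos)
  qed
qed

lemma F_nonneg: "0 \<le> F t"
  using F_subgradient[of 0 t] by (simp add: f_nonpos F_nonpos)

lemma F_ge_linear: "f u * (t - u) \<le> F t"
  using F_subgradient[of u t] F_nonneg[of u] by linarith

lemma \<Phi>_bdd: "bdd_above ((\<lambda>t. s * t - F t) ` {0..T})"
proof (rule bdd_aboveI2)
  fix t assume t: "t \<in> {0..T}"
  have "s * t \<le> \<bar>s\<bar> * T" using t by (intro order_trans[OF mult_right_mono[OF abs_ge_self] mult_left_mono]) auto
  then show "s * t - F t \<le> \<bar>s\<bar> * T" using F_nonneg[of t] by linarith
qed

lemma \<Phi>_upper: "t \<in> {0..T} \<Longrightarrow> s * t - F t \<le> \<Phi> s"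
  unfolding \<Phi>_def by (rule cSUP_upper[OF _ \<Phi>_bdd])

lemma \<Phi>_least: "(\<And>t. t \<in> {0..T} \<Longrightarrow> s * t - F t \<le> c) \<Longrightarrow> \<Phi> s \<le> c"
  unfolding \<Phi>_def using T_ge_1 by (intro cSUP_least) auto

lemma \<Phi>_nonneg: "0 \<le> \<Phi> s"
  using \<Phi>_upper[of 0 s] T_ge_1 by (simp add: F_nonpos)

lemma \<Phi>_zero: "\<Phi> 0 = 0"
  using \<Phi>_nonneg[of 0] by (intro antisym \<Phi>_least) (simp_all add: F_nonneg)

lemma \<Phi>_lipschitz: "\<bar>\<Phi> s - \<Phi> s'\<bar> \<le> T * \<bar>s - s'\<bar>"
proof -
  have "\<Phi> s \<le> \<Phi> s' + T * \<bar>s - s'\<bar>" for s s'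
  proof (rule \<Phi>_least)
    fix t assume t: "t \<in> {0..T}"
    have "(s - s') * t \<le> \<bar>s - s'\<bar> * T" using t by (intro order_trans[OF mult_right_mono[OF abs_ge_self] mult_left_mono]) auto
    then show "s * t - F t \<le> \<Phi> s' + T * \<bar>s - s'\<bar>" using \<Phi>_upper[OF t, of s'] by (simp add: algebra_simps)
  qed
  from this[of s s'] this[of s' s] show ?thesis by (simp add: abs_le_iff abs_minus_commute algebra_simps)
qed

lemma \<Phi>_continuous: "continuous_on UNIV \<Phi>"
proof (rule continuous_at_imp_continuous_on, rule ballI)
  fix s
  have "((\<lambda>s'. T * \<bar>s' - s\<bar>) \<longlongrightarrow> T * \<bar>s - s\<bar>) (at s)" by (intro tendsto_intros)
  then have "((\<lambda>s'. T * \<bar>s' - s\<bar>) \<longlongrightarrow> 0) (at s)" by simp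
  then have "((\<lambda>s'. \<Phi> s' - \<Phi> s) \<longlongrightarrow> 0) (at s)"
    by (rule Lim_null_comparison[rotated]) (simp add: \<Phi>_lipschitz)
  then show "isCont \<Phi> s" unfolding isCont_def by (simp add: LIM_zero_iff)
qed

lemma \<Phi>_measurable [measurable]: "\<Phi> \<in> borel_measurable borel"
  by (rule borel_measurable_continuous_onI[OF \<Phi>_continuous])

text \<open>Fenchel-Young. The supremum defining \<Phi> stops at T, but beyond T the slope of F is f
  T \<ge> s, so larger u cannot do better than u = T.\<close>

lemma young:
  assumes "0 \<le> s" "s \<le> f T"
  shows "s * u \<le> \<Phi> s + F u"
proof -
  consider "u \<le> 0" | "0 \<le> u" "u \<le> T" | "T \<le> u" by linarith
  then show ?thesis
  proof cases
    case 1
    then have "s * u \<le> 0" using assms by (intro mult_nonneg_nonpos)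
    then show ?thesis using \<Phi>_nonneg[of s] F_nonneg[of u] by linarith
  next
    case 2
    then show ?thesis using \<Phi>_upper[of u s] by simp
  next
    case 3
    have "s * (u - T) \<le> f T * (u - T)" using assms 3 by (intro mult_right_mono) auto
    also have "\<dots> \<le> F u - F T" by (rule F_subgradient)
    finally show ?thesis using \<Phi>_upper[of T s] T_ge_1 by (simp add: algebra_simps)
  qed
qed

lemma young_eq: "f u * u = \<Phi> (f u) + F u"
proof (rule antisym)
  show "f u * u \<le> \<Phi> (f u) + F u" by (rule young) (auto simp: f_nonneg f_le_T)
  have "\<Phi> (f u) \<le> f u * u - F u"
    by (rule \<Phi>_least) (use F_subgradient[of u] in \<open>auto simp: algebra_simps\<close>)
  then show "\<Phi> (f u) + F u \<le> f u * u" by simp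
qed

text \<open>Equality makes s a subgradient of F at u; comparing with f slightly to the right and to
  the left of u squeezes s between two limits that agree at a point of continuity.\<close>

lemma young_eq_unique:
  assumes s: "0 \<le> s" "s \<le> f T" and eq: "s * u = \<Phi> s + F u" and c: "isCont f u"
  shows "s = f u"
proof (rule antisym)
  have sub: "s * (v - u) \<le> f v * (v - u)" for v
    using young[OF s, of v] eq F_subgradient[of v u] by (simp add: algebra_simps)
  have lim: "(\<lambda>n. f (u + 1 / Suc n)) \<longlonglongrightarrow> f u" "(\<lambda>n. f (u - 1 / Suc n)) \<longlonglongrightarrow> f u"
  proof -
    have "(\<lambda>n. u + 1 / Suc n) \<longlonglongrightarrow> u + 0" "(\<lambda>n. u - 1 / Suc n) \<longlonglongrightarrow> u - 0"
      by (intro tendsto_intros LIMSEQ_Suc[OF lim_1_over_n])+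
    then show "(\<lambda>n. f (u + 1 / Suc n)) \<longlonglongrightarrow> f u" "(\<lambda>n. f (u - 1 / Suc n)) \<longlonglongrightarrow> f u"
      by (auto intro: isCont_tendsto_compose[OF c])
  qed
  have "s \<le> f (u + 1 / Suc n)" for n using sub[of "u + 1 / Suc n"] by (simp add: divide_le_cancel del: of_nat_Suc)
  then show "s \<le> f u" by (intro LIMSEQ_le_const[OF lim(1)]) auto
  have "f (u - 1 / Suc n) \<le> s" for n using sub[of "u - 1 / Suc n"] by (simp add: divide_le_cancel del: of_nat_Suc)
  then show "f u \<le> s" by (intro LIMSEQ_le_const2[OF lim(2)]) auto
qed

text \<open>For t > 1 the growth of s t is paid for by F t \<ge> f 1 (t - 1). This makes the penalty
  of a patch of height \<open>lam * f 1\<close> at most its mass.\<close>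

lemma \<Phi>_le: "0 \<le> s \<Longrightarrow> s \<le> f 1 \<Longrightarrow> \<Phi> s \<le> s"
proof (rule \<Phi>_least)
  fix t assume s: "0 \<le> s" "s \<le> f 1" and t: "t \<in> {0..T}"
  show "s * t - F t \<le> s"
  proof (cases "t \<le> 1")
    case True
    have "s * t \<le> s * 1" using s True by (intro mult_left_mono)
    then show ?thesis using F_nonneg[of t] by simp
  next
    case False
    have "s * (t - 1) \<le> f 1 * (t - 1)" using s False by (intro mult_right_mono) auto
    also have "\<dots> \<le> F t" by (rule F_ge_linear)
    finally show ?thesis by (simp add: algebra_simps)
  qed
qed

end

section \<open>The variational problem\<close>

lemma Dom_compact: "compact (Dom r)"
  and Dom_borel [measurable]: "Dom r \<in> sets borel"
proof -
  have "Dom r = {r / 2..3 * r / 2} \<times> {- r..r}"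
    by (auto simp: Dom_def abs_le_iff)
  then show "compact (Dom r)" by (auto intro: compact_Times)
  then show "Dom r \<in> sets borel" by (intro borel_closed compact_imp_closed)
qed

lemma Dom_norm: "x \<in> Dom r \<Longrightarrow> norm x \<le> 3 * r"
  using norm_Pair_le[of "fst x" "snd x"] by (auto simp: Dom_def)

lemma integral_Dom: "r > 0 \<Longrightarrow> (\<integral>x. indicator (Dom r) x \<partial>lborel) = 2 * r\<^sup>2"
proof -
  assume r: "r > 0"
  have e: "Dom r = cbox (r / 2, - r) (3 * r / 2, r)"
    by (auto simp: Dom_def cbox_def Basis_prod_def abs_le_iff)
  have "(\<integral>x. indicator (Dom r) x \<partial>lborel) = measure lborel (Dom r)" by simp
  also have "\<dots> = (\<Prod>b\<in>Basis. (3 * r / 2, r) \<bullet> b - (r / 2, - r) \<bullet> b)"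
    unfolding e by (rule content_cbox) (use r in \<open>auto simp: Basis_prod_def\<close>)
  also have "\<dots> = 2 * r\<^sup>2" by (simp add: Basis_prod_def power2_eq_square)
  finally show ?thesis .
qed

text \<open>\<open>mass_room\<close> says that the whole rectangle, of area 2 r r, filled with the
  maximal density carries more than \<kappa>; without it the mass constraint could not be
  met.\<close>

locale vortex = profile f T for f T +
  fixes r \<kappa> W lam :: real
  assumes r: "r > 0" and \<kappa>: "\<kappa> > 0" and W: "W > 0" and lam: "lam > 0"
    and mass_room: "\<kappa> < lam * f T * (2 * r\<^sup>2)"
begin

definition K :: "(plane \<Rightarrow> real) set" where
  "K = {\<zeta>. \<zeta> \<in> borel_measurable borel \<and> (\<forall>x. 0 \<le> \<zeta> x) \<and> (\<forall>x. \<zeta> x \<le> lam * f T) \<and> (\<forall>x. x \<notin> Dom r \<longrightarrow> \<zeta> x = 0)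
    \<and> integral\<^sup>L lborel \<zeta> = \<kappa> \<and> steiner_sym \<zeta>}"

text \<open>The map from s to lam \<Phi>(s / lam) is the conjugate of lam F, so s u minus the
  penalty is maximal in s at lam f u: the equation sought is its optimality condition.\<close>

definition cost :: "(plane \<Rightarrow> real) \<Rightarrow> real" where
  "cost \<zeta> = W * (\<integral>x. fst x * \<zeta> x \<partial>lborel) + lam * (\<integral>x. \<Phi> (\<zeta> x / lam) \<partial>lborel)"

definition En :: "(plane \<Rightarrow> real) \<Rightarrow> real" where
  "En \<zeta> = energy_form \<zeta> \<zeta> / 2 - cost \<zeta>"

text \<open>The pointwise maximizer of the linearized functional with potential \<psi>, where \<mu>
  is the Lagrange multiplier of the mass constraint.\<close>

definition bathtub :: "(plane \<Rightarrow> real) \<Rightarrow> real \<Rightarrow> plane \<Rightarrow> real" where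
  "bathtub \<psi> \<mu> x = (if x \<in> Dom r then lam * f (\<psi> x - W * fst x - \<mu>) else 0)"

text \<open>A quantitative form of strict decrease in \<bar>x2\<bar>: with a fixed rate c it passes
  to pointwise limits of potentials, which mere strictness does not.\<close>

definition uniformly_decreasing :: "real \<Rightarrow> (plane \<Rightarrow> real) \<Rightarrow> bool" where
  "uniformly_decreasing c \<psi> \<longleftrightarrow> (\<forall>x1 a b. (x1, b) \<in> Dom r \<longrightarrow> \<bar>a\<bar> \<le> \<bar>b\<bar> \<longrightarrow> c * (b\<^sup>2 - a\<^sup>2) \<le> \<psi> (x1, a) - \<psi> (x1, b))"

definition decrease_rate :: real where "decrease_rate = \<kappa> / (260 * pi * r\<^sup>2)"

lemma csd_pos: "decrease_rate > 0"
  using \<kappa> r by (simp add: decrease_rate_def)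

lemma K_dens: "\<zeta> \<in> K \<Longrightarrow> bounded_density (lam * f T) (3 * r) \<zeta>"
  using Dom_norm[of _ r] by (force simp: K_def bounded_density_def)

lemma K_D:
  assumes "\<zeta> \<in> K"
  shows "\<zeta> \<in> borel_measurable borel" "0 \<le> \<zeta> x" "\<zeta> x \<le> lam * f T" "x \<notin> Dom r \<Longrightarrow> \<zeta> x = 0"
    "integral\<^sup>L lborel \<zeta> = \<kappa>" "steiner_sym \<zeta>" "integrable lborel \<zeta>" "(\<integral>x. \<bar>\<zeta> x\<bar> \<partial>lborel) = \<kappa>"
  using assms dens_integrable[OF K_dens[OF assms]] by (auto simp: K_def)

lemma fT_nonneg: "0 \<le> lam * f T"
  using lam f_nonneg[of T] by simp

lemma integrable_K_mult:
  assumes "\<zeta> \<in> K" and "\<psi> \<in> borel_measurable borel" and "\<forall>x\<in>Dom r. \<bar>\<psi> x\<bar> \<le> C"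
  shows "integrable lborel (\<lambda>x. \<psi> x * \<zeta> x)"
proof (rule dens_integrable_bounded[where B = "\<bar>C\<bar> * (lam * f T)" and \<rho> = "3 * r"])
  note [measurable] = K_D(1)[OF assms(1)] assms(2)
  show "(\<lambda>x. \<psi> x * \<zeta> x) \<in> borel_measurable borel" by measurable
  fix x
  show "norm (\<psi> x * \<zeta> x) \<le> \<bar>C\<bar> * (lam * f T)"
  proof (cases "x \<in> Dom r")
    case True
    then show ?thesis using assms(3) True K_D(2,3)[OF assms(1), of x] unfolding real_norm_def abs_mult
      by (intro mult_mono) auto
  qed (simp add: K_D(4)[OF assms(1)] fT_nonneg)
  show "\<psi> x * \<zeta> x = 0" if "norm x > 3 * r" using that Dom_norm[of x r] K_D(4)[OF assms(1), of x] by force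
qed

lemma integrable_K_fst: "\<zeta> \<in> K \<Longrightarrow> integrable lborel (\<lambda>x. fst x * \<zeta> x)"
  by (rule integrable_K_mult[where C = "3 * r / 2"])
    (use r in \<open>auto simp: Dom_def intro!: borel_measurable_continuous_onI continuous_intros\<close>)

lemma \<Phi>_abs_le: "\<bar>\<Phi> s\<bar> \<le> T * \<bar>s\<bar>"
  using \<Phi>_lipschitz[of s 0] by (simp add: \<Phi>_zero)

lemma \<Phi>_K_le: "\<zeta> \<in> K \<Longrightarrow> \<bar>\<Phi> (\<zeta> x / lam)\<bar> \<le> T * f T * indicator (Dom r) x"
proof (cases "x \<in> Dom r")
  case True
  assume \<zeta>: "\<zeta> \<in> K"
  have "\<bar>\<zeta> x / lam\<bar> \<le> f T" using K_D(2,3)[OF \<zeta>, of x] lam by (simp add: divide_le_eq mult.commute)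
  then have "T * \<bar>\<zeta> x / lam\<bar> \<le> T * f T" using T_ge_1 by (intro mult_left_mono) auto
  then show ?thesis using \<Phi>_abs_le[of "\<zeta> x / lam"] True by simp
qed (simp add: K_D(4) \<Phi>_zero)

lemma integrable_ind_Dom: "integrable lborel (\<lambda>x. c * indicator (Dom r) x :: real)"
  using compact_imp_bounded[OF Dom_compact[of r]] emeasure_bounded_finite[of "Dom r"]
  by (intro integrable_mult_right integrable_real_indicator) auto

lemma integrable_K_\<Phi>: "\<zeta> \<in> K \<Longrightarrow> integrable lborel (\<lambda>x. \<Phi> (\<zeta> x / lam))"
  by (rule Bochner_Integration.integrable_bound[OF integrable_ind_Dom[of "T * f T"]])
    (use K_D(1)[of \<zeta>] \<Phi>_K_le[of \<zeta>] in \<open>auto intro!: AE_I2 order_trans[OF _ abs_ge_self]\<close>)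

definition green_sup_const :: real where
  "green_sup_const = 2 * (6 * r * \<kappa> + (lam * f T * sing_const 1 + \<kappa>))"

definition green_lipschitz_const :: real where
  "green_lipschitz_const = 2 * (lam * f T * sing_const 1 + \<kappa>)"

lemma green_K_bound: "\<zeta> \<in> K \<Longrightarrow> x \<in> Dom r \<Longrightarrow> \<bar>green \<zeta> x\<bar> \<le> green_sup_const"
proof -
  assume \<zeta>: "\<zeta> \<in> K" and x: "x \<in> Dom r"
  have 1: "\<bar>inv_neg_laplacian \<zeta> z\<bar> \<le> 6 * r * \<kappa> + (lam * f T * sing_const 1 + \<kappa>)" if "norm z \<le> 3 * r" for z
  proof -
    have "\<bar>inv_neg_laplacian \<zeta> z\<bar> \<le> (norm z + \<bar>3 * r\<bar>) * \<kappa> + (lam * f T * sing_const 1 + \<kappa>)"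
      using inv_neg_laplacian_bound[OF K_dens[OF \<zeta>], of z] K_D(8)[OF \<zeta>] by (simp add: pot_const_def)
    also have "(norm z + \<bar>3 * r\<bar>) * \<kappa> \<le> 6 * r * \<kappa>" using that r \<kappa> by (intro mult_right_mono) auto
    finally show ?thesis by simp
  qed
  show ?thesis using 1[of x] 1[of "reflect x"] Dom_norm[OF x] unfolding green_def green_sup_const_def
    by (simp add: abs_le_iff)
qed

lemma green_K_bdd: "\<zeta> \<in> K \<Longrightarrow> \<forall>x\<in>Dom r. \<bar>green \<zeta> x\<bar> \<le> green_sup_const"
  by (simp add: green_K_bound)

lemma green_K_lipschitz: "\<zeta> \<in> K \<Longrightarrow> \<bar>green \<zeta> x - green \<zeta> y\<bar> \<le> green_lipschitz_const * dist x y"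
proof -
  assume \<zeta>: "\<zeta> \<in> K"
  have 1: "\<bar>inv_neg_laplacian \<zeta> z - inv_neg_laplacian \<zeta> z'\<bar> \<le> green_lipschitz_const / 2 * dist z z'" for z z'
  proof -
    have e: "pot_const 1 (lam * f T) \<zeta> = green_lipschitz_const / 2" by (simp add: green_lipschitz_const_def pot_const_def K_D(8)[OF \<zeta>])
    show ?thesis using inv_neg_laplacian_lipschitz[OF K_dens[OF \<zeta>], of z z'] unfolding e .
  qed
  have d: "dist (reflect x) (reflect y) = dist x y" by (simp add: dist_reflect)
  show ?thesis using 1[of x y] 1[of "reflect x" "reflect y", unfolded d] unfolding green_def by argo
qed

lemma green_K_continuous: "\<zeta> \<in> K \<Longrightarrow> continuous_on UNIV (green \<zeta>)"
proof -
  assume \<zeta>: "\<zeta> \<in> K"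
  have "continuous_on UNIV (inv_neg_laplacian \<zeta>)"
    by (rule continuous_at_imp_continuous_on) (use inv_neg_laplacian_has_derivative(1)[OF K_dens[OF \<zeta>]] has_derivative_continuous in blast)
  moreover from this have "continuous_on UNIV (\<lambda>x. inv_neg_laplacian \<zeta> (reflect x))"
    by (rule continuous_on_compose2) (auto simp: reflect_def intro!: continuous_intros)
  ultimately have "continuous_on UNIV (\<lambda>x. inv_neg_laplacian \<zeta> x - inv_neg_laplacian \<zeta> (reflect x))"
    by (rule continuous_on_diff)
  then show ?thesis by (simp add: green_def[abs_def])
qed

lemma green_K_measurable: "\<zeta> \<in> K \<Longrightarrow> green \<zeta> \<in> borel_measurable borel"
  by (rule borel_measurable_continuous_onI[OF green_K_continuous])

lemma green_K_sdec: "\<zeta> \<in> K \<Longrightarrow> uniformly_decreasing decrease_rate (green \<zeta>)"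
  unfolding uniformly_decreasing_def decrease_rate_def
proof (intro allI impI)
  fix x1 a b :: real
  assume \<zeta>: "\<zeta> \<in> K" and D: "(x1, b) \<in> Dom r" and ab: "\<bar>a\<bar> \<le> \<bar>b\<bar>"
  have "(b\<^sup>2 - a\<^sup>2) * integral\<^sup>L lborel \<zeta> / (260 * pi * r\<^sup>2) \<le> green \<zeta> (x1, a) - green \<zeta> (x1, b)"
    by (rule green_strict_decreasing[OF r _ _ ab _ K_dens[OF \<zeta>] K_D(6)[OF \<zeta>] K_D(2)[OF \<zeta>] K_D(4)[OF \<zeta>]])
      (use D in \<open>auto simp: Dom_def\<close>)
  then show "\<kappa> / (260 * pi * r\<^sup>2) * (b\<^sup>2 - a\<^sup>2) \<le> green \<zeta> (x1, a) - green \<zeta> (x1, b)"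
    by (simp add: K_D(5)[OF \<zeta>] mult.commute)
qed

lemma integrable_K_green: "\<zeta> \<in> K \<Longrightarrow> \<eta> \<in> K \<Longrightarrow> integrable lborel (\<lambda>x. \<zeta> x * green \<eta> x)"
  using integrable_K_mult[OF _ green_K_measurable green_K_bdd] by (simp add: mult.commute)

lemma green_diff:
  assumes "bounded_density B \<rho> \<zeta>" "bounded_density B' \<rho>' \<eta>"
  shows "green (\<lambda>x. \<zeta> x - \<eta> x) y = green \<zeta> y - green \<eta> y"
  using dens_integrable_log[OF assms(1)] dens_integrable_log[OF assms(2)]
  by (simp add: green_def inv_neg_laplacian_def right_diff_distrib)

text \<open>Expand the nonnegative energy of the difference: a convex quadratic form lies above its
  tangent at \<eta>.\<close>

lemma energy_form_convex:
  assumes \<zeta>: "\<zeta> \<in> K" and \<eta>: "\<eta> \<in> K"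
  shows "2 * energy_form \<zeta> \<eta> - energy_form \<eta> \<eta> \<le> energy_form \<zeta> \<zeta>"
proof -
  have d: "bounded_density (lam * f T) (3 * r) (\<lambda>x. \<zeta> x - \<eta> x)"
    unfolding bounded_density_def
  proof (intro conjI allI impI)
    show "(\<lambda>x. \<zeta> x - \<eta> x) \<in> borel_measurable borel" using K_D(1)[OF \<zeta>] K_D(1)[OF \<eta>] by simp
    show "\<bar>\<zeta> x - \<eta> x\<bar> \<le> lam * f T" for x
      using K_D(2,3)[OF \<zeta>, of x] K_D(2,3)[OF \<eta>, of x] by (simp add: abs_le_iff)
    show "\<zeta> x - \<eta> x = 0" if "norm x > 3 * r" for x
      using K_dens[OF \<zeta>] K_dens[OF \<eta>] that by (simp add: bounded_density_def)
  qed
  have "0 \<le> energy_form (\<lambda>x. \<zeta> x - \<eta> x) (\<lambda>x. \<zeta> x - \<eta> x)"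
  proof (rule energy_form_nonneg[OF d])
    fix x :: plane assume "fst x \<le> 0"
    then have "x \<notin> Dom r" using r by (auto simp: Dom_def)
    then show "\<zeta> x - \<eta> x = 0" using K_D(4)[OF \<zeta>] K_D(4)[OF \<eta>] by simp
  qed
  also have "\<dots> = (\<integral>x. \<zeta> x * green \<zeta> x - \<zeta> x * green \<eta> x - (\<eta> x * green \<zeta> x - \<eta> x * green \<eta> x) \<partial>lborel)"
    unfolding energy_form_def green_diff[OF K_dens[OF \<zeta>] K_dens[OF \<eta>]] by (simp add: algebra_simps)
  also have "\<dots> = energy_form \<zeta> \<zeta> - energy_form \<zeta> \<eta> - (energy_form \<eta> \<zeta> - energy_form \<eta> \<eta>)"
    unfolding energy_form_def using integrable_K_green \<zeta> \<eta> by simp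
  also have "energy_form \<eta> \<zeta> = energy_form \<zeta> \<eta>"
    by (rule energy_form_eq_pair(2)[OF K_dens[OF \<zeta>] K_dens[OF \<eta>]])
  finally show ?thesis by simp
qed

text \<open>Steiner symmetry comes for free, since f is monotone, \<psi> decreases in \<bar>x2\<bar>
  and the term W x1 is constant on vertical lines. Only the mass has to be adjusted.\<close>

lemma bath_K:
  assumes \<psi>: "\<psi> \<in> borel_measurable borel" and s: "uniformly_decreasing c \<psi>" and c: "c \<ge> 0" and m: "integral\<^sup>L lborel (bathtub \<psi> \<mu>) = \<kappa>"
  shows "bathtub \<psi> \<mu> \<in> K"
  unfolding K_def
proof (intro CollectI conjI allI impI)
  note [measurable] = \<psi>
  have fm: "fst \<in> borel_measurable (borel :: plane measure)" by (intro borel_measurable_continuous_onI continuous_intros)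
  note [measurable] = fm
  show "bathtub \<psi> \<mu> \<in> borel_measurable borel" unfolding bathtub_def by measurable
  show "steiner_sym (bathtub \<psi> \<mu>)" unfolding steiner_sym_def
  proof (intro allI impI)
    fix x1 a b :: real assume ab: "\<bar>a\<bar> \<le> \<bar>b\<bar>"
    show "bathtub \<psi> \<mu> (x1, b) \<le> bathtub \<psi> \<mu> (x1, a)"
    proof (cases "(x1, b) \<in> Dom r")
      case True
      then have "(x1, a) \<in> Dom r" using ab by (auto simp: Dom_def)
      moreover have "0 \<le> c * (b\<^sup>2 - a\<^sup>2)" using c ab by (simp add: abs_le_square_iff)
      then have "\<psi> (x1, b) \<le> \<psi> (x1, a)" using s True ab unfolding uniformly_decreasing_def by (metis diff_ge_0_iff_ge order_trans)
      ultimately show ?thesis using True lam by (auto simp: bathtub_def intro!: mult_left_mono monoD[OF mono_f])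
    qed (use lam f_nonneg in \<open>auto simp: bathtub_def\<close>)
  qed
qed (use m lam f_nonneg f_le_T fT_nonneg in \<open>auto simp: bathtub_def intro: mult_left_mono\<close>)

end

section \<open>Bathtub maximizers of the linearized energy\<close>

context vortex
begin

text \<open>On the rectangle W x1 lies between 0 and 2 r W. At the high level the argument of f is
  nonpositive throughout; at the low level it is at least T throughout, so the density is constant
  and \<open>mass_room\<close> applies.\<close>

lemma bath_mass_limits:
  assumes \<psi>b: "\<forall>x\<in>Dom r. \<bar>\<psi> x\<bar> \<le> C"
  shows "integral\<^sup>L lborel (bathtub \<psi> (C + 2 * r * W)) = 0"
    and "integral\<^sup>L lborel (bathtub \<psi> (- (C + 2 * r * W) - T)) > \<kappa>"
proof -
  have b: "\<bar>\<psi> x - W * fst x\<bar> \<le> C + 2 * r * W" if "x \<in> Dom r" for x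
  proof -
    have "W * fst x \<le> W * (2 * r)" "0 \<le> W * fst x" using that W r by (auto simp: Dom_def)
    moreover have "2 * r * W = W * (2 * r)" by simp
    moreover have "\<bar>\<psi> x\<bar> \<le> C" using \<psi>b that by blast
    ultimately show ?thesis by argo
  qed
  have "bathtub \<psi> (C + 2 * r * W) = (\<lambda>x. 0)"
    using b by (force simp: bathtub_def fun_eq_iff f_nonpos abs_le_iff)
  then show "integral\<^sup>L lborel (bathtub \<psi> (C + 2 * r * W)) = 0" by simp
  have tb: "T \<le> \<psi> x - W * fst x - (- (C + 2 * r * W) - T)" if "x \<in> Dom r" for x
    using b[OF that] by (simp add: abs_le_iff)
  have 2: "bathtub \<psi> (- (C + 2 * r * W) - T) = (\<lambda>x. lam * f T * indicator (Dom r) x)"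
    using f_const[OF tb] by (intro ext) (simp add: bathtub_def)
  have "integral\<^sup>L lborel (bathtub \<psi> (- (C + 2 * r * W) - T)) = lam * f T * (2 * r\<^sup>2)"
    unfolding 2 using integral_Dom[OF r] by simp
  then show "integral\<^sup>L lborel (bathtub \<psi> (- (C + 2 * r * W) - T)) > \<kappa>" using mass_room by simp
qed

text \<open>On a vertical line the argument of f is strictly monotone on either side of x2 = 0,
  hence hits each of the countably many jumps at most twice. The exceptional set has countable
  sections and is null by Fubini.\<close>

lemma AE_isCont_bath:
  assumes \<psi>[measurable]: "\<psi> \<in> borel_measurable borel" and s: "uniformly_decreasing c \<psi>" and c: "c > 0"
  shows "AE x in lborel. x \<in> Dom r \<longrightarrow> isCont f (\<psi> x - W * fst x - \<mu>)"
proof -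
  define J where "J = {s. \<not> isCont f s}"
  have J: "countable J" unfolding J_def by (rule mono_ctble_discont[OF mono_f])
  then have [measurable]: "J \<in> sets borel" by (rule sets.countable[rotated]) auto
  define u where "u x = \<psi> x - W * fst x - \<mu>" for x
  have fm[measurable]: "fst \<in> borel_measurable (borel :: plane measure)" by (intro borel_measurable_continuous_onI continuous_intros)
  have [measurable]: "u \<in> borel_measurable borel" unfolding u_def by measurable
  have inj: "countable {b. (x1, b) \<in> Dom r \<and> u (x1, b) \<in> J}" for x1
  proof -
    have strict: "u (x1, b) < u (x1, a)" if "(x1, b) \<in> Dom r" "\<bar>a\<bar> < \<bar>b\<bar>" for a b
    proof -
      have "a\<^sup>2 < b\<^sup>2" using that(2) abs_le_square_iff[of b a] by linarith
      then have "0 < c * (b\<^sup>2 - a\<^sup>2)" using c by simp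
      also have "\<dots> \<le> \<psi> (x1, a) - \<psi> (x1, b)" using s that unfolding uniformly_decreasing_def by auto
      finally show ?thesis by (simp add: u_def)
    qed
    have c1: "countable {b. (x1, b) \<in> Dom r \<and> u (x1, b) \<in> J \<and> P b}"
      if P: "\<And>a b. P a \<Longrightarrow> P b \<Longrightarrow> a \<noteq> b \<Longrightarrow> \<bar>a\<bar> \<noteq> \<bar>b\<bar>" for P
    proof (rule countable_image_inj_on[where f = "\<lambda>b. u (x1, b)"])
      show "countable ((\<lambda>b. u (x1, b)) ` {b. (x1, b) \<in> Dom r \<and> u (x1, b) \<in> J \<and> P b})"
        by (rule countable_subset[OF _ J]) auto
      show "inj_on (\<lambda>b. u (x1, b)) {b. (x1, b) \<in> Dom r \<and> u (x1, b) \<in> J \<and> P b}"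
      proof (rule inj_onI, rule ccontr)
        fix a b assume ab: "a \<in> {b. (x1, b) \<in> Dom r \<and> u (x1, b) \<in> J \<and> P b}" "b \<in> {b. (x1, b) \<in> Dom r \<and> u (x1, b) \<in> J \<and> P b}"
          "u (x1, a) = u (x1, b)" "a \<noteq> b"
        then have "\<bar>a\<bar> \<noteq> \<bar>b\<bar>" using P by auto
        then show False using strict[of a b] strict[of b a] ab by (cases "\<bar>a\<bar> < \<bar>b\<bar>") auto
      qed
    qed
    have "{b. (x1, b) \<in> Dom r \<and> u (x1, b) \<in> J} = {b. (x1, b) \<in> Dom r \<and> u (x1, b) \<in> J \<and> b \<ge> 0} \<union> {b. (x1, b) \<in> Dom r \<and> u (x1, b) \<in> J \<and> b \<le> 0}"
      by auto
    then show ?thesis using c1[of "\<lambda>b. b \<ge> 0"] c1[of "\<lambda>b. b \<le> 0"] by (simp add: countable_Un)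
  qed
  have "AE x in (lborel \<Otimes>\<^sub>M lborel). \<not> (x \<in> Dom r \<and> u x \<in> J)"
  proof (rule lborel_pair.AE_pair_measure)
    have "{x \<in> space borel. \<not> (x \<in> Dom r \<and> u x \<in> J)} \<in> sets borel" by measurable
    then show "{x \<in> space (lborel \<Otimes>\<^sub>M lborel). \<not> (x \<in> Dom r \<and> u x \<in> J)} \<in> sets (lborel \<Otimes>\<^sub>M lborel)"
      unfolding lborel_prod by simp
    have "AE b in lborel. \<not> ((x1, b) \<in> Dom r \<and> u (x1, b) \<in> J)" for x1
      using AE_not_in[OF countable_imp_null_set_lborel[OF inj[of x1]]] by simp
    then show "AE x1 in lborel. AE b in lborel. \<not> ((x1, b) \<in> Dom r \<and> u (x1, b) \<in> J)" by simp
  qed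
  then have "AE x in lborel. \<not> (x \<in> Dom r \<and> u x \<in> J)" unfolding lborel_prod .
  then show ?thesis by eventually_elim (auto simp: J_def u_def)
qed

lemma bath_abs_le: "norm (bathtub \<psi> \<mu> x) \<le> lam * f T * indicator (Dom r) x"
  using lam f_le_T f_nonneg by (auto simp: bathtub_def abs_mult intro!: mult_left_mono)

lemma bath_measurable:
  assumes [measurable]: "\<psi> \<in> borel_measurable borel"
  shows "bathtub \<psi> \<mu> \<in> borel_measurable borel"
proof -
  have [measurable]: "fst \<in> borel_measurable (borel :: plane measure)" by (intro borel_measurable_continuous_onI continuous_intros)
  show ?thesis unfolding bathtub_def by measurable
qed

lemma bath_tendsto:
  assumes \<psi>: "\<psi> \<in> borel_measurable borel" and s: "uniformly_decreasing c \<psi>" and c: "c > 0"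
    and lim: "\<forall>x\<in>Dom r. (\<lambda>n. \<psi>n n x) \<longlonglongrightarrow> \<psi> x" and mu: "\<mu>n \<longlonglongrightarrow> \<mu>"
  shows "AE x in lborel. (\<lambda>n. bathtub (\<psi>n n) (\<mu>n n) x) \<longlonglongrightarrow> bathtub \<psi> \<mu> x"
  using AE_isCont_bath[OF \<psi> s c, of \<mu>]
proof eventually_elim
  fix x assume x: "x \<in> Dom r \<longrightarrow> isCont f (\<psi> x - W * fst x - \<mu>)"
  show "(\<lambda>n. bathtub (\<psi>n n) (\<mu>n n) x) \<longlonglongrightarrow> bathtub \<psi> \<mu> x"
  proof (cases "x \<in> Dom r")
    case True
    have c: "isCont f (\<psi> x - W * fst x - \<mu>)" using x True by blast
    have l: "(\<lambda>n. \<psi>n n x - W * fst x - \<mu>n n) \<longlonglongrightarrow> \<psi> x - W * fst x - \<mu>"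
      by (intro tendsto_diff tendsto_const mu bspec[OF lim True])
    note isCont_tendsto_compose[OF c l]
    then have "(\<lambda>n. lam * f (\<psi>n n x - W * fst x - \<mu>n n)) \<longlonglongrightarrow> lam * f (\<psi> x - W * fst x - \<mu>)"
      by (rule tendsto_mult_left)
    then show ?thesis using True by (simp add: bathtub_def)
  qed (simp add: bathtub_def)
qed

lemma bath_integral_tendsto:
  assumes \<psi>: "\<psi> \<in> borel_measurable borel" and s: "uniformly_decreasing c \<psi>" and c: "c > 0"
    and \<psi>n: "\<And>n. \<psi>n n \<in> borel_measurable borel"
    and lim: "\<forall>x\<in>Dom r. (\<lambda>n. \<psi>n n x) \<longlonglongrightarrow> \<psi> x" and mu: "\<mu>n \<longlonglongrightarrow> \<mu>"
  shows "(\<lambda>n. integral\<^sup>L lborel (bathtub (\<psi>n n) (\<mu>n n))) \<longlonglongrightarrow> integral\<^sup>L lborel (bathtub \<psi> \<mu>)"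
  by (rule integral_dominated_convergence[OF _ _ integrable_ind_Dom[of "lam * f T"] bath_tendsto[OF \<psi> s c lim mu]])
    (use bath_measurable[OF \<psi>] bath_measurable[OF \<psi>n] bath_abs_le in \<open>auto\<close>)

text \<open>Intermediate value theorem for the mass as a function of \<mu>. The mass is continuous
  although f is not, because the jumps of f are met on a null set only.\<close>

lemma ex_bath_K:
  assumes \<psi>: "\<psi> \<in> borel_measurable borel" and s: "uniformly_decreasing c \<psi>" and c: "c > 0"
    and \<psi>b: "\<forall>x\<in>Dom r. \<bar>\<psi> x\<bar> \<le> C"
  obtains \<mu> where "\<bar>\<mu>\<bar> \<le> C + 2 * r * W + T" "bathtub \<psi> \<mu> \<in> K"
proof -
  let ?m = "\<lambda>\<mu>. integral\<^sup>L lborel (bathtub \<psi> \<mu>)"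
  let ?a = "- (C + 2 * r * W) - T" and ?b = "C + 2 * r * W"
  have "(r, 0) \<in> Dom r" using r by (auto simp: Dom_def)
  then have C0: "0 \<le> C" using \<psi>b by force
  have "0 \<le> 2 * r * W" using r W by simp
  then have ab: "?a \<le> ?b" using C0 T_ge_1 by linarith
  have "\<forall>\<mu>. ?a \<le> \<mu> \<and> \<mu> \<le> ?b \<longrightarrow> isCont ?m \<mu>"
  proof (intro allI impI)
    fix \<mu>
    show "isCont ?m \<mu>"
      unfolding continuous_at_sequentially comp_def
      by (auto intro!: bath_integral_tendsto[OF \<psi> s c] \<psi>)
  qed
  then have "\<exists>\<mu>. ?a \<le> \<mu> \<and> \<mu> \<le> ?b \<and> ?m \<mu> = \<kappa>"
    using bath_mass_limits[OF \<psi>b] \<kappa> by (intro IVT2 ab) auto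
  then obtain \<mu> where m: "?a \<le> \<mu>" "\<mu> \<le> ?b" "?m \<mu> = \<kappa>" by blast
  show ?thesis
  proof (rule that)
    show "bathtub \<psi> \<mu> \<in> K" by (rule bath_K[OF \<psi> s _ m(3)]) (use c in simp)
    show "\<bar>\<mu>\<bar> \<le> C + 2 * r * W + T" using m T_ge_1 by (simp add: abs_le_iff)
  qed
qed

definition linearized_energy :: "(plane \<Rightarrow> real) \<Rightarrow> (plane \<Rightarrow> real) \<Rightarrow> real" where
  "linearized_energy \<psi> \<zeta> = (\<integral>x. \<psi> x * \<zeta> x \<partial>lborel) - cost \<zeta>"

text \<open>All admissible densities have mass \<kappa>, so the multiplier term contributes the
  constant \<mu> \<kappa>, and maximizing the linearized energy becomes a pointwise problem.\<close>

lemma lin_eq: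
  assumes \<zeta>: "\<zeta> \<in> K" and \<psi>: "\<psi> \<in> borel_measurable borel" and \<psi>b: "\<forall>x\<in>Dom r. \<bar>\<psi> x\<bar> \<le> C"
  shows "integrable lborel (\<lambda>x. lam * (\<zeta> x / lam * (\<psi> x - W * fst x - \<mu>) - \<Phi> (\<zeta> x / lam)))"
    and "linearized_energy \<psi> \<zeta> = (\<integral>x. lam * (\<zeta> x / lam * (\<psi> x - W * fst x - \<mu>) - \<Phi> (\<zeta> x / lam)) \<partial>lborel) + \<mu> * \<kappa>"
proof -
  have e: "lam * (\<zeta> x / lam * (\<psi> x - W * fst x - \<mu>) - \<Phi> (\<zeta> x / lam))
      = \<psi> x * \<zeta> x - W * (fst x * \<zeta> x) - \<mu> * \<zeta> x - lam * \<Phi> (\<zeta> x / lam)" for x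
    using lam by (simp add: algebra_simps)
  note i = integrable_K_mult[OF \<zeta> \<psi> \<psi>b] integrable_K_fst[OF \<zeta>] K_D(7)[OF \<zeta>] integrable_K_\<Phi>[OF \<zeta>]
  show "integrable lborel (\<lambda>x. lam * (\<zeta> x / lam * (\<psi> x - W * fst x - \<mu>) - \<Phi> (\<zeta> x / lam)))"
    unfolding e using i by simp
  show "linearized_energy \<psi> \<zeta> = (\<integral>x. lam * (\<zeta> x / lam * (\<psi> x - W * fst x - \<mu>) - \<Phi> (\<zeta> x / lam)) \<partial>lborel) + \<mu> * \<kappa>"
    unfolding e linearized_energy_def cost_def using i by (simp add: K_D(5)[OF \<zeta>])
qed

text \<open>In the rectangle the largest possible value is lam F at the relative stream function, by
  Fenchel-Young, with equality for the bathtub density.\<close>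

lemma bath_young:
  assumes \<zeta>: "\<zeta> \<in> K"
  shows "lam * (\<zeta> x / lam * (\<psi> x - W * fst x - \<mu>) - \<Phi> (\<zeta> x / lam))
    \<le> lam * (bathtub \<psi> \<mu> x / lam * (\<psi> x - W * fst x - \<mu>) - \<Phi> (bathtub \<psi> \<mu> x / lam))"
proof (cases "x \<in> Dom r")
  case True
  have "0 \<le> \<zeta> x / lam" "\<zeta> x / lam \<le> f T" using K_D(2,3)[OF \<zeta>, of x] lam by (auto simp: divide_le_eq mult.commute)
  then have "\<zeta> x / lam * (\<psi> x - W * fst x - \<mu>) - \<Phi> (\<zeta> x / lam) \<le> F (\<psi> x - W * fst x - \<mu>)"
    using young[of "\<zeta> x / lam" "\<psi> x - W * fst x - \<mu>"] by simp
  also have "\<dots> = bathtub \<psi> \<mu> x / lam * (\<psi> x - W * fst x - \<mu>) - \<Phi> (bathtub \<psi> \<mu> x / lam)"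
    using young_eq[of "\<psi> x - W * fst x - \<mu>"] True lam by (simp add: bathtub_def)
  finally show ?thesis using lam by (intro mult_left_mono) auto
qed (simp add: K_D(4)[OF \<zeta>] bathtub_def)

lemma bath_optimal:
  assumes \<zeta>: "\<zeta> \<in> K" and b: "bathtub \<psi> \<mu> \<in> K" and \<psi>: "\<psi> \<in> borel_measurable borel" and \<psi>b: "\<forall>x\<in>Dom r. \<bar>\<psi> x\<bar> \<le> C"
  shows "linearized_energy \<psi> \<zeta> \<le> linearized_energy \<psi> (bathtub \<psi> \<mu>)"
proof -
  let ?g = "\<lambda>\<zeta> x. lam * (\<zeta> x / lam * (\<psi> x - W * fst x - \<mu>) - \<Phi> (\<zeta> x / lam))"
  have "integral\<^sup>L lborel (?g \<zeta>) \<le> integral\<^sup>L lborel (?g (bathtub \<psi> \<mu>))"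
    by (rule integral_mono[OF lin_eq(1)[OF \<zeta> \<psi> \<psi>b, of \<mu>] lin_eq(1)[OF b \<psi> \<psi>b, of \<mu>] bath_young[OF \<zeta>, of _ \<psi> \<mu>]])
  then show ?thesis using lin_eq(2)[OF \<zeta> \<psi> \<psi>b, of \<mu>] lin_eq(2)[OF b \<psi> \<psi>b, of \<mu>] by linarith
qed

text \<open>Equal integrals force equality in Fenchel-Young almost everywhere, and equality
  determines the density wherever f is continuous at the relative stream function, that is, almost
  everywhere.\<close>

lemma bath_unique:
  assumes \<zeta>: "\<zeta> \<in> K" and b: "bathtub \<psi> \<mu> \<in> K" and \<psi>: "\<psi> \<in> borel_measurable borel" and \<psi>b: "\<forall>x\<in>Dom r. \<bar>\<psi> x\<bar> \<le> C"
    and s: "uniformly_decreasing c \<psi>" and c: "c > 0" and ge: "linearized_energy \<psi> (bathtub \<psi> \<mu>) \<le> linearized_energy \<psi> \<zeta>"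
  shows "AE x in lborel. \<zeta> x = bathtub \<psi> \<mu> x"
proof -
  let ?g = "\<lambda>\<zeta> x. lam * (\<zeta> x / lam * (\<psi> x - W * fst x - \<mu>) - \<Phi> (\<zeta> x / lam))"
  note i = lin_eq(1)[OF \<zeta> \<psi> \<psi>b, of \<mu>] lin_eq(1)[OF b \<psi> \<psi>b, of \<mu>]
  have "linearized_energy \<psi> (bathtub \<psi> \<mu>) = linearized_energy \<psi> \<zeta>" by (rule antisym[OF ge bath_optimal[OF \<zeta> b \<psi> \<psi>b]])
  then have "integral\<^sup>L lborel (?g (bathtub \<psi> \<mu>)) = integral\<^sup>L lborel (?g \<zeta>)"
    using lin_eq(2)[OF \<zeta> \<psi> \<psi>b, of \<mu>] lin_eq(2)[OF b \<psi> \<psi>b, of \<mu>] by simp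
  then have "integral\<^sup>L lborel (\<lambda>x. ?g (bathtub \<psi> \<mu>) x - ?g \<zeta> x) = 0"
    unfolding Bochner_Integration.integral_diff[OF i(2) i(1)] by (rule right_minus_eq[THEN iffD2])
  moreover have "integrable lborel (\<lambda>x. ?g (bathtub \<psi> \<mu>) x - ?g \<zeta> x)"
    by (rule Bochner_Integration.integrable_diff[OF i(2) i(1)])
  moreover have "AE x in lborel. 0 \<le> ?g (bathtub \<psi> \<mu>) x - ?g \<zeta> x"
    by (rule AE_I2, subst diff_ge_0_iff_ge, rule bath_young[OF \<zeta>, of _ \<psi> \<mu>])
  ultimately have "AE x in lborel. ?g (bathtub \<psi> \<mu>) x - ?g \<zeta> x = 0"
    by (rule integral_nonneg_eq_0_iff_AE[THEN iffD1, rotated 2])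
  then show ?thesis using AE_isCont_bath[OF \<psi> s c, of \<mu>]
  proof eventually_elim
    fix x assume eq: "?g (bathtub \<psi> \<mu>) x - ?g \<zeta> x = 0" and cont: "x \<in> Dom r \<longrightarrow> isCont f (\<psi> x - W * fst x - \<mu>)"
    show "\<zeta> x = bathtub \<psi> \<mu> x"
    proof (cases "x \<in> Dom r")
      case True
      let ?u = "\<psi> x - W * fst x - \<mu>"
      have e1: "?g (bathtub \<psi> \<mu>) x = lam * F ?u" using young_eq[of ?u] True lam by (simp add: bathtub_def)
      have "lam * (\<zeta> x / lam * ?u - \<Phi> (\<zeta> x / lam)) = lam * F ?u"
        by (rule trans[OF eq[THEN eq_iff_diff_eq_0[THEN iffD2], symmetric] e1])
      then have "\<zeta> x / lam * ?u = \<Phi> (\<zeta> x / lam) + F ?u" using lam by simp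
      then have "\<zeta> x / lam = f ?u"
        by (rule young_eq_unique[rotated 2])
          (use cont True K_D(2,3)[OF \<zeta>, of x] lam in \<open>auto simp: divide_le_eq mult.commute\<close>)
      then show ?thesis using True lam by (simp add: bathtub_def divide_eq_eq mult.commute)
    qed (simp add: K_D(4)[OF \<zeta>] bathtub_def)
  qed
qed

text \<open>\<open>En\<close> lies above its linearization at \<eta> and touches it at \<eta>, so a
  maximizer of the linearization has at least the energy of \<eta>.\<close>

lemma En_lin: "\<eta> \<in> K \<Longrightarrow> \<zeta> \<in> K \<Longrightarrow> linearized_energy (green \<eta>) \<zeta> - energy_form \<eta> \<eta> / 2 \<le> En \<zeta>"
  using energy_form_convex[of \<zeta> \<eta>] by (simp add: linearized_energy_def En_def energy_form_def mult.commute)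

lemma En_lin_eq: "\<eta> \<in> K \<Longrightarrow> En \<eta> = linearized_energy (green \<eta>) \<eta> - energy_form \<eta> \<eta> / 2"
  by (simp add: linearized_energy_def En_def energy_form_def mult.commute)

lemma En_bath_ge:
  assumes \<eta>: "\<eta> \<in> K" and b: "bathtub (green \<eta>) \<mu> \<in> K"
  shows "En \<eta> \<le> En (bathtub (green \<eta>) \<mu>)"
  using En_lin[OF \<eta> b] bath_optimal[OF \<eta> b green_K_measurable[OF \<eta>] green_K_bdd[OF \<eta>]] En_lin_eq[OF \<eta>] by simp

end

section \<open>Existence of a maximizer that satisfies the steady equation at every point\<close>

context vortex
begin

lemma K_nonempty: "K \<noteq> {}"
proof -
  \<comment> \<open>Any bounded, uniformly decreasing potential yields an admissible density; this
    is the simplest one with rate 1.\<close>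
  let ?\<psi> = "\<lambda>x::plane. - (snd x)\<^sup>2"
  have m: "?\<psi> \<in> borel_measurable borel" by (intro borel_measurable_continuous_onI continuous_intros)
  have s: "uniformly_decreasing 1 ?\<psi>" by (auto simp: uniformly_decreasing_def)
  have b: "\<forall>x\<in>Dom r. \<bar>?\<psi> x\<bar> \<le> r\<^sup>2"
    using r by (auto simp: Dom_def abs_le_square_iff[symmetric])
  obtain \<mu> where "bathtub ?\<psi> \<mu> \<in> K" using ex_bath_K[OF m s _ b] by auto
  then show ?thesis by blast
qed

lemma cost_nonneg: "\<zeta> \<in> K \<Longrightarrow> 0 \<le> cost \<zeta>"
proof -
  assume \<zeta>: "\<zeta> \<in> K"
  have "0 \<le> fst x * \<zeta> x" for x
    using K_D(2,4)[OF \<zeta>, of x] r by (cases "x \<in> Dom r") (auto simp: Dom_def)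
  then have "0 \<le> (\<integral>x. fst x * \<zeta> x \<partial>lborel)" "0 \<le> (\<integral>x. \<Phi> (\<zeta> x / lam) \<partial>lborel)"
    by (auto intro!: Bochner_Integration.integral_nonneg \<Phi>_nonneg)
  then show ?thesis unfolding cost_def using W lam by simp
qed

lemma energy_form_le: "\<zeta> \<in> K \<Longrightarrow> energy_form \<zeta> \<zeta> \<le> green_sup_const * \<kappa>"
proof -
  assume \<zeta>: "\<zeta> \<in> K"
  have "energy_form \<zeta> \<zeta> \<le> (\<integral>x. green_sup_const * \<zeta> x \<partial>lborel)"
    unfolding energy_form_def
  proof (rule integral_mono[OF integrable_K_green[OF \<zeta> \<zeta>]])
    fix x
    show "\<zeta> x * green \<zeta> x \<le> green_sup_const * \<zeta> x"
      using green_K_bound[OF \<zeta>, of x] K_D(2,4)[OF \<zeta>, of x]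
      by (cases "x \<in> Dom r") (auto simp: mult.commute[of green_sup_const] abs_le_iff intro!: mult_left_mono)
  qed (use K_D(7)[OF \<zeta>] in simp)
  then show ?thesis by (simp add: K_D(5)[OF \<zeta>])
qed

lemma En_le: "\<zeta> \<in> K \<Longrightarrow> En \<zeta> \<le> green_sup_const * \<kappa> / 2"
  using energy_form_le[of \<zeta>] cost_nonneg[of \<zeta>] by (simp add: En_def)

lemma green_tendsto:
  assumes zn: "\<And>n. \<zeta>n n \<in> K" and z: "\<zeta> \<in> K" and lim: "AE x in lborel. (\<lambda>n. \<zeta>n n x) \<longlonglongrightarrow> \<zeta> x"
  shows "(\<lambda>n. green (\<zeta>n n) x) \<longlonglongrightarrow> green \<zeta> x"
proof -
  have d: "bounded_density (lam * f T) (3 * r) (\<lambda>y. lam * f T * indicator (Dom r) y)"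
    using Dom_norm[of _ r] fT_nonneg by (force simp: bounded_density_def indicator_def)
  have gm[measurable]: "(\<lambda>y. green_kernel x y) \<in> borel_measurable borel" unfolding green_kernel_def by measurable
  have "(\<lambda>n. \<integral>y. green_kernel x y * \<zeta>n n y \<partial>lborel) \<longlonglongrightarrow> (\<integral>y. green_kernel x y * \<zeta> y \<partial>lborel)"
  proof (rule integral_dominated_convergence[OF _ _ integrable_abs[OF dens_integrable_green_kernel[OF d, of x]]])
    show "(\<lambda>y. green_kernel x y * \<zeta> y) \<in> borel_measurable lborel" using K_D(1)[OF z] by simp
    show "(\<lambda>y. green_kernel x y * \<zeta>n n y) \<in> borel_measurable lborel" for n using K_D(1)[OF zn[of n]] by simp
    show "AE y in lborel. (\<lambda>n. green_kernel x y * \<zeta>n n y) \<longlonglongrightarrow> green_kernel x y * \<zeta> y"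
      using lim by eventually_elim (intro tendsto_intros)
    show "AE y in lborel. norm (green_kernel x y * \<zeta>n n y) \<le> \<bar>green_kernel x y * (lam * f T * indicator (Dom r) y)\<bar>" for n
    proof (rule AE_I2)
      fix y
      have "\<bar>\<zeta>n n y\<bar> \<le> \<bar>lam * f T * indicator (Dom r) y\<bar>"
        using K_D(2,3,4)[OF zn[of n], of y] fT_nonneg by (cases "y \<in> Dom r") auto
      then show "norm (green_kernel x y * \<zeta>n n y) \<le> \<bar>green_kernel x y * (lam * f T * indicator (Dom r) y)\<bar>"
        unfolding real_norm_def abs_mult[of "green_kernel x y"] by (intro mult_left_mono) auto
    qed
  qed
  then show ?thesis unfolding green_eq_integral[OF K_dens[OF zn]] green_eq_integral[OF K_dens[OF z]]
    by (intro tendsto_intros)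
qed

lemma En_tendsto:
  assumes zn: "\<And>n. \<zeta>n n \<in> K" and z: "\<zeta> \<in> K" and lim: "AE x in lborel. (\<lambda>n. \<zeta>n n x) \<longlonglongrightarrow> \<zeta> x"
  shows "(\<lambda>n. En (\<zeta>n n)) \<longlonglongrightarrow> En \<zeta>"
proof -
  have le: "\<bar>\<zeta>n n x\<bar> \<le> lam * f T * indicator (Dom r) x" for n x
    using K_D(2,3,4)[OF zn[of n], of x] by (cases "x \<in> Dom r") auto
  have fm: "fst \<in> borel_measurable (borel :: plane measure)" by (intro borel_measurable_continuous_onI continuous_intros)
  have a: "(\<lambda>n. energy_form (\<zeta>n n) (\<zeta>n n)) \<longlonglongrightarrow> energy_form \<zeta> \<zeta>"
    unfolding energy_form_def
  proof (rule integral_dominated_convergence[OF _ _ integrable_ind_Dom[of "lam * f T * green_sup_const"]])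
    show "(\<lambda>x. \<zeta> x * green \<zeta> x) \<in> borel_measurable lborel" using K_D(1)[OF z] green_K_measurable[OF z] by simp
    show "(\<lambda>x. \<zeta>n n x * green (\<zeta>n n) x) \<in> borel_measurable lborel" for n
      using K_D(1)[OF zn[of n]] green_K_measurable[OF zn[of n]] by simp
    show "AE x in lborel. (\<lambda>n. \<zeta>n n x * green (\<zeta>n n) x) \<longlonglongrightarrow> \<zeta> x * green \<zeta> x"
      using lim by eventually_elim (intro tendsto_intros green_tendsto[OF zn z lim])
    show "AE x in lborel. norm (\<zeta>n n x * green (\<zeta>n n) x) \<le> lam * f T * green_sup_const * indicator (Dom r) x" for n
    proof (rule AE_I2)
      fix x
      show "norm (\<zeta>n n x * green (\<zeta>n n) x) \<le> lam * f T * green_sup_const * indicator (Dom r) x"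
      proof (cases "x \<in> Dom r")
        case True
        have "\<bar>\<zeta>n n x\<bar> * \<bar>green (\<zeta>n n) x\<bar> \<le> lam * f T * green_sup_const"
          using le[of n x] green_K_bound[OF zn[of n] True] True fT_nonneg by (intro mult_mono) auto
        then show ?thesis using True by (simp add: abs_mult)
      qed (simp add: K_D(4)[OF zn])
    qed
  qed
  have b: "(\<lambda>n. \<integral>x. fst x * \<zeta>n n x \<partial>lborel) \<longlonglongrightarrow> (\<integral>x. fst x * \<zeta> x \<partial>lborel)"
  proof (rule integral_dominated_convergence[OF _ _ integrable_ind_Dom[of "3 * r / 2 * (lam * f T)"]])
    show "(\<lambda>x. fst x * \<zeta> x) \<in> borel_measurable lborel" using K_D(1)[OF z] fm by simp
    show "(\<lambda>x. fst x * \<zeta>n n x) \<in> borel_measurable lborel" for n using K_D(1)[OF zn[of n]] fm by simp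
    show "AE x in lborel. (\<lambda>n. fst x * \<zeta>n n x) \<longlonglongrightarrow> fst x * \<zeta> x"
      using lim by eventually_elim (intro tendsto_intros)
    show "AE x in lborel. norm (fst x * \<zeta>n n x) \<le> 3 * r / 2 * (lam * f T) * indicator (Dom r) x" for n
    proof (rule AE_I2)
      fix x
      show "norm (fst x * \<zeta>n n x) \<le> 3 * r / 2 * (lam * f T) * indicator (Dom r) x"
      proof (cases "x \<in> Dom r")
        case True
        have "\<bar>fst x\<bar> * \<bar>\<zeta>n n x\<bar> \<le> 3 * r / 2 * (lam * f T)"
          using le[of n x] True r by (intro mult_mono) (auto simp: Dom_def)
        then show ?thesis using True by (simp add: abs_mult)
      qed (simp add: K_D(4)[OF zn])
    qed
  qed
  have c: "(\<lambda>n. \<integral>x. \<Phi> (\<zeta>n n x / lam) \<partial>lborel) \<longlonglongrightarrow> (\<integral>x. \<Phi> (\<zeta> x / lam) \<partial>lborel)"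
  proof (rule integral_dominated_convergence[OF _ _ integrable_ind_Dom[of "T * f T"]])
    show "(\<lambda>x. \<Phi> (\<zeta> x / lam)) \<in> borel_measurable lborel" using K_D(1)[OF z] by simp
    show "(\<lambda>x. \<Phi> (\<zeta>n n x / lam)) \<in> borel_measurable lborel" for n using K_D(1)[OF zn[of n]] by simp
    have cont: "isCont \<Phi> s" for s using \<Phi>_continuous by (simp add: continuous_on_eq_continuous_at)
    show "AE x in lborel. (\<lambda>n. \<Phi> (\<zeta>n n x / lam)) \<longlonglongrightarrow> \<Phi> (\<zeta> x / lam)"
      using lim by eventually_elim (rule isCont_tendsto_compose[OF cont], intro tendsto_intros, use lam in auto)
    show "AE x in lborel. norm (\<Phi> (\<zeta>n n x / lam)) \<le> T * f T * indicator (Dom r) x" for n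
      using \<Phi>_K_le[OF zn[of n]] by (intro AE_I2) simp
  qed
  show ?thesis unfolding En_def cost_def by (intro tendsto_intros a b c) auto
qed

text \<open>By convexity of the quadratic part, a maximizing sequence may be replaced by its bathtub
  rearrangements, for which uniform convergence of the potentials implies convergence almost everywhere.\<close>

lemma ex_maximizer: "\<exists>\<zeta>\<in>K. \<forall>\<eta>\<in>K. En \<eta> \<le> En \<zeta>"
proof -
  define S where "S = (SUP \<eta>\<in>K. En \<eta>)"
  have bdd: "bdd_above (En ` K)" by (rule bdd_aboveI2[where M = "green_sup_const * \<kappa> / 2"]) (rule En_le)
  have "\<exists>\<eta>\<in>K. S - 1 / Suc n < En \<eta>" for n
    unfolding S_def using less_cSUP_iff[OF K_nonempty bdd, of "S - 1 / Suc n"] by (simp add: S_def)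
  then obtain \<eta> where \<eta>: "\<And>n. \<eta> n \<in> K" "\<And>n. S - 1 / Suc n < En (\<eta> n)" by metis
  \<comment> \<open>The sup and Lipschitz bounds of the potentials are the same for the whole class,
    so they form a relatively compact family on the rectangle.\<close>
  obtain g k where g: "continuous_on (Dom r) g" and k: "strict_mono (k :: nat \<Rightarrow> nat)"
    and unif: "\<And>e. 0 < e \<Longrightarrow> \<exists>N. \<forall>n x. n \<ge> N \<and> x \<in> Dom r \<longrightarrow> norm (green (\<eta> (k n)) x - g x) < e"
  proof (rule Arzela_Ascoli[OF Dom_compact, of r "\<lambda>n. green (\<eta> n)" green_sup_const])
    show "norm (green (\<eta> n) x) \<le> green_sup_const" if "x \<in> Dom r" for n x using green_K_bound[OF \<eta>(1) that] by simp
    show "\<exists>d. 0 < d \<and> (\<forall>n y. y \<in> Dom r \<and> norm (x - y) < d \<longrightarrow> norm (green (\<eta> n) x - green (\<eta> n) y) < e)" if "0 < e" for x e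
    proof (intro exI conjI allI impI)
      have green_lipschitz_const: "0 \<le> green_lipschitz_const" unfolding green_lipschitz_const_def using fT_nonneg \<kappa> by (simp add: sing_const_def)
      then show "0 < e / (green_lipschitz_const + 1)" using that by simp
      fix n y assume y: "y \<in> Dom r \<and> norm (x - y) < e / (green_lipschitz_const + 1)"
      have "norm (green (\<eta> n) x - green (\<eta> n) y) \<le> green_lipschitz_const * dist x y" using green_K_lipschitz[OF \<eta>(1)] by simp
      also have "\<dots> \<le> (green_lipschitz_const + 1) * norm (x - y)" by (simp add: dist_norm distrib_right)
      also have "\<dots> < e" using y green_lipschitz_const by (simp add: pos_less_divide_eq mult.commute)
      finally show "norm (green (\<eta> n) x - green (\<eta> n) y) < e" .
    qed
  qed auto
  have ptw: "(\<lambda>n. green (\<eta> (k n)) x) \<longlonglongrightarrow> g x" if "x \<in> Dom r" for x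
    using unif that unfolding LIMSEQ_iff by meson
  \<comment> \<open>The limit \<open>g\<close> is controlled on the rectangle only; extension by 0
    gives a Borel function on the plane, and a bathtub density reads its values in the rectangle
    only.\<close>
  define \<psi> where "\<psi> x = indicator (Dom r) x *\<^sub>R g x" for x
  have \<psi>m: "\<psi> \<in> borel_measurable borel"
    unfolding \<psi>_def by (rule borel_measurable_continuous_on_indicator[OF Dom_borel g])
  have \<psi>s: "uniformly_decreasing decrease_rate \<psi>"
    unfolding uniformly_decreasing_def
  proof (intro allI impI)
    fix x1 a b assume b: "(x1, b) \<in> Dom r" and ab: "\<bar>a\<bar> \<le> \<bar>b\<bar>"
    then have a: "(x1, a) \<in> Dom r" by (auto simp: Dom_def)
    have "decrease_rate * (b\<^sup>2 - a\<^sup>2) \<le> g (x1, a) - g (x1, b)"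
      using green_K_sdec[OF \<eta>(1)] b ab unfolding uniformly_decreasing_def
      by (intro LIMSEQ_le_const[OF tendsto_diff[OF ptw[OF a] ptw[OF b]]]) auto
    then show "decrease_rate * (b\<^sup>2 - a\<^sup>2) \<le> \<psi> (x1, a) - \<psi> (x1, b)" using a b by (simp add: \<psi>_def)
  qed
  have "\<exists>\<mu>. \<bar>\<mu>\<bar> \<le> green_sup_const + 2 * r * W + T \<and> bathtub (green (\<eta> (k n))) \<mu> \<in> K" for n
    using ex_bath_K[OF green_K_measurable[OF \<eta>(1)] green_K_sdec[OF \<eta>(1)] csd_pos green_K_bdd[OF \<eta>(1)]] by blast
  then obtain \<mu>n where \<mu>n: "\<And>n. \<bar>\<mu>n n\<bar> \<le> green_sup_const + 2 * r * W + T" "\<And>n. bathtub (green (\<eta> (k n))) (\<mu>n n) \<in> K" by metis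
  have "bounded (range \<mu>n)" using \<mu>n(1) by (auto simp: bounded_iff)
  then obtain \<mu> l where l: "strict_mono (l :: nat \<Rightarrow> nat)" "(\<mu>n \<circ> l) \<longlonglongrightarrow> \<mu>"
    using bounded_imp_convergent_subsequence by blast
  define \<zeta>n where "\<zeta>n n = bathtub (green (\<eta> (k (l n)))) (\<mu>n (l n))" for n
  have ptw': "\<forall>x\<in>Dom r. (\<lambda>n. green (\<eta> (k (l n))) x) \<longlonglongrightarrow> \<psi> x"
    using LIMSEQ_subseq_LIMSEQ[OF ptw l(1)] by (simp add: \<psi>_def comp_def)
  have \<mu>l: "(\<lambda>n. \<mu>n (l n)) \<longlonglongrightarrow> \<mu>" using l(2) by (simp add: comp_def)
  have z: "bathtub \<psi> \<mu> \<in> K"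
  proof (rule bath_K[OF \<psi>m \<psi>s])
    have "(\<lambda>n. integral\<^sup>L lborel (\<zeta>n n)) \<longlonglongrightarrow> integral\<^sup>L lborel (bathtub \<psi> \<mu>)"
      unfolding \<zeta>n_def by (rule bath_integral_tendsto[OF \<psi>m \<psi>s csd_pos green_K_measurable[OF \<eta>(1)] ptw' \<mu>l])
    moreover have "integral\<^sup>L lborel (\<zeta>n n) = \<kappa>" for n unfolding \<zeta>n_def by (rule K_D(5)[OF \<mu>n(2)])
    ultimately show "integral\<^sup>L lborel (bathtub \<psi> \<mu>) = \<kappa>" by (simp add: LIMSEQ_const_iff)
  qed (use csd_pos in simp)
  have zn: "\<zeta>n n \<in> K" for n unfolding \<zeta>n_def by (rule \<mu>n(2))
  have "(\<lambda>n. En (\<zeta>n n)) \<longlonglongrightarrow> En (bathtub \<psi> \<mu>)"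
    by (rule En_tendsto[OF zn z]) (unfold \<zeta>n_def, rule bath_tendsto[OF \<psi>m \<psi>s csd_pos ptw' \<mu>l])
  moreover have "(\<lambda>n. S - 1 / Suc (k (l n))) \<longlonglongrightarrow> S - 0"
  proof (intro tendsto_intros)
    have "strict_mono (\<lambda>n. k (l n))" using k l(1) by (simp add: strict_mono_def)
    from LIMSEQ_subseq_LIMSEQ[OF LIMSEQ_Suc[OF lim_1_over_n] this]
    show "(\<lambda>n. 1 / real (Suc (k (l n)))) \<longlonglongrightarrow> 0" by (simp add: comp_def)
  qed
  moreover have "S - 1 / Suc (k (l n)) \<le> En (\<zeta>n n)" for n
    using \<eta>(2)[of "k (l n)"] En_bath_ge[OF \<eta>(1) \<mu>n(2), of "l n"] unfolding \<zeta>n_def by linarith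
  ultimately have "S - 0 \<le> En (bathtub \<psi> \<mu>)" by (intro LIMSEQ_le) auto
  then have "\<forall>\<eta>\<in>K. En \<eta> \<le> En (bathtub \<psi> \<mu>)"
    using cSUP_upper[OF _ bdd] unfolding S_def by force
  with z show ?thesis by blast
qed

text \<open>A maximizer agrees with its bathtub density almost everywhere. Replacing it by that
  density leaves the potential unchanged, so the equation then holds at every point.\<close>

theorem ex_steady_maximizer:
  obtains \<zeta> \<mu> where "\<zeta> \<in> K" "\<zeta> = bathtub (green \<zeta>) \<mu>" "\<And>\<eta>. \<eta> \<in> K \<Longrightarrow> En \<eta> \<le> En \<zeta>"
proof -
  obtain z where z: "z \<in> K" and max: "\<And>\<eta>. \<eta> \<in> K \<Longrightarrow> En \<eta> \<le> En z" using ex_maximizer by blast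
  obtain \<mu> where b: "bathtub (green z) \<mu> \<in> K"
    using ex_bath_K[OF green_K_measurable[OF z] green_K_sdec[OF z] csd_pos green_K_bdd[OF z]] by blast
  have "linearized_energy (green z) (bathtub (green z) \<mu>) \<le> linearized_energy (green z) z"
    using En_lin[OF z b] max[OF b] En_lin_eq[OF z] by simp
  then have ae: "AE x in lborel. z x = bathtub (green z) \<mu> x"
    by (intro bath_unique[OF z b green_K_measurable[OF z] green_K_bdd[OF z] green_K_sdec[OF z] csd_pos])
  define \<zeta> where "\<zeta> = bathtub (green z) \<mu>"
  have \<zeta>K: "\<zeta> \<in> K" using b by (simp add: \<zeta>_def)
  have "(\<integral>y. ln (1 / dist x y) * \<zeta> y \<partial>lborel) = (\<integral>y. ln (1 / dist x y) * z y \<partial>lborel)" for x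
  proof (rule integral_cong_AE)
    show "AE y in lborel. ln (1 / dist x y) * \<zeta> y = ln (1 / dist x y) * z y"
      using ae by eventually_elim (simp add: \<zeta>_def)
    show "(\<lambda>y. ln (1 / dist x y) * \<zeta> y) \<in> borel_measurable lborel" using K_D(1)[OF \<zeta>K] by measurable
    show "(\<lambda>y. ln (1 / dist x y) * z y) \<in> borel_measurable lborel" using K_D(1)[OF z] by measurable
  qed
  then have g: "green \<zeta> = green z" by (simp add: fun_eq_iff green_def inv_neg_laplacian_def)
  have "En \<eta> \<le> En \<zeta>" if "\<eta> \<in> K" for \<eta>
    using max[OF that] En_bath_ge[OF z b] by (simp add: \<zeta>_def)
  then show ?thesis using that[of \<zeta> \<mu>] \<zeta>K g by (simp add: \<zeta>_def)
qed

end

section \<open>Estimates independent of the vortex strength\<close>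

lemma integral_linear_combination:
  fixes u v w :: "'a \<Rightarrow> real"
  assumes "integrable M u" "integrable M v" "integrable M w"
  shows "(\<integral>x. p * u x + q * v x - s * w x \<partial>M) = p * integral\<^sup>L M u + q * integral\<^sup>L M v - s * integral\<^sup>L M w"
  using assms by simp

lemma sing_const_1 [simp]: "sing_const 1 = 16"
  by (simp add: sing_const_def)

context vortex
begin

text \<open>The size of the vortex core: density of order \<open>lam\<close> on a disc of radius
  \<open>eps\<close> has mass of order 1.\<close>

definition eps :: real where "eps = 1 / sqrt lam"

lemma eps_pos: "eps > 0"
  using lam by (simp add: eps_def)

lemma lam_eps: "lam * eps * eps = 1"
  using lam by (simp add: eps_def)

lemma lam_eps': "lam * (eps * (eps * c)) = c"
  using lam_eps by (metis mult.assoc mult_1)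

lemma integrable_K_cball: "\<zeta> \<in> K \<Longrightarrow> A \<in> sets borel \<Longrightarrow> integrable lborel (\<lambda>y. \<zeta> y * indicator A y)"
  using integrable_real_mult_indicator[OF _ K_D(7)] by (simp add: mult.commute)

text \<open>Three zones around x. Within \<open>eps\<close> the excess over ln (1 / eps) is at most
  eps / dist x y, which integrates to 16 f T; up to R eps there is no excess; beyond R eps at least
  ln R is lost. This loss later forces concentration.\<close>

lemma log_integral_le:
  assumes \<zeta>: "\<zeta> \<in> K" and R: "R \<ge> 1"
  shows "(\<integral>y. ln (1 / dist x y) * \<zeta> y \<partial>lborel)
    \<le> \<kappa> * ln (1 / eps) + 16 * f T - ln R * (\<integral>y. \<zeta> y * indicator (- cball x (R * eps)) y \<partial>lborel)"
proof -
  let ?s = "\<lambda>y. dist x y powr - 1 * indicator (cball x eps) y :: real"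
  let ?b = "\<lambda>y. ln (1 / eps) * \<zeta> y + lam * f T * eps * ?s y - ln R * (\<zeta> y * indicator (- cball x (R * eps)) y)"
  have isg: "integrable lborel ?s" by (rule integrable_dist_powr_cball) (use eps_pos in auto)
  have ib: "integrable lborel (\<lambda>y. \<zeta> y * indicator (- cball x (R * eps)) y)" by (rule integrable_K_cball[OF \<zeta>]) auto
  have "(\<integral>y. ln (1 / dist x y) * \<zeta> y \<partial>lborel) \<le> integral\<^sup>L lborel ?b"
  proof (rule integral_mono_AE[OF dens_integrable_log[OF K_dens[OF \<zeta>]]])
    show "integrable lborel ?b"
      by (intro Bochner_Integration.integrable_diff Bochner_Integration.integrable_add integrable_mult_right isg ib K_D(7)[OF \<zeta>])
    show "AE y in lborel. ln (1 / dist x y) * \<zeta> y \<le> ?b y"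
      using AE_lborel_singleton[of x]
    proof eventually_elim
      fix y assume y: "y \<noteq> x"
      then have d: "dist x y > 0" by simp
      have z: "0 \<le> \<zeta> y" "\<zeta> y \<le> lam * f T" by (rule K_D(2,3)[OF \<zeta>])+
      have eR: "eps \<le> R * eps" using R eps_pos by simp
      have ln1: "ln (1 / dist x y) = ln (1 / eps) + ln (eps / dist x y)" using d eps_pos by (simp add: ln_div)
      consider "dist x y \<le> eps" | "dist x y > eps" "dist x y \<le> R * eps" | "dist x y > R * eps" by linarith
      then show "ln (1 / dist x y) * \<zeta> y \<le> ?b y"
      proof cases
        case 1
        have "ln (eps / dist x y) \<le> eps / dist x y" using ln_le_minus_one[of "eps / dist x y"] d eps_pos by simp
        then have "ln (eps / dist x y) * \<zeta> y \<le> eps / dist x y * \<zeta> y" using z by (intro mult_right_mono)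
        also have "\<dots> \<le> eps / dist x y * (lam * f T)" using z d eps_pos by (intro mult_left_mono) auto
        finally have b: "ln (eps / dist x y) * \<zeta> y \<le> eps / dist x y * (lam * f T)" .
        have i: "indicator (cball x eps) y = (1 :: real)" "indicator (- cball x (R * eps)) y = (0 :: real)"
          using 1 eR by auto
        show ?thesis using b d unfolding ln1 i by (simp add: powr_minus_divide algebra_simps)
      next
        case 2
        have "ln (eps / dist x y) \<le> 0" using 2 d eps_pos by simp
        then have "ln (eps / dist x y) * \<zeta> y \<le> 0" using z by (intro mult_nonpos_nonneg)
        then show ?thesis using 2 unfolding ln1 by (simp add: distrib_right)
      next
        case 3
        have "eps / dist x y \<le> 1 / R" using 3 R d eps_pos by (simp add: field_simps)
        then have "ln (eps / dist x y) \<le> ln (1 / R)" using d eps_pos R by (subst ln_le_cancel_iff) auto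
        then have "ln (eps / dist x y) \<le> - ln R" using R by (simp add: ln_div)
        then have "ln (eps / dist x y) * \<zeta> y \<le> - ln R * \<zeta> y" using z by (intro mult_right_mono)
        then show ?thesis using 3 eR unfolding ln1 by (simp add: distrib_right)
      qed
    qed
  qed
  also have "integral\<^sup>L lborel ?b = \<kappa> * ln (1 / eps) + lam * f T * eps * integral\<^sup>L lborel ?s - ln R * (\<integral>y. \<zeta> y * indicator (- cball x (R * eps)) y \<partial>lborel)"
    using integral_linear_combination[OF K_D(7)[OF \<zeta>] isg ib, of "ln (1 / eps)" "lam * f T * eps" "ln R"] K_D(5)[OF \<zeta>]
    by (simp only: mult.commute[of \<kappa>])
  also have "lam * f T * eps * integral\<^sup>L lborel ?s \<le> lam * f T * eps * (16 * eps)"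
    using integral_dist_powr_cball_le[of 1 eps x] eps_pos fT_nonneg by (intro mult_left_mono) auto
  also have "lam * f T * eps * (16 * eps) = 16 * f T" using lam_eps'[of "16 * f T"] by (simp add: mult_ac)
  finally show ?thesis by simp
qed

lemma dist_reflect_bounds:
  assumes "x \<in> Dom r" "y \<in> Dom r"
  shows "r \<le> dist (reflect x) y" "dist (reflect x) y \<le> 6 * r"
proof -
  have "dist (fst (reflect x)) (fst y) \<le> dist (reflect x) y" by (rule dist_fst_le)
  moreover have "r \<le> dist (fst (reflect x)) (fst y)" using assms r by (auto simp: Dom_def dist_real_def)
  ultimately show "r \<le> dist (reflect x) y" by linarith
  have "dist (reflect x) y \<le> norm (reflect x) + norm y" by (metis dist_norm norm_triangle_ineq4)
  then show "dist (reflect x) y \<le> 6 * r" using Dom_norm[OF assms(1)] Dom_norm[OF assms(2)] by simp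
qed

lemma green_K_le:
  assumes \<zeta>: "\<zeta> \<in> K" and x: "x \<in> Dom r" and R: "R \<ge> 1"
  shows "2 * pi * green \<zeta> x \<le> \<kappa> * ln (1 / eps) + 16 * f T - ln R * (\<integral>y. \<zeta> y * indicator (- cball x (R * eps)) y \<partial>lborel) + \<kappa> * ln (6 * r)"
proof -
  note d = K_dens[OF \<zeta>]
  have "- (\<integral>y. ln (1 / dist (reflect x) y) * \<zeta> y \<partial>lborel) = (\<integral>y. - (ln (1 / dist (reflect x) y) * \<zeta> y) \<partial>lborel)" by simp
  also have "\<dots> \<le> (\<integral>y. ln (6 * r) * \<zeta> y \<partial>lborel)"
  proof (rule integral_mono)
    fix y
    show "- (ln (1 / dist (reflect x) y) * \<zeta> y) \<le> ln (6 * r) * \<zeta> y"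
    proof (cases "y \<in> Dom r")
      case True
      have "0 < dist (reflect x) y" using dist_reflect_bounds(1)[OF x True] r by linarith
      then have "- ln (1 / dist (reflect x) y) \<le> ln (6 * r)"
        using dist_reflect_bounds(2)[OF x True] ln_le_cancel_iff[of "dist (reflect x) y" "6 * r"] r by (simp add: ln_div)
      then show ?thesis using K_D(2)[OF \<zeta>, of y] by (metis minus_mult_left mult_right_mono)
    qed (simp add: K_D(4)[OF \<zeta>])
  qed (use dens_integrable_log[OF d] K_D(7)[OF \<zeta>] in auto)
  also have "\<dots> = \<kappa> * ln (6 * r)" using K_D(5)[OF \<zeta>] by simp
  finally have 1: "- (\<integral>y. ln (1 / dist (reflect x) y) * \<zeta> y \<partial>lborel) \<le> \<kappa> * ln (6 * r)" .
  have "2 * pi * green \<zeta> x = (\<integral>y. ln (1 / dist x y) * \<zeta> y \<partial>lborel) - (\<integral>y. ln (1 / dist (reflect x) y) * \<zeta> y \<partial>lborel)"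
    by (simp add: green_def inv_neg_laplacian_def field_simps)
  then show ?thesis using 1 log_integral_le[OF \<zeta> R, of x] by linarith
qed

end

section \<open>A square patch as competitor\<close>

locale vortex_patch = vortex f T r \<kappa> W lam for f T r \<kappa> W lam +
  assumes f1: "f 1 > 0" and small: "6 * sqrt (\<kappa> / (4 * f 1)) * (1 / sqrt lam) \<le> r"
begin

text \<open>Half the side, in units of \<open>eps\<close>, of the square that carries mass \<kappa>
  at density lam f 1. The hypothesis \<open>small\<close> leaves room in the rectangle for this
  square and for neighbourhoods three times as wide.\<close>

definition a where "a = sqrt (\<kappa> / (4 * f 1))"

lemma a_pos: "a > 0" and a_sq: "4 * f 1 * a\<^sup>2 = \<kappa>" and a_small: "6 * a * eps \<le> r"
  using f1 \<kappa> small by (auto simp: a_def eps_def)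

definition Q :: "plane set" where "Q = cbox (r - a * eps, - a * eps) (r + a * eps, a * eps)"

text \<open>The height uses f 1 so that \<open>\<Phi>_le\<close> bounds the penalty by \<kappa>,
  uniformly in \<open>lam\<close>.\<close>

definition \<zeta>0 :: "plane \<Rightarrow> real" where "\<zeta>0 x = lam * f 1 * indicator Q x"

lemma integral_square:
  fixes c l p q :: real
  assumes "l \<ge> 0" shows "(\<integral>x. c * indicator (cbox (p, q) (p + l, q + l)) x \<partial>lborel) = c * l\<^sup>2"
proof -
  have "measure lborel (cbox (p, q) (p + l, q + l)) = (\<Prod>b\<in>Basis. (p + l, q + l) \<bullet> b - (p, q) \<bullet> b)"
    by (rule content_cbox) (use assms in \<open>auto simp: Basis_prod_def inner_prod_def\<close>)
  also have "\<dots> = l\<^sup>2" by (simp add: Basis_prod_def power2_eq_square)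
  finally show ?thesis by simp
qed

lemma \<zeta>0_mass: "(\<integral>x. c * indicator Q x \<partial>lborel) = c * (4 * a\<^sup>2 * eps\<^sup>2)"
proof -
  have "Q = cbox (r - a * eps, - a * eps) (r - a * eps + 2 * a * eps, - a * eps + 2 * a * eps)"
    unfolding Q_def by (intro arg_cong2[where f = cbox] refl) simp
  then show ?thesis using integral_square[of "2 * a * eps" c "r - a * eps" "- a * eps"] a_pos eps_pos
    by (simp add: power_mult_distrib)
qed

lemma Q_iff: "x \<in> Q \<longleftrightarrow> \<bar>fst x - r\<bar> \<le> a * eps \<and> \<bar>snd x\<bar> \<le> a * eps"
  by (auto simp: Q_def cbox_def Basis_prod_def abs_le_iff inner_prod_def)

lemma ae_pos: "0 < a * eps" using a_pos eps_pos by simp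

lemma Q_Dom: "x \<in> Q \<Longrightarrow> x \<in> Dom r"
  using a_small ae_pos r by (auto simp: Q_iff Dom_def abs_le_iff)

lemma mass_eq: "lam * f 1 * (4 * a\<^sup>2 * eps\<^sup>2) = \<kappa>"
proof -
  have "lam * f 1 * (4 * a\<^sup>2 * eps\<^sup>2) = lam * (eps * (eps * (4 * f 1 * a\<^sup>2)))" by (simp add: power2_eq_square mult_ac)
  also have "\<dots> = \<kappa>" unfolding lam_eps' by (rule a_sq)
  finally show ?thesis .
qed

lemma \<zeta>0_K: "\<zeta>0 \<in> K"
  unfolding K_def
proof (intro CollectI conjI allI impI)
  have [measurable]: "Q \<in> sets borel" by (simp add: Q_def)
  show "\<zeta>0 \<in> borel_measurable borel" unfolding \<zeta>0_def by measurable
  show "integral\<^sup>L lborel \<zeta>0 = \<kappa>" unfolding \<zeta>0_def \<zeta>0_mass mass_eq ..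
  show "steiner_sym \<zeta>0" using lam f1 by (auto simp: steiner_sym_def \<zeta>0_def Q_iff indicator_def)
  show "\<zeta>0 x \<le> lam * f T" for x using lam f_le_T[of 1] f_nonneg[of T] by (auto simp: \<zeta>0_def indicator_def)
  show "\<zeta>0 x = 0" if "x \<notin> Dom r" for x using that Q_Dom[of x] by (auto simp: \<zeta>0_def indicator_def)
qed (use lam f1 in \<open>auto simp: \<zeta>0_def\<close>)

text \<open>Within the square distances are at most 3 a eps and image distances at least r, so the
  kernel is at least ln (r / (3 a eps)) there. The cost stays bounded as \<open>lam\<close> grows,
  so the logarithm is the leading term.\<close>

lemma En_\<zeta>0: "\<kappa>\<^sup>2 / (4 * pi) * (ln (1 / eps) + ln (r / (3 * a))) - 3 / 2 * r * W * \<kappa> - \<kappa> \<le> En \<zeta>0"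
proof -
  note z = \<zeta>0_K
  note d = K_dens[OF z]
  have g: "\<kappa> / (2 * pi) * (ln (1 / eps) + ln (r / (3 * a))) \<le> green \<zeta>0 x" if x: "x \<in> Q" for x
  proof -
    have "(\<integral>y. (ln (1 / eps) + ln (r / (3 * a))) * \<zeta>0 y \<partial>lborel) \<le> (\<integral>y. green_kernel x y * \<zeta>0 y \<partial>lborel)"
    proof (rule integral_mono_AE[OF _ dens_integrable_green_kernel[OF d]])
      show "integrable lborel (\<lambda>y. (ln (1 / eps) + ln (r / (3 * a))) * \<zeta>0 y)" using K_D(7)[OF z] by simp
      show "AE y in lborel. (ln (1 / eps) + ln (r / (3 * a))) * \<zeta>0 y \<le> green_kernel x y * \<zeta>0 y"
        using AE_lborel_singleton[of x]
      proof eventually_elim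
        fix y assume y: "y \<noteq> x"
        show "(ln (1 / eps) + ln (r / (3 * a))) * \<zeta>0 y \<le> green_kernel x y * \<zeta>0 y"
        proof (cases "y \<in> Q")
          case True
          note D = Q_Dom[OF x] Q_Dom[OF True]
          have "0 < dist x y" using y by simp
          \<comment> \<open>The diagonal of the square is 2 sqrt 2 times a eps, rounded up to 3 a
            eps.\<close>
          have dd: "(dist x y)\<^sup>2 \<le> (3 * (a * eps))\<^sup>2"
          proof -
            have "\<bar>fst x - fst y\<bar> \<le> \<bar>2 * (a * eps)\<bar>" "\<bar>snd x - snd y\<bar> \<le> \<bar>2 * (a * eps)\<bar>"
              using x True ae_pos by (auto simp: Q_iff abs_le_iff)
            from this[THEN abs_le_square_iff[THEN iffD1]]
            have "(dist x y)\<^sup>2 \<le> (2 * (a * eps))\<^sup>2 + (2 * (a * eps))\<^sup>2" unfolding dist_plane_squared(1) by linarith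
            also have "\<dots> \<le> (3 * (a * eps))\<^sup>2" by (simp add: power_mult_distrib)
            finally show ?thesis .
          qed
          then have d3: "dist x y \<le> 3 * a * eps" using power2_le_imp_le[OF dd] ae_pos by (simp add: mult.assoc)
          have n: "y \<noteq> reflect x" using D r by (auto simp: Dom_def)
          have "ln (1 / eps) + ln (r / (3 * a)) = ln (r / (3 * a * eps))" using a_pos eps_pos r
            by (simp add: ln_div ln_mult)
          also have "\<dots> \<le> ln (dist (reflect x) y / dist x y)"
          proof (subst ln_le_cancel_iff)
            show "r / (3 * a * eps) \<le> dist (reflect x) y / dist x y"
              using dist_reflect_bounds(1)[OF D] d3 \<open>0 < dist x y\<close> r by (intro frac_le) auto
            show "0 < r / (3 * a * eps)" using r a_pos eps_pos by simp
            show "0 < dist (reflect x) y / dist x y" using dist_reflect_bounds(1)[OF D] r \<open>0 < dist x y\<close> by (intro divide_pos_pos) auto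
          qed
          also have "\<dots> = green_kernel x y" by (rule green_kernel_eq(1)[OF y n, symmetric])
          finally show ?thesis using K_D(2)[OF z, of y] by (intro mult_right_mono)
        qed (simp add: \<zeta>0_def)
      qed
    qed
    then have "1 / (2 * pi) * (\<integral>y. (ln (1 / eps) + ln (r / (3 * a))) * \<zeta>0 y \<partial>lborel) \<le> green \<zeta>0 x"
      unfolding green_eq_integral[OF d] by (intro mult_left_mono) auto
    then show ?thesis using K_D(5)[OF z] by (simp add: mult_ac)
  qed
  have "(\<integral>x. \<zeta>0 x * (\<kappa> / (2 * pi) * (ln (1 / eps) + ln (r / (3 * a)))) \<partial>lborel) \<le> energy_form \<zeta>0 \<zeta>0"
    unfolding energy_form_def
  proof (rule integral_mono[OF _ integrable_K_green[OF z z]])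
    show "\<zeta>0 x * (\<kappa> / (2 * pi) * (ln (1 / eps) + ln (r / (3 * a)))) \<le> \<zeta>0 x * green \<zeta>0 x" for x
      using mult_left_mono[OF g[of x] K_D(2)[OF z, of x]] by (cases "x \<in> Q") (simp_all add: \<zeta>0_def)
  qed (use K_D(7)[OF z] in simp)
  then have 1: "\<kappa> * (\<kappa> / (2 * pi) * (ln (1 / eps) + ln (r / (3 * a)))) \<le> energy_form \<zeta>0 \<zeta>0" using K_D(5)[OF z] by simp
  have "(\<integral>x. fst x * \<zeta>0 x \<partial>lborel) \<le> (\<integral>x. 3 / 2 * r * \<zeta>0 x \<partial>lborel)"
  proof (rule integral_mono[OF integrable_K_fst[OF z]])
    show "fst x * \<zeta>0 x \<le> 3 / 2 * r * \<zeta>0 x" for x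
      using K_D(2,4)[OF z, of x] mult_right_mono[of "fst x" "3 / 2 * r" "\<zeta>0 x"]
      by (cases "x \<in> Dom r") (auto simp: Dom_def)
  qed (use K_D(7)[OF z] in simp)
  then have "W * (\<integral>x. fst x * \<zeta>0 x \<partial>lborel) \<le> W * (3 / 2 * r * \<kappa>)" using K_D(5)[OF z] W by (intro mult_left_mono) auto
  moreover have "lam * (\<integral>x. \<Phi> (\<zeta>0 x / lam) \<partial>lborel) \<le> \<kappa>"
  proof -
    have "(\<integral>x. \<Phi> (\<zeta>0 x / lam) \<partial>lborel) \<le> (\<integral>x. \<zeta>0 x / lam \<partial>lborel)"
    proof (rule integral_mono[OF integrable_K_\<Phi>[OF z]])
      show "\<Phi> (\<zeta>0 x / lam) \<le> \<zeta>0 x / lam" for x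
        using lam f1 \<Phi>_le[of "f 1"] by (cases "x \<in> Q") (auto simp: \<zeta>0_def \<Phi>_zero)
    qed (use K_D(7)[OF z] in simp)
    also have "\<dots> = \<kappa> / lam" using K_D(5)[OF z] by simp
    finally show ?thesis using lam by (simp add: pos_le_divide_eq mult.commute)
  qed
  ultimately have 2: "cost \<zeta>0 \<le> 3 / 2 * r * W * \<kappa> + \<kappa>" unfolding cost_def by (simp add: mult_ac)
  have e: "\<kappa>\<^sup>2 / (4 * pi) * (ln (1 / eps) + ln (r / (3 * a))) = \<kappa> * (\<kappa> / (2 * pi) * (ln (1 / eps) + ln (r / (3 * a)))) / 2"
    by (simp add: power2_eq_square)
  show ?thesis unfolding En_def e using 1 2 by argo
qed

end

text \<open>\<open>T_large\<close> collects the value 1 at a nearby low point and the largest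
  possible change of potential and linear term on the way there; its left side must not exceed T for
  the truncation to stay inactive.\<close>

locale vortex_steady = vortex_patch +
  fixes \<zeta> :: "plane \<Rightarrow> real" and \<mu> :: real
  assumes \<zeta>K: "\<zeta> \<in> K" and steady: "\<zeta> = bathtub (green \<zeta>) \<mu>" and maximal: "\<And>\<eta>. \<eta> \<in> K \<Longrightarrow> En \<eta> \<le> En \<zeta>"
    and T_large: "1 + 6 * a * (16 * f T + \<kappa>) + 2 * \<kappa> + 2 * r * W \<le> T"
begin

lemmas \<zeta>_meas = K_D(1)[OF \<zeta>K] and \<zeta>_nonneg = K_D(2)[OF \<zeta>K] and \<zeta>_le = K_D(3)[OF \<zeta>K]
  and \<zeta>_Dom = K_D(4)[OF \<zeta>K] and \<zeta>_mass = K_D(5)[OF \<zeta>K] and \<zeta>_steiner = K_D(6)[OF \<zeta>K] and \<zeta>_int = K_D(7)[OF \<zeta>K]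

lemma \<zeta>_eq: "x \<in> Dom r \<Longrightarrow> \<zeta> x = lam * f (green \<zeta> x - W * fst x - \<mu>)"
  by (subst steady) (simp add: bathtub_def)

text \<open>Every square of side \<open>3 a eps\<close> contains a point where the relative stream function is below \<open>1\<close>,
  since otherwise the square alone would carry more than the total mass.\<close>

lemma ex_low_point:
  assumes x: "x \<in> Dom r"
  obtains x' where "x' \<in> Dom r" "dist x x' \<le> 6 * a * eps" "green \<zeta> x' - W * fst x' - \<mu> < 1"
proof -
  define l where "l = 3 * a * eps"
  \<comment> \<open>The square is attached to \<open>x\<close> on the side facing the centre of the
    rectangle, so that it stays inside because 2 l \<le> r.\<close>
  define p where "p = (if fst x \<le> r then fst x else fst x - l)"
  define q where "q = (if snd x \<le> 0 then snd x else snd x - l)"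
  let ?S = "cbox (p, q) (p + l, q + l)"
  have l: "0 < l" "2 * l \<le> r" using a_pos eps_pos a_small by (auto simp: l_def)
  have SD: "y \<in> Dom r \<and> dist x y \<le> 6 * a * eps" if "y \<in> ?S" for y
  proof -
    have y: "p \<le> fst y" "fst y \<le> p + l" "q \<le> snd y" "snd y \<le> q + l"
      using that by (auto simp: cbox_def Basis_prod_def inner_prod_def)
    have "y \<in> Dom r" using y x l r by (auto simp: Dom_def p_def q_def abs_le_iff split: if_splits)
    moreover have "\<bar>fst x - fst y\<bar> \<le> l" "\<bar>snd x - snd y\<bar> \<le> l"
      using y by (auto simp: p_def q_def abs_le_iff split: if_splits)
    moreover have "dist x y \<le> \<bar>fst x - fst y\<bar> + \<bar>snd x - snd y\<bar>"
      using norm_Pair_le[of "fst x - fst y" "snd x - snd y"] by (simp add: dist_norm minus_prod_def)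
    ultimately show ?thesis by (simp add: l_def)
  qed
  have "\<exists>y\<in>?S. green \<zeta> y - W * fst y - \<mu> < 1"
  proof (rule ccontr)
    assume "\<not> ?thesis"
    then have ge: "lam * f 1 * indicator ?S y \<le> \<zeta> y" for y
      using SD[of y] \<zeta>_nonneg[of y] lam by (auto simp: indicator_def \<zeta>_eq not_less intro!: mult_left_mono monoD[OF mono_f])
    have "lam * f 1 * l\<^sup>2 = (\<integral>y. lam * f 1 * indicator ?S y \<partial>lborel)"
      using l by (intro integral_square[symmetric]) simp
    also have "\<dots> \<le> (\<integral>y. \<zeta> y \<partial>lborel)"
    proof (rule integral_mono[OF _ \<zeta>_int ge])
      show "integrable lborel (\<lambda>y. lam * f 1 * indicator ?S y)"
        using emeasure_bounded_finite[OF bounded_cbox[of "(p, q)" "(p + l, q + l)"]]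
        by (intro integrable_mult_right integrable_real_indicator) auto
    qed
    also have "\<dots> = \<kappa>" by (rule \<zeta>_mass)
    also have "lam * f 1 * l\<^sup>2 = 9 / 4 * (lam * f 1 * (4 * a\<^sup>2 * eps\<^sup>2))" by (simp add: l_def power_mult_distrib)
    also have "\<dots> = 9 / 4 * \<kappa>" unfolding mass_eq ..
    finally show False using \<kappa> by simp
  qed
  then show ?thesis using SD that by blast
qed

text \<open>A shift by h = 6 a eps changes the logarithm of the distance to y by at most h / dist x
  y. Splitting at distance \<open>eps\<close> gives 16 f T h / eps from the singularity and \<kappa>
  h / eps from the rest; the image term costs at most \<kappa>. All of this is independent of
  \<open>lam\<close>.\<close>

lemma green_oscillation:
  assumes x: "x \<in> Dom r" and x': "x' \<in> Dom r" and d: "dist x x' \<le> 6 * a * eps"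
  shows "2 * pi * (green \<zeta> x - green \<zeta> x') \<le> 6 * a * (16 * f T + \<kappa>) + 2 * \<kappa>"
proof -
  define h where "h = 6 * a * eps"
  have h: "0 < h" "h \<le> r" using a_pos eps_pos a_small by (auto simp: h_def)
  note dn = K_dens[OF \<zeta>K]
  let ?s = "\<lambda>y. dist x y powr - 1 * indicator (cball x eps) y :: real"
  let ?b = "\<lambda>y. lam * f T * h * ?s y + h / eps * \<zeta> y - (- 1) * \<zeta> y"
  have isg: "integrable lborel ?s" by (rule integrable_dist_powr_cball) (use eps_pos in auto)
  have ib: "integrable lborel ?b"
    by (intro Bochner_Integration.integrable_diff Bochner_Integration.integrable_add integrable_mult_right isg \<zeta>_int)
  have "(\<integral>y. green_kernel x y * \<zeta> y - green_kernel x' y * \<zeta> y \<partial>lborel) \<le> integral\<^sup>L lborel ?b"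
  proof (rule integral_mono_AE[OF _ ib])
    show "integrable lborel (\<lambda>y. green_kernel x y * \<zeta> y - green_kernel x' y * \<zeta> y)"
      by (intro Bochner_Integration.integrable_diff dens_integrable_green_kernel[OF dn])
    show "AE y in lborel. green_kernel x y * \<zeta> y - green_kernel x' y * \<zeta> y \<le> ?b y"
      using AE_lborel_singleton[of x] AE_lborel_singleton[of x']
    proof eventually_elim
      fix y assume y: "y \<noteq> x" "y \<noteq> x'"
      have b0: "0 \<le> lam * f T * h * ?s y"
        by (intro mult_nonneg_nonneg) (use lam f_nonneg[of T] h in auto)
      show "green_kernel x y * \<zeta> y - green_kernel x' y * \<zeta> y \<le> ?b y"
      proof (cases "y \<in> Dom r")
        case True
        have p: "dist x y > 0" "dist x' y > 0" using y by auto
        have D: "dist (reflect x) y > 0" "dist (reflect x') y \<ge> r"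
          using dist_reflect_bounds[OF x True] dist_reflect_bounds[OF x' True] r by auto
        have e: "green_kernel x y - green_kernel x' y = ln (dist x' y / dist x y) + ln (dist (reflect x) y / dist (reflect x') y)"
        proof -
          have "dist (reflect x') y > 0" using D r by linarith
          then show ?thesis using p D(1) by (simp add: green_kernel_def ln_div)
        qed
        have "dist x' y \<le> dist x y + h" using d dist_triangle[of x' y x] by (simp add: h_def dist_commute)
        then have "dist x' y / dist x y \<le> 1 + h / dist x y" using p by (simp add: field_simps)
        then have "ln (dist x' y / dist x y) \<le> h / dist x y"
          using ln_le_minus_one[of "dist x' y / dist x y"] p by simp
        \<comment> \<open>The image distance is at least r \<ge> h, so the shift at most doubles
          it.\<close>
        moreover have "ln (dist (reflect x) y / dist (reflect x') y) \<le> 1"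
        proof -
          have D': "dist (reflect x') y > 0" using D r by linarith
          have "dist (reflect x) y \<le> dist (reflect x') y + dist (reflect x) (reflect x')"
            using dist_triangle[of "reflect x" y "reflect x'"] by simp
          also have "dist (reflect x) (reflect x') \<le> h" using d by (simp add: dist_reflect h_def)
          finally have "dist (reflect x) y \<le> dist (reflect x') y + dist (reflect x') y" using h D by linarith
          then have "dist (reflect x) y / dist (reflect x') y \<le> 2" using D' by (simp add: divide_le_eq)
          then show ?thesis using ln_le_minus_one[of "dist (reflect x) y / dist (reflect x') y"] D(1) D' by simp
        qed
        ultimately have k: "green_kernel x y - green_kernel x' y \<le> h / dist x y + 1" unfolding e by simp
        have "h / dist x y * \<zeta> y \<le> lam * f T * h * ?s y + h / eps * \<zeta> y"
        proof (cases "dist x y \<le> eps")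
          case True
          have "h / dist x y * \<zeta> y \<le> h / dist x y * (lam * f T)" using h p \<zeta>_le by (intro mult_left_mono) auto
          moreover have "0 \<le> h / eps * \<zeta> y" using h eps_pos \<zeta>_nonneg by simp
          ultimately show ?thesis using True p by (simp add: powr_minus_divide mult_ac)
        next
          case False
          have "h / dist x y \<le> h / eps" using False h eps_pos p by (intro divide_left_mono) auto
          then have "h / dist x y * \<zeta> y \<le> h / eps * \<zeta> y" by (rule mult_right_mono[OF _ \<zeta>_nonneg])
          then show ?thesis using False by simp
        qed
        moreover have "(green_kernel x y - green_kernel x' y) * \<zeta> y \<le> (h / dist x y + 1) * \<zeta> y"
          using k \<zeta>_nonneg by (intro mult_right_mono)
        ultimately show ?thesis unfolding left_diff_distrib distrib_right by linarith
      qed (use b0 in \<open>simp add: \<zeta>_Dom\<close>)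
    qed
  qed
  also have "integral\<^sup>L lborel ?b = lam * f T * h * integral\<^sup>L lborel ?s + h / eps * \<kappa> + \<kappa>"
    using integral_linear_combination[OF isg \<zeta>_int \<zeta>_int, of "lam * f T * h" "h / eps" "- 1"] \<zeta>_mass by simp
  also have "lam * f T * h * integral\<^sup>L lborel ?s \<le> lam * f T * h * (16 * eps)"
    using integral_dist_powr_cball_le[of 1 eps x] eps_pos fT_nonneg h by (intro mult_left_mono) auto
  also have "lam * f T * h * (16 * eps) = 96 * a * f T" using lam_eps'[of "96 * a * f T"] by (simp add: h_def mult_ac)
  also have "h / eps = 6 * a" using eps_pos by (simp add: h_def)
  finally have "(\<integral>y. green_kernel x y * \<zeta> y - green_kernel x' y * \<zeta> y \<partial>lborel) \<le> 96 * a * f T + 6 * a * \<kappa> + \<kappa>" by simp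
  moreover have "2 * pi * (green \<zeta> x - green \<zeta> x') = (\<integral>y. green_kernel x y * \<zeta> y - green_kernel x' y * \<zeta> y \<partial>lborel)"
    unfolding green_eq_integral[OF dn] using dens_integrable_green_kernel[OF dn] by (simp add: field_simps)
  ultimately show ?thesis using \<kappa> by (simp add: algebra_simps)
qed

text \<open>Compare with the low point at distance at most 6 a eps; \<open>T_large\<close> was
  chosen for exactly this sum.\<close>

lemma stream_le_T:
  assumes x: "x \<in> Dom r" shows "green \<zeta> x - W * fst x - \<mu> \<le> T"
proof -
  obtain x' where x': "x' \<in> Dom r" "dist x x' \<le> 6 * a * eps" "green \<zeta> x' - W * fst x' - \<mu> < 1"
    using ex_low_point[OF x] by blast
  let ?C = "6 * a * (16 * f T + \<kappa>) + 2 * \<kappa>"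
  have C0: "0 \<le> ?C" using a_pos f_nonneg[of T] \<kappa> by simp
  have "green \<zeta> x - green \<zeta> x' \<le> ?C"
  proof (cases "green \<zeta> x - green \<zeta> x' \<le> 0")
    case False
    then have "1 * (green \<zeta> x - green \<zeta> x') \<le> 2 * pi * (green \<zeta> x - green \<zeta> x')"
      using pi_ge_two by (intro mult_right_mono) auto
    also have "\<dots> \<le> ?C" by (rule green_oscillation[OF x x'(1,2)])
    finally show ?thesis by simp
  qed (use C0 in linarith)
  moreover have "W * fst x' - W * fst x \<le> 2 * r * W"
  proof -
    have "fst x' - fst x \<le> 2 * r" using x x'(1) r by (auto simp: Dom_def)
    then have "W * (fst x' - fst x) \<le> W * (2 * r)" using W by (intro mult_left_mono) auto
    then show ?thesis by (simp add: algebra_simps)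
  qed
  ultimately show ?thesis using x'(3) T_large by linarith
qed

definition multiplier_const where
  "multiplier_const = \<bar>\<kappa> / (2 * pi) * ln (r / (3 * a))\<bar> + 3 * r * W + 2 + T"

text \<open>Integrating \<open>stream_le_T\<close> against \<zeta> bounds the energy form, less the
  linear term, by (\<mu> + T) \<kappa>. The same quantity is at least 2 En \<zeta>, hence at least
  twice the energy of the patch, whose logarithmic term then bounds \<mu>.\<close>

lemma \<mu>_lower: "\<kappa> / (2 * pi) * ln (1 / eps) - multiplier_const \<le> \<mu>"
proof -
  note i = integrable_K_green[OF \<zeta>K \<zeta>K] integrable_K_fst[OF \<zeta>K] \<zeta>_int
  have "(\<integral>x. \<zeta> x * green \<zeta> x - W * (fst x * \<zeta> x) - \<mu> * \<zeta> x \<partial>lborel) \<le> (\<integral>x. T * \<zeta> x \<partial>lborel)"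
  proof (rule integral_mono)
    show "\<zeta> x * green \<zeta> x - W * (fst x * \<zeta> x) - \<mu> * \<zeta> x \<le> T * \<zeta> x" for x
    proof (cases "x \<in> Dom r")
      case True
      have "(green \<zeta> x - W * fst x - \<mu>) * \<zeta> x \<le> T * \<zeta> x" by (rule mult_right_mono[OF stream_le_T[OF True] \<zeta>_nonneg])
      then show ?thesis by (simp add: algebra_simps)
    qed (simp add: \<zeta>_Dom)
  qed (use i in auto)
  also have "\<dots> = T * \<kappa>" by (simp add: \<zeta>_mass)
  also have "(\<integral>x. \<zeta> x * green \<zeta> x - W * (fst x * \<zeta> x) - \<mu> * \<zeta> x \<partial>lborel)
      = energy_form \<zeta> \<zeta> - W * (\<integral>x. fst x * \<zeta> x \<partial>lborel) - \<mu> * \<kappa>"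
    using i by (simp add: energy_form_def \<zeta>_mass)
  finally have 1: "energy_form \<zeta> \<zeta> - W * (\<integral>x. fst x * \<zeta> x \<partial>lborel) - \<mu> * \<kappa> \<le> T * \<kappa>" .
  have x0: "0 \<le> (\<integral>x. fst x * \<zeta> x \<partial>lborel)"
  proof (rule Bochner_Integration.integral_nonneg)
    show "0 \<le> fst x * \<zeta> x" for x using \<zeta>_Dom[of x] \<zeta>_nonneg[of x] r by (cases "x \<in> Dom r") (auto simp: Dom_def)
  qed
  have P0: "0 \<le> lam * (\<integral>x. \<Phi> (\<zeta> x / lam) \<partial>lborel)"
    using lam by (intro mult_nonneg_nonneg Bochner_Integration.integral_nonneg \<Phi>_nonneg) auto
  have "2 * En \<zeta> + W * (\<integral>x. fst x * \<zeta> x \<partial>lborel) \<le> energy_form \<zeta> \<zeta>"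
    using x0 P0 W mult_nonneg_nonneg[of W "\<integral>x. fst x * \<zeta> x \<partial>lborel"] unfolding En_def cost_def by (simp add: field_simps)
  with 1 have "2 * En \<zeta> - T * \<kappa> \<le> \<mu> * \<kappa>" by linarith
  then have 2: "2 * (\<kappa>\<^sup>2 / (4 * pi) * (ln (1 / eps) + ln (r / (3 * a))) - 3 / 2 * r * W * \<kappa> - \<kappa>) - T * \<kappa> \<le> \<mu> * \<kappa>"
    by (intro order_trans[OF diff_right_mono[OF mult_left_mono[OF order_trans[OF En_\<zeta>0 maximal[OF \<zeta>0_K]]]]]) auto
  have "(\<kappa> / (2 * pi) * ln (1 / eps) + \<kappa> / (2 * pi) * ln (r / (3 * a)) - 3 * r * W - 2 - T) * \<kappa>
      = 2 * (\<kappa>\<^sup>2 / (4 * pi) * (ln (1 / eps) + ln (r / (3 * a))) - 3 / 2 * r * W * \<kappa> - \<kappa>) - T * \<kappa>"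
    by (simp add: power2_eq_square field_simps)
  with 2 have "(\<kappa> / (2 * pi) * ln (1 / eps) + \<kappa> / (2 * pi) * ln (r / (3 * a)) - 3 * r * W - 2 - T) * \<kappa> \<le> \<mu> * \<kappa>" by linarith
  then have "\<kappa> / (2 * pi) * ln (1 / eps) + \<kappa> / (2 * pi) * ln (r / (3 * a)) - 3 * r * W - 2 - T \<le> \<mu>"
    using \<kappa> by (simp only: mult_le_cancel_right_pos)
  then show ?thesis unfolding multiplier_const_def by linarith
qed

definition concentration_const where "concentration_const = 2 * pi * multiplier_const + \<bar>\<kappa> * ln (6 * r)\<bar> + 16 * f T + 1"

text \<open>Chosen so that its logarithm is 4 \<open>concentration_const\<close> / \<kappa>, which
  leaves at most a quarter of the mass outside the disc. It does not involve
  \<open>lam\<close>.\<close>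

definition conc_radius where "conc_radius = exp (4 * concentration_const / \<kappa>)"

lemma C4_pos: "concentration_const \<ge> 1"
proof -
  have "0 \<le> multiplier_const" unfolding multiplier_const_def using r W T_ge_1 by simp
  then show ?thesis using f_nonneg[of T] unfolding concentration_const_def by simp
qed

lemma Rad_ge_1: "conc_radius > 1"
  using C4_pos \<kappa> by (simp add: conc_radius_def)

lemma support_stream: "\<zeta> x > 0 \<Longrightarrow> x \<in> Dom r \<and> green \<zeta> x - W * fst x - \<mu> > 0"
proof -
  assume z: "\<zeta> x > 0"
  then have D: "x \<in> Dom r" using \<zeta>_Dom[of x] by force
  then have "f (green \<zeta> x - W * fst x - \<mu>) \<noteq> 0" using z \<zeta>_eq[OF D] by force
  then show ?thesis using D f_nonpos[of "green \<zeta> x - W * fst x - \<mu>"] by force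
qed

lemma support_green: "\<zeta> x > 0 \<Longrightarrow> \<mu> \<le> green \<zeta> x"
proof -
  assume z: "\<zeta> x > 0"
  have "0 \<le> W * fst x" using support_stream[OF z] W r by (auto simp: Dom_def)
  then show ?thesis using support_stream[OF z] by linarith
qed

text \<open>At a point of the support the potential is at least \<mu>. The terms \<kappa> ln (1 /
  eps) in the lower bound of \<mu> and in \<open>green_K_le\<close> cancel, so ln
  \<open>conc_radius\<close> times the far mass is bounded by a constant.\<close>

lemma mass_far:
  assumes z: "\<zeta> x > 0"
  shows "(\<integral>y. \<zeta> y * indicator (- cball x (conc_radius * eps)) y \<partial>lborel) \<le> \<kappa> / 4"
proof -
  let ?m = "\<integral>y. \<zeta> y * indicator (- cball x (conc_radius * eps)) y \<partial>lborel"
  have "2 * pi * (\<kappa> / (2 * pi) * ln (1 / eps) - multiplier_const) \<le> 2 * pi * green \<zeta> x"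
    using \<mu>_lower support_green[OF z] by (intro mult_left_mono) auto
  also have "\<dots> \<le> \<kappa> * ln (1 / eps) + 16 * f T - ln conc_radius * ?m + \<kappa> * ln (6 * r)"
    using support_stream[OF z] Rad_ge_1 by (intro green_K_le[OF \<zeta>K]) auto
  also have "2 * pi * (\<kappa> / (2 * pi) * ln (1 / eps) - multiplier_const) = \<kappa> * ln (1 / eps) - 2 * pi * multiplier_const" by (simp add: field_simps)
  finally have "ln conc_radius * ?m \<le> concentration_const" unfolding concentration_const_def by linarith
  then have "4 * concentration_const / \<kappa> * ?m \<le> concentration_const" by (simp add: conc_radius_def)
  then have "concentration_const * (4 * ?m) \<le> concentration_const * \<kappa>" using \<kappa> by (simp add: field_simps)
  then show ?thesis using C4_pos by simp
qed

text \<open>If the two discs were disjoint, every point would lie outside one of them, and two far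
  masses of at most \<kappa> / 4 would have to add up to \<kappa>.\<close>

lemma support_diam:
  assumes "\<zeta> x > 0" "\<zeta> x' > 0" shows "dist x x' \<le> 2 * conc_radius * eps"
proof (rule ccontr)
  assume far: "\<not> ?thesis"
  have "\<zeta> y \<le> \<zeta> y * indicator (- cball x (conc_radius * eps)) y + \<zeta> y * indicator (- cball x' (conc_radius * eps)) y" for y
  proof (cases "y \<in> cball x (conc_radius * eps) \<and> y \<in> cball x' (conc_radius * eps)")
    case True
    then have "dist x x' \<le> 2 * conc_radius * eps" using dist_triangle[of x x' y] by (auto simp: dist_commute)
    with far show ?thesis by simp
  qed (use \<zeta>_nonneg[of y] in \<open>auto simp: indicator_def\<close>)
  then have "integral\<^sup>L lborel \<zeta> \<le> (\<integral>y. \<zeta> y * indicator (- cball x (conc_radius * eps)) y + \<zeta> y * indicator (- cball x' (conc_radius * eps)) y \<partial>lborel)"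
    by (intro integral_mono \<zeta>_int Bochner_Integration.integrable_add integrable_K_cball[OF \<zeta>K]) auto
  also have "\<dots> = (\<integral>y. \<zeta> y * indicator (- cball x (conc_radius * eps)) y \<partial>lborel) + (\<integral>y. \<zeta> y * indicator (- cball x' (conc_radius * eps)) y \<partial>lborel)"
    by (intro Bochner_Integration.integral_add integrable_K_cball[OF \<zeta>K]) auto
  finally show False using mass_far[OF assms(1)] mass_far[OF assms(2)] \<zeta>_mass \<kappa> by simp
qed

lemma ex_support: "\<exists>x. \<zeta> x > 0"
proof (rule ccontr)
  assume "\<not> ?thesis"
  then have "\<zeta> = (\<lambda>_. 0)" using \<zeta>_nonneg by (auto simp: fun_eq_iff intro: antisym simp: not_less)
  then show False using \<zeta>_mass \<kappa> by simp
qed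

lemma \<mu>_upper: "\<mu> \<le> \<kappa> / (2 * pi) * ln (1 / eps) + (16 * f T + \<bar>\<kappa> * ln (6 * r)\<bar>)"
proof -
  obtain x where z: "\<zeta> x > 0" using ex_support by blast
  let ?C = "16 * f T + \<bar>\<kappa> * ln (6 * r)\<bar>"
  have "2 * pi * \<mu> \<le> 2 * pi * green \<zeta> x" using support_green[OF z] by (intro mult_left_mono) auto
  also have "\<dots> \<le> \<kappa> * ln (1 / eps) + ?C"
    \<comment> \<open>With R = 1 the far mass term carries the factor ln 1 = 0.\<close>
    using green_K_le[OF \<zeta>K, of x 1] support_stream[OF z] by simp
  finally have "\<mu> \<le> (\<kappa> * ln (1 / eps) + ?C) / (2 * pi)" by (simp add: field_simps)
  also have "\<dots> = \<kappa> / (2 * pi) * ln (1 / eps) + ?C / (2 * pi)" by (simp add: add_divide_distrib)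
  also have "?C / (2 * pi) \<le> ?C / 1" using f_nonneg[of T] pi_ge_two by (intro divide_left_mono) auto
  finally show ?thesis by simp
qed

end

section \<open>Location of the support\<close>

context vortex_steady
begin

text \<open>The squared distance between one point and the mirror image of the other after both have
  been translated by \<tau> along x1.\<close>

definition image_dist2 :: "real \<Rightarrow> plane \<Rightarrow> plane \<Rightarrow> real" where
  "image_dist2 \<tau> x y = (fst x + fst y + 2 * \<tau>)\<^sup>2 + (snd x - snd y)\<^sup>2"

text \<open>Translation along \<open>x\<^sub>1\<close> changes neither the logarithmic self-interaction nor the penalty, so only
  the interaction with the mirror image and the linear term enter.\<close>

lemma translation_gain_impossible:
  assumes s: "\<And>x. \<zeta> x > 0 \<Longrightarrow> (fst x + \<tau>, snd x) \<in> Dom r"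
    and gain: "\<And>x y. \<zeta> x > 0 \<Longrightarrow> \<zeta> y > 0 \<Longrightarrow> 4 * pi * W * \<tau> / \<kappa> < 1 / 2 * (ln (image_dist2 \<tau> x y) - ln (image_dist2 0 x y))"
  shows False
proof -
  define \<eta> where "\<eta> x = \<zeta> (- \<tau> + 1 * fst x, 0 + 1 * snd x)" for x
  let ?s = "\<lambda>x::plane. (\<tau> + 1 * fst x, 0 + 1 * snd x)"
  note zm[measurable] = \<zeta>_meas
  have fm[measurable]: "fst \<in> borel_measurable (borel :: plane measure)" by (intro borel_measurable_continuous_onI continuous_intros)
  have \<eta>s: "\<eta> (?s x) = \<zeta> x" for x by (simp add: \<eta>_def)
  have \<eta>0: "\<eta> x \<noteq> 0 \<Longrightarrow> x \<in> Dom r" for x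
  proof -
    assume "\<eta> x \<noteq> 0"
    then have "\<zeta> (- \<tau> + fst x, snd x) > 0" using \<zeta>_nonneg[of "(- \<tau> + fst x, snd x)"] by (simp add: \<eta>_def)
    from s[OF this] show ?thesis by simp
  qed
  have \<eta>K: "\<eta> \<in> K"
    unfolding K_def
  proof (intro CollectI conjI allI impI)
    show "\<eta> \<in> borel_measurable borel" unfolding \<eta>_def
      using measurable_compose[OF measurable_signed_translation[of "- \<tau>" 1 0 1] zm] by simp
    show "integral\<^sup>L lborel \<eta> = \<kappa>"
      unfolding \<eta>_def using integral_signed_translation[of 1 1 \<zeta> "- \<tau>" 0] \<zeta>_mass by simp
    show "steiner_sym \<eta>" using \<zeta>_steiner by (auto simp: steiner_sym_def \<eta>_def)
  qed (use \<eta>0 \<zeta>_nonneg \<zeta>_le in \<open>auto simp: \<eta>_def\<close>)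
  note \<eta>m[measurable] = K_D(1)[OF \<eta>K]
  have shift: "(\<integral>x. g (?s x) \<partial>lborel) = integral\<^sup>L lborel g" if "g \<in> borel_measurable borel" for g :: "plane \<Rightarrow> real"
    using integral_signed_translation[of 1 1 g \<tau> 0] that by simp
  have c: "cost \<eta> = cost \<zeta> + W * \<tau> * \<kappa>"
  proof -
    have "(\<integral>x. fst x * \<eta> x \<partial>lborel) = (\<integral>x. fst (?s x) * \<eta> (?s x) \<partial>lborel)"
      by (rule shift[symmetric]) measurable
    also have "\<dots> = (\<integral>x. \<tau> * \<zeta> x + fst x * \<zeta> x \<partial>lborel)" unfolding \<eta>s by (simp add: distrib_right)
    also have "\<dots> = \<tau> * \<kappa> + (\<integral>x. fst x * \<zeta> x \<partial>lborel)" using \<zeta>_int integrable_K_fst[OF \<zeta>K] \<zeta>_mass by simp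
    finally have 1: "(\<integral>x. fst x * \<eta> x \<partial>lborel) = \<tau> * \<kappa> + (\<integral>x. fst x * \<zeta> x \<partial>lborel)" .
    have "(\<integral>x. \<Phi> (\<eta> x / lam) \<partial>lborel) = (\<integral>x. \<Phi> (\<eta> (?s x) / lam) \<partial>lborel)"
      by (rule shift[symmetric]) measurable
    then show ?thesis unfolding cost_def 1 \<eta>s by (simp add: distrib_left mult_ac)
  qed
  \<comment> \<open>The change of the Green kernel under the translation: only the image term
    moves.\<close>
  define k where "k p = ln (dist (reflect (?s (fst p))) (?s (snd p))) - ln (dist (reflect (fst p)) (snd p))" for p
  define w where "w p = \<zeta> (fst p) * \<zeta> (snd p)" for p
  have wK: "integrable lborel w" "integral\<^sup>L lborel w = \<kappa> * \<kappa>"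
    unfolding w_def using integrable_pair_product[OF K_dens[OF \<zeta>K] K_dens[OF \<zeta>K]] integral_pair_product[OF K_dens[OF \<zeta>K] K_dens[OF \<zeta>K]] \<zeta>_mass by auto
  have id2: "(dist (reflect x) y)\<^sup>2 = image_dist2 0 x y" "(dist (reflect (?s x)) (?s y))\<^sup>2 = image_dist2 \<tau> x y" for x y
    unfolding dist_plane_squared(2) image_dist2_def by (simp_all add: algebra_simps)
  have pos1: "dist (reflect (?s x)) (?s y) > 0" and pos2: "dist (reflect x) y > 0" if "\<zeta> x > 0" "\<zeta> y > 0" for x y
  proof -
    have "\<tau> + fst x \<ge> r / 2" "\<tau> + fst y \<ge> r / 2" using s[OF that(1)] s[OF that(2)] by (auto simp: Dom_def)
    then show "dist (reflect (?s x)) (?s y) > 0" using r by (auto simp: reflect_def)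
    show "dist (reflect x) y > 0"
      using dist_reflect_bounds(1)[of x y] support_stream[OF that(1)] support_stream[OF that(2)] r by linarith
  qed
  have gain': "4 * pi * W * \<tau> / \<kappa> < ln (dist (reflect (?s x)) (?s y)) - ln (dist (reflect x) y)"
    if "\<zeta> x > 0" "\<zeta> y > 0" for x y
    using gain[OF that] pos1[OF that] pos2[OF that] unfolding id2[symmetric] by (simp add: ln_realpow)
  let ?c = "((\<tau>, 0), (\<tau>, 0)) :: plane \<times> plane"
  define gw where "gw z p = green_kernel (fst p) (snd p) * (z (fst p) * z (snd p))" for z p
  have ef: "energy_form z z = 1 / (2 * pi) * integral\<^sup>L lborel (gw z)" "integrable lborel (gw z)" if "z \<in> K" for z
    using energy_form_eq_pair(1)[OF K_dens[OF that] K_dens[OF that]] integrable_pair_green[OF K_dens[OF that] K_dens[OF that]]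
    by (simp_all add: gw_def[abs_def] split_def lborel_prod)
  have cs: "?c + p = (?s (fst p), ?s (snd p))" for p by (simp add: prod_eq_iff)
  have sh: "gw \<eta> (?c + p) = gw \<zeta> p + k p * w p" for p
  proof (cases "w p = 0")
    case True
    then show ?thesis unfolding cs gw_def fst_conv snd_conv \<eta>s by (auto simp: w_def)
  next
    case False
    then have z: "\<zeta> (fst p) > 0" "\<zeta> (snd p) > 0" using \<zeta>_nonneg[of "fst p"] \<zeta>_nonneg[of "snd p"] by (auto simp: w_def less_le)
    have d: "dist (?s (fst p)) (?s (snd p)) = dist (fst p) (snd p)" by (simp add: dist_prod_def)
    have "green_kernel (?s (fst p)) (?s (snd p)) = green_kernel (fst p) (snd p) + k p"
      unfolding green_kernel_def d k_def using pos1[OF z] pos2[OF z] by (simp add: ln_div)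
    then show ?thesis unfolding cs gw_def fst_conv snd_conv \<eta>s w_def by (simp add: distrib_right)
  qed
  have gm: "gw \<eta> \<in> borel_measurable borel" using borel_measurable_integrable[OF ef(2)[OF \<eta>K]] by simp
  have "integrable lborel (\<lambda>p. gw \<eta> (?c + p))" and i\<eta>: "(\<integral>p. gw \<eta> (?c + p) \<partial>lborel) = integral\<^sup>L lborel (gw \<eta>)"
    using integrable_distr_eq[of "(+) ?c" lborel borel "gw \<eta>"] integral_distr[of "(+) ?c" lborel borel "gw \<eta>"] ef(2)[OF \<eta>K] gm
    by (simp_all add: lborel_distr_plus)
  then have ikw: "integrable lborel (\<lambda>p. k p * w p)"
    using Bochner_Integration.integrable_diff[OF _ ef(2)[OF \<zeta>K], of "\<lambda>p. gw \<eta> (?c + p)"] by (simp add: sh)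
  have "integral\<^sup>L lborel (gw \<eta>) = integral\<^sup>L lborel (gw \<zeta>) + (\<integral>p. k p * w p \<partial>lborel)"
    unfolding i\<eta>[symmetric] sh by (rule Bochner_Integration.integral_add[OF ef(2)[OF \<zeta>K] ikw])
  then have e: "energy_form \<eta> \<eta> = energy_form \<zeta> \<zeta> + 1 / (2 * pi) * (\<integral>p. k p * w p \<partial>lborel)"
    unfolding ef(1)[OF \<eta>K] ef(1)[OF \<zeta>K] by (simp add: distrib_left)
  \<comment> \<open>The break-even value: the energy changes by the integral of
    \<open>k p * w p\<close> over 4 \<pi>, the cost by W \<tau> \<kappa>, and \<open>w\<close> has
    total mass \<kappa> \<kappa>.\<close>
  define c0 where "c0 = 4 * pi * W * \<tau> / \<kappa>"
  have kc: "0 < (k p - c0) * w p \<or> w p = 0" for p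
  proof (cases "w p = 0")
    case False
    then have z: "\<zeta> (fst p) > 0" "\<zeta> (snd p) > 0" using \<zeta>_nonneg[of "fst p"] \<zeta>_nonneg[of "snd p"] by (auto simp: w_def less_le)
    then show ?thesis using gain'[OF z] by (simp add: k_def c0_def w_def)
  qed simp
  have kc0: "0 \<le> (k p - c0) * w p" for p using kc[of p] by auto
  have ikc: "integrable lborel (\<lambda>p. (k p - c0) * w p)" using ikw wK(1) by (simp add: left_diff_distrib)
  \<comment> \<open>Strictness: the integrand is positive wherever \<open>w\<close> is nonzero, and
    \<open>w\<close> cannot vanish almost everywhere.\<close>
  have "(\<integral>p. (k p - c0) * w p \<partial>lborel) \<noteq> 0"
  proof
    assume "(\<integral>p. (k p - c0) * w p \<partial>lborel) = 0"
    moreover have "AE p in lborel. 0 \<le> (k p - c0) * w p"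
      by (rule AE_I2) (rule kc0)
    ultimately have "AE p in lborel. (k p - c0) * w p = 0"
      by (rule integral_nonneg_eq_0_iff_AE[THEN iffD1, OF ikc, rotated])
    then have "AE p in lborel. w p = 0" by eventually_elim (use kc in force)
    then have "integral\<^sup>L lborel w = 0" by (rule integral_eq_zero_AE)
    then show False using wK \<kappa> by simp
  qed
  moreover have "0 \<le> (\<integral>p. (k p - c0) * w p \<partial>lborel)"
    by (rule Bochner_Integration.integral_nonneg) (rule kc0)
  moreover have "(\<integral>p. (k p - c0) * w p \<partial>lborel) = (\<integral>p. k p * w p \<partial>lborel) - c0 * (\<kappa> * \<kappa>)"
    using ikw wK by (simp add: left_diff_distrib)
  ultimately have "c0 * (\<kappa> * \<kappa>) < (\<integral>p. k p * w p \<partial>lborel)" by linarith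
  moreover have "c0 * (\<kappa> * \<kappa>) = 4 * pi * (W * \<tau> * \<kappa>)" using \<kappa> by (simp add: c0_def)
  ultimately have "4 * pi * (W * \<tau> * \<kappa>) < (\<integral>p. k p * w p \<partial>lborel)" by simp
  then have "W * \<tau> * \<kappa> < 1 / (2 * pi) * (\<integral>p. k p * w p \<partial>lborel) / 2" by (simp add: field_simps)
  then have "En \<zeta> < En \<eta>" unfolding En_def c e by (simp add: add_divide_distrib)
  then show False using maximal[OF \<eta>K] by simp
qed

text \<open>Otherwise a shift to the left by \<tau> would gain. The value of W makes 4 \<pi> W
  \<tau> / \<kappa> equal to \<tau> / r, and for points with x1 \<ge> r + \<tau> the logarithm of
  the image distance drops by at most ln (1 + \<tau> / r) < \<tau> / r. A vertical separation of the
  points only reduces this drop.\<close>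

lemma ex_support_left:
  assumes Weq: "W = \<kappa> / (4 * pi * r)" and \<tau>: "\<tau> > 0"
  shows "\<exists>x. \<zeta> x > 0 \<and> fst x < r + \<tau>"
proof (rule ccontr)
  assume "\<not> ?thesis"
  then have ge: "\<zeta> x > 0 \<Longrightarrow> r + \<tau> \<le> fst x" for x by (meson not_less)
  show False
  proof (rule translation_gain_impossible[of "- \<tau>"])
    fix x assume z: "\<zeta> x > 0"
    show "(fst x + - \<tau>, snd x) \<in> Dom r" using ge[OF z] support_stream[OF z] \<tau> r by (auto simp: Dom_def)
  next
    fix x y assume z: "\<zeta> x > 0" "\<zeta> y > 0"
    define w where "w = fst x + fst y - 2 * \<tau>"
    define s where "s = snd x - snd y"
    have w: "w \<ge> 2 * r" using ge[OF z(1)] ge[OF z(2)] by (simp add: w_def)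
    have I: "image_dist2 (- \<tau>) x y = w\<^sup>2 + s\<^sup>2" "image_dist2 0 x y = (w + 2 * \<tau>)\<^sup>2 + s\<^sup>2"
      by (simp_all add: image_dist2_def w_def s_def)
    have pos: "w\<^sup>2 + s\<^sup>2 > 0" "(w + 2 * \<tau>)\<^sup>2 + s\<^sup>2 > 0" using w r \<tau> by (auto simp: add_pos_nonneg)
    have "2 * r * \<tau> \<le> w * \<tau>" using w \<tau> by (intro mult_right_mono) auto
    then have "2 * \<tau> \<le> w * (\<tau> / r)" using r by (simp add: field_simps)
    then have "(w + 2 * \<tau>)\<^sup>2 \<le> (w * (1 + \<tau> / r))\<^sup>2" using w r \<tau> by (intro power_mono) (auto simp: distrib_left)
    then have "(w + 2 * \<tau>)\<^sup>2 \<le> (1 + \<tau> / r)\<^sup>2 * w\<^sup>2" by (simp only: power_mult_distrib mult.commute)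
    moreover have "1 * s\<^sup>2 \<le> (1 + \<tau> / r)\<^sup>2 * s\<^sup>2" using r \<tau> by (intro mult_right_mono one_le_power) auto
    ultimately have "(w + 2 * \<tau>)\<^sup>2 + s\<^sup>2 \<le> (1 + \<tau> / r)\<^sup>2 * (w\<^sup>2 + s\<^sup>2)"
      unfolding distrib_left by linarith
    then have "ln ((w + 2 * \<tau>)\<^sup>2 + s\<^sup>2) \<le> ln ((1 + \<tau> / r)\<^sup>2 * (w\<^sup>2 + s\<^sup>2))"
      using pos r \<tau> by (subst ln_le_cancel_iff) (auto intro!: mult_pos_pos zero_less_power add_pos_nonneg)
    also have "\<dots> = 2 * ln (1 + \<tau> / r) + ln (w\<^sup>2 + s\<^sup>2)"
    proof -
      have "1 + \<tau> / r > 0" using r \<tau> by (simp add: add_pos_nonneg)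
      moreover have "ln (A\<^sup>2 * B) = 2 * ln A + ln B" if "A > 0" "B > 0" for A B :: real
        using that by (simp add: ln_mult ln_realpow)
      ultimately show ?thesis using pos(1) by blast
    qed
    also have "ln (1 + \<tau> / r) < \<tau> / r"
    proof -
      have p: "0 < 1 + \<tau> / r" using r \<tau> by (simp add: add_pos_nonneg)
      have "ln (1 + \<tau> / r) \<noteq> (1 + \<tau> / r) - 1" using ln_eq_minus_one[OF p] r \<tau> by auto
      then show ?thesis using ln_le_minus_one[OF p] by linarith
    qed
    finally have "ln ((w + 2 * \<tau>)\<^sup>2 + s\<^sup>2) - ln (w\<^sup>2 + s\<^sup>2) < 2 * (\<tau> / r)" by simp
    moreover have "4 * pi * W * - \<tau> / \<kappa> = - (\<tau> / r)" using \<kappa> r by (simp add: Weq)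
    ultimately show "4 * pi * W * - \<tau> / \<kappa> < 1 / 2 * (ln (image_dist2 (- \<tau>) x y) - ln (image_dist2 0 x y))"
      unfolding I by argo
  qed
qed

text \<open>Otherwise a shift to the right by \<open>eps\<close> would gain. Here a vertical
  separation s works against the gain; the bound on the diameter keeps its square below r eps, and
  the margin 2 eps compensates for it.\<close>

lemma ex_support_right:
  assumes Weq: "W = \<kappa> / (4 * pi * r)" and sm: "4 * conc_radius\<^sup>2 * eps < r"
  shows "\<exists>x. \<zeta> x > 0 \<and> r - 2 * eps < fst x"
proof (rule ccontr)
  assume "\<not> ?thesis"
  then have le: "\<zeta> x > 0 \<Longrightarrow> fst x \<le> r - 2 * eps" for x by (meson not_less)
  note e0 = eps_pos
  have "1 \<le> conc_radius\<^sup>2" using Rad_ge_1 by simp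
  then have "1 * eps \<le> conc_radius\<^sup>2 * eps" using e0 by (intro mult_right_mono) auto
  then have e4: "4 * eps < r" using sm by linarith
  show False
  proof (rule translation_gain_impossible[of eps])
    fix x assume z: "\<zeta> x > 0"
    show "(fst x + eps, snd x) \<in> Dom r" using le[OF z] support_stream[OF z] e0 r by (auto simp: Dom_def)
  next
    fix x y assume z: "\<zeta> x > 0" "\<zeta> y > 0"
    define w where "w = fst x + fst y + 2 * eps"
    define s where "s = snd x - snd y"
    have w: "r \<le> w" "w \<le> 2 * r - 2 * eps"
      using support_stream[OF z(1)] support_stream[OF z(2)] le[OF z(1)] le[OF z(2)] e0 by (auto simp: w_def Dom_def)
    have I: "image_dist2 eps x y = w\<^sup>2 + s\<^sup>2" "image_dist2 0 x y = (w - 2 * eps)\<^sup>2 + s\<^sup>2"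
      by (simp_all add: image_dist2_def w_def s_def)
    have pos: "w\<^sup>2 + s\<^sup>2 > 0" "(w - 2 * eps)\<^sup>2 + s\<^sup>2 > 0" using w r e4 by (auto simp: add_pos_nonneg)
    have "\<bar>s\<bar> \<le> dist x y" using dist_snd_le[of x y] by (simp add: s_def dist_real_def)
    also have "\<dots> \<le> 2 * conc_radius * eps" by (rule support_diam[OF z])
    finally have "\<bar>s\<bar>\<^sup>2 \<le> (2 * conc_radius * eps)\<^sup>2" by (intro power_mono) auto
    then have "s\<^sup>2 \<le> 4 * conc_radius\<^sup>2 * eps * eps" by (simp add: power_mult_distrib power2_eq_square mult_ac)
    also have "\<dots> < r * eps" using sm e0 by (intro mult_strict_right_mono)
    finally have s2: "s\<^sup>2 < r * eps" .
    \<comment> \<open>The product estimates the square of w by a linear expression in w; together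
      with the bound on s it shows that eps / r is less than the relative decrease of the image
      distance.\<close>
    have "0 \<le> (w - 2 * eps) * (2 * r - 2 * eps - w)" using w e4 r by (intro mult_nonneg_nonneg) auto
    then have a1: "4 * r * eps - 4 * (eps * eps) \<le> 2 * r * w - w\<^sup>2" by (simp add: power2_eq_square algebra_simps)
    have "4 * eps * eps \<le> r * eps" using e4 e0 by (intro mult_right_mono) auto
    then have "w\<^sup>2 + s\<^sup>2 < r * (2 * w - 2 * eps)" using a1 s2 by (simp add: algebra_simps)
    then have "(w\<^sup>2 + s\<^sup>2) * (eps / r) < r * (2 * w - 2 * eps) * (eps / r)"
      using e0 r by (intro mult_strict_right_mono) auto
    also have "r * (2 * w - 2 * eps) * (eps / r) = 2 * eps * (w - eps)" using r by (simp add: field_simps)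
    finally have "(w\<^sup>2 + s\<^sup>2) * (eps / r) < 2 * eps * (w - eps)" .
    then have k: "eps / r < 2 * eps * (w - eps) / (w\<^sup>2 + s\<^sup>2)" using pos(1) by (simp add: pos_less_divide_eq mult.commute)
    have "ln (((w - 2 * eps)\<^sup>2 + s\<^sup>2) / (w\<^sup>2 + s\<^sup>2)) \<le> ((w - 2 * eps)\<^sup>2 + s\<^sup>2) / (w\<^sup>2 + s\<^sup>2) - 1"
      using pos by (intro ln_le_minus_one divide_pos_pos)
    also have "\<dots> = ((w - 2 * eps)\<^sup>2 + s\<^sup>2 - (w\<^sup>2 + s\<^sup>2)) / (w\<^sup>2 + s\<^sup>2)" 
    proof -
      have "X / B - 1 = (X - B) / B" if "B > 0" for X B :: real using that by (simp add: diff_divide_distrib)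
      then show ?thesis using pos(1) by blast
    qed
    also have "(w - 2 * eps)\<^sup>2 + s\<^sup>2 - (w\<^sup>2 + s\<^sup>2) = - 2 * (2 * eps * (w - eps))" by (simp add: power2_eq_square algebra_simps)
    also have "- 2 * (2 * eps * (w - eps)) / (w\<^sup>2 + s\<^sup>2) = - 2 * (2 * eps * (w - eps) / (w\<^sup>2 + s\<^sup>2))" by simp
    finally have "ln ((w - 2 * eps)\<^sup>2 + s\<^sup>2) - ln (w\<^sup>2 + s\<^sup>2) \<le> - 2 * (2 * eps * (w - eps) / (w\<^sup>2 + s\<^sup>2))"
    proof -
      have "ln (X / B) = ln X - ln B" if "X > 0" "B > 0" for X B :: real using that by (simp add: ln_div)
      from this[OF pos(2) pos(1)] show "ln (((w - 2 * eps)\<^sup>2 + s\<^sup>2) / (w\<^sup>2 + s\<^sup>2)) \<le> - 2 * (2 * eps * (w - eps) / (w\<^sup>2 + s\<^sup>2)) \<Longrightarrow> ?thesis" by linarith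
    qed
    moreover have "4 * pi * W * eps / \<kappa> = eps / r" using \<kappa> r by (simp add: Weq)
    moreover have "Z < 1 / 2 * (b - a)" if "a - b \<le> - 2 * Y" "Z = E" "E < Y" for a b Y Z E :: real
      using that by (simp add: field_simps)
    ultimately show "4 * pi * W * eps / \<kappa> < 1 / 2 * (ln (image_dist2 eps x y) - ln (image_dist2 0 x y))"
      unfolding I using k by blast
  qed
qed

text \<open>By evenness the support contains x and its mirror image in x2, so the diameter bounds
  \<bar>x2\<bar>. In the direction of x1 the two preceding lemmas give support points on either side
  of r up to O(eps), and the diameter does the rest.\<close>

lemma support_location:
  assumes Weq: "W = \<kappa> / (4 * pi * r)" and sm: "4 * conc_radius\<^sup>2 * eps < r" and z: "\<zeta> x > 0"
  shows "dist x (r, 0) < (3 * conc_radius + 3) * eps"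
proof -
  obtain xl where xl: "\<zeta> xl > 0" "fst xl < r + eps" using ex_support_left[OF Weq eps_pos] by blast
  obtain xr where xr: "\<zeta> xr > 0" "r - 2 * eps < fst xr" using ex_support_right[OF Weq sm] by blast
  have d: "\<bar>fst p - fst q\<bar> \<le> 2 * conc_radius * eps" "\<bar>snd p - snd q\<bar> \<le> 2 * conc_radius * eps" if "\<zeta> p > 0" "\<zeta> q > 0" for p q
    using support_diam[OF that] dist_fst_le[of p q] dist_snd_le[of p q] by (auto simp: dist_real_def)
  have "\<zeta> (fst x, - snd x) > 0" using z steiner_sym_even[OF \<zeta>_steiner, of "fst x" "snd x"] by simp
  from d(2)[OF z this] have s: "\<bar>snd x\<bar> \<le> conc_radius * eps" by simp
  have f: "\<bar>fst x - r\<bar> < 2 * conc_radius * eps + 2 * eps" using d(1)[OF z xl(1)] d(1)[OF z xr(1)] xl(2) xr(2) eps_pos by linarith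
  have "dist x (r, 0) \<le> \<bar>fst x - r\<bar> + \<bar>snd x\<bar>"
    using norm_Pair_le[of "fst x - r" "snd x"] by (simp add: dist_norm minus_prod_def)
  also have "\<dots> < 3 * conc_radius * eps + 2 * eps" using s f by linarith
  finally show ?thesis using eps_pos by (simp add: algebra_simps)
qed

text \<open>Off the disc of radius r / 2 the distance to the support is at least r / 4, while the
  image distance is larger by at most 3 r; so ln q \<le> q - 1 bounds the kernel by 12, and 12 \<le>
  6 \<pi>. The bound does not depend on \<open>lam\<close>, unlike \<mu>, and holds in the whole
  half plane.\<close>

lemma green_far:
  assumes Weq: "W = \<kappa> / (4 * pi * r)" and sm: "4 * conc_radius\<^sup>2 * eps < r" and sm2: "(3 * conc_radius + 3) * eps \<le> r / 4"
    and x: "fst x > 0" "dist x (r, 0) \<ge> r / 2"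
  shows "green \<zeta> x \<le> 3 * \<kappa>"
proof -
  have "(\<integral>y. green_kernel x y * \<zeta> y \<partial>lborel) \<le> (\<integral>y. 12 * \<zeta> y \<partial>lborel)"
  proof (rule integral_mono[OF dens_integrable_green_kernel[OF K_dens[OF \<zeta>K]]])
    fix y
    show "green_kernel x y * \<zeta> y \<le> 12 * \<zeta> y"
    proof (cases "\<zeta> y = 0")
      case False
      then have z: "\<zeta> y > 0" using \<zeta>_nonneg[of y] by simp
      have y: "0 < fst y" "fst y \<le> 3 * r / 2" using support_stream[OF z] r by (auto simp: Dom_def)
      have d: "r / 4 \<le> dist x y"
        using support_location[OF Weq sm z] sm2 x(2) dist_triangle[of x "(r, 0)" y] by linarith
      have ne: "y \<noteq> x" "y \<noteq> reflect x" using d r x y by auto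
      have "dist y (reflect y) = 2 * fst y" using y by (simp add: dist_prod_def dist_real_def real_sqrt_mult)
      then have D: "dist (reflect x) y \<le> dist x y + 3 * r"
        using dist_triangle[of x "reflect y" y] y by (simp add: dist_reflect)
      have dp: "dist x y > 0" using d r by linarith
      have "green_kernel x y = ln (dist (reflect x) y / dist x y)" by (rule green_kernel_eq(1)[OF ne])
      also have "\<dots> \<le> dist (reflect x) y / dist x y - 1" using ne dp by (intro ln_le_minus_one divide_pos_pos) auto
      also have "\<dots> \<le> 12" using D d dp by (simp add: divide_le_eq)
      finally show ?thesis using \<zeta>_nonneg by (intro mult_right_mono)
    qed simp
  qed (use \<zeta>_int in simp)
  then have "2 * pi * green \<zeta> x \<le> 12 * \<kappa>" unfolding green_eq_integral[OF K_dens[OF \<zeta>K]] by (simp add: \<zeta>_mass)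
  also have "\<dots> \<le> 2 * pi * (3 * \<kappa>)" using mult_right_mono[OF pi_ge_two, of \<kappa>] \<kappa> by simp
  finally show ?thesis by simp
qed

end

section \<open>Integration by parts for functions of class C1\<close>

text \<open>Class C1 is all that compositions with the potential offer here. The gradient is an
  explicit argument, so that products, translates and slices come with a formula for theirs.\<close>

definition C1_compact_support :: "('a::euclidean_space \<Rightarrow> real) \<Rightarrow> ('a \<Rightarrow> 'a) \<Rightarrow> bool" where
  "C1_compact_support g G \<longleftrightarrow> (\<forall>x. (g has_derivative (\<lambda>h. G x \<bullet> h)) (at x)) \<and> continuous_on UNIV G
     \<and> (\<exists>\<rho>. \<forall>x. norm x > \<rho> \<longrightarrow> g x = 0)"

lemma C1cD:
  assumes "C1_compact_support g G"
  shows "(g has_derivative (\<lambda>h. G x \<bullet> h)) (at x)" "continuous_on UNIV G" "continuous_on UNIV g"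
    "G \<in> borel_measurable borel" "g \<in> borel_measurable borel"
proof -
  show d: "(g has_derivative (\<lambda>h. G x \<bullet> h)) (at x)" for x using assms by (simp add: C1_compact_support_def)
  show c: "continuous_on UNIV G" using assms by (simp add: C1_compact_support_def)
  show c': "continuous_on UNIV g"
    by (rule continuous_at_imp_continuous_on) (use d has_derivative_continuous in blast)
  show "G \<in> borel_measurable borel" "g \<in> borel_measurable borel" using c c' by (auto intro: borel_measurable_continuous_onI)
qed

lemma C1c_grad_support:
  assumes "C1_compact_support g G" "\<And>x. norm x > \<rho> \<Longrightarrow> g x = 0" "norm x > \<rho>"
  shows "G x = 0"
proof -
  have o: "open {x::'a. norm x > \<rho>}" by (intro open_Collect_less continuous_intros)
  have "((\<lambda>x. 0) has_derivative (\<lambda>h. G x \<bullet> h)) (at x)"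
    by (rule has_derivative_transform_within_open[OF C1cD(1)[OF assms(1), of x] o]) (use assms in auto)
  then have "(\<lambda>h. G x \<bullet> h) = (\<lambda>h. 0)" using has_derivative_unique[OF _ has_derivative_const] by blast
  then have "G x \<bullet> G x = 0" by (rule fun_cong)
  then show ?thesis by simp
qed

lemma C1c_bounds:
  assumes g: "C1_compact_support g G"
  obtains C \<rho> where "0 \<le> C" "0 \<le> \<rho>" "\<And>x. norm (G x) \<le> C" "\<And>x. \<bar>g x\<bar> \<le> C" "\<And>x. norm x > \<rho> \<Longrightarrow> g x = 0"
    "\<And>x. norm x > \<rho> \<Longrightarrow> G x = 0" "\<And>x y. \<bar>g x - g y\<bar> \<le> C * norm (x - y)"
proof -
  obtain \<rho>0 where \<rho>0: "\<And>x. norm x > \<rho>0 \<Longrightarrow> g x = 0" using g by (auto simp: C1_compact_support_def)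
  define \<rho> where "\<rho> = \<bar>\<rho>0\<bar>"
  have \<rho>: "norm x > \<rho> \<Longrightarrow> g x = 0" for x using \<rho>0[of x] by (simp add: \<rho>_def)
  have z: "norm x > \<rho> \<Longrightarrow> G x = 0" for x by (rule C1c_grad_support[OF g \<rho>])
  have "compact (G ` cball 0 \<rho>)" "compact (g ` cball 0 \<rho>)"
    by (intro compact_continuous_image continuous_on_subset[OF C1cD(2)[OF g]] continuous_on_subset[OF C1cD(3)[OF g]]; simp)+
  then have "bounded (G ` cball 0 \<rho>)" "bounded (g ` cball 0 \<rho>)" by (auto intro: compact_imp_bounded)
  then obtain C1 C2 where C1: "\<And>x. x \<in> cball 0 \<rho> \<Longrightarrow> norm (G x) \<le> C1" and C2: "\<And>x. x \<in> cball 0 \<rho> \<Longrightarrow> norm (g x) \<le> C2"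
    unfolding bounded_iff by (metis imageI)
  define C where "C = max 0 (max C1 C2)"
  have bG: "norm (G x) \<le> C" for x using C1[of x] z[of x] by (cases "norm x \<le> \<rho>") (auto simp: C_def)
  have bg: "\<bar>g x\<bar> \<le> C" for x using C2[of x] \<rho>[of x] by (cases "norm x \<le> \<rho>") (auto simp: C_def)
  have "norm (g x - g y) \<le> C * norm (x - y)" for x y
  proof (rule differentiable_bound[of UNIV g "\<lambda>x h. G x \<bullet> h"])
    show "onorm (\<lambda>h. G x \<bullet> h) \<le> C" for x
    proof (rule onorm_le)
      fix h
      have "norm (G x \<bullet> h) \<le> norm (G x) * norm h" by (simp add: Cauchy_Schwarz_ineq2)
      also have "\<dots> \<le> C * norm h" by (intro mult_right_mono bG) simp
      finally show "norm (G x \<bullet> h) \<le> C * norm h" .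
    qed
  qed (use C1cD(1)[OF g] in auto)
  then show ?thesis using that[of C \<rho>] bG bg \<rho> z by (auto simp: C_def \<rho>_def)
qed

lemma C1c_difference_quotient:
  assumes g: "C1_compact_support g G" and s: "s \<noteq> 0"
  shows "(\<lambda>n. (g (x + (s / real (Suc n)) *\<^sub>R e) - g x) / (s / real (Suc n))) \<longlonglongrightarrow> G x \<bullet> e"
proof -
  have "((\<lambda>s. g (x + s *\<^sub>R e)) has_derivative (\<lambda>s. G (x + 0 *\<^sub>R e) \<bullet> (s *\<^sub>R e))) (at 0)"
    by (rule has_derivative_compose[where f = "\<lambda>s. x + s *\<^sub>R e", OF _ C1cD(1)[OF g]])
      (auto intro!: derivative_eq_intros)
  then have "((\<lambda>s. g (x + s *\<^sub>R e)) has_real_derivative G x \<bullet> e) (at 0)"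
    unfolding has_field_derivative_def by (rule has_derivative_eq_rhs) (simp add: fun_eq_iff mult.commute)
  then have "((\<lambda>h. (g (x + h *\<^sub>R e) - g x) / h) \<longlongrightarrow> G x \<bullet> e) (at 0)"
    by (simp add: DERIV_def)
  moreover have "filterlim (\<lambda>n. s / real (Suc n)) (at 0) sequentially"
    using LIMSEQ_Suc[OF lim_const_over_n[of s]] s by (auto simp: filterlim_at)
  ultimately show ?thesis by (rule filterlim_compose)
qed

lemma integrable_translation:
  fixes g :: "'a::euclidean_space \<Rightarrow> real"
  assumes "g \<in> borel_measurable borel"
  shows "integrable lborel (\<lambda>x. g (x + c)) \<longleftrightarrow> integrable lborel g" "(\<integral>x. g (x + c) \<partial>lborel) = integral\<^sup>L lborel g"
  using integrable_distr_eq[of "(+) c" lborel borel g] integral_distr[of "(+) c" lborel borel g] assms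
  by (simp_all add: lborel_distr_plus add.commute)

lemma C1c_integrable:
  assumes g: "C1_compact_support g G"
  shows "integrable lborel g" "integrable lborel (\<lambda>x. G x \<bullet> e)"
proof -
  obtain C \<rho> where b: "0 \<le> C" "\<And>x. norm (G x) \<le> C" "\<And>x. \<bar>g x\<bar> \<le> C" "\<And>x. norm x > \<rho> \<Longrightarrow> g x = 0" "\<And>x. norm x > \<rho> \<Longrightarrow> G x = 0"
    using C1c_bounds[OF g] by metis
  show "integrable lborel g" by (rule dens_integrable_bounded[of _ C \<rho>]) (use C1cD(5)[OF g] b in auto)
  show "integrable lborel (\<lambda>x. G x \<bullet> e)"
  proof (rule dens_integrable_bounded[of _ "C * norm e" \<rho>])
    show "(\<lambda>x. G x \<bullet> e) \<in> borel_measurable borel" using C1cD(4)[OF g] by measurable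
    show "norm (G x \<bullet> e) \<le> C * norm e" for x
      using order_trans[OF Cauchy_Schwarz_ineq2[of "G x" e] mult_right_mono[OF b(2)[of x] norm_ge_zero]] by simp
  qed (use b in auto)
qed

text \<open>Integration by parts by difference quotients; this needs no mixed second derivatives.\<close>

lemma C1c_dominated_quotient:
  fixes g :: "'a::euclidean_space \<Rightarrow> real" and p :: "'a \<Rightarrow> real"
  assumes g: "C1_compact_support g G" and p: "p \<in> borel_measurable borel" and pb: "\<And>x. \<bar>p x\<bar> \<le> P" and s: "\<bar>s\<bar> = 1"
  shows "(\<lambda>n. \<integral>x. (g (x + (s / real (Suc n)) *\<^sub>R e) - g x) / (s / real (Suc n)) * p x \<partial>lborel) \<longlonglongrightarrow> (\<integral>x. (G x \<bullet> e) * p x \<partial>lborel)"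
proof -
  obtain C \<rho> where b: "0 \<le> C" "0 \<le> \<rho>" "\<And>x. norm x > \<rho> \<Longrightarrow> g x = 0" "\<And>x y. \<bar>g x - g y\<bar> \<le> C * norm (x - y)"
    using C1c_bounds[OF g] by metis
  note [measurable] = p C1cD(5)[OF g] C1cD(4)[OF g]
  let ?q = "\<lambda>n x. (g (x + (s / real (Suc n)) *\<^sub>R e) - g x) / (s / real (Suc n)) * p x"
  show ?thesis
  proof (rule integral_dominated_convergence[where w = "\<lambda>x. C * norm e * P * indicator (cball 0 (\<rho> + norm e)) x"])
    show "integrable lborel (\<lambda>x::'a. C * norm e * P * indicator (cball 0 (\<rho> + norm e)) x)"
      using emeasure_bounded_finite[OF bounded_cball[of "0::'a" "\<rho> + norm e"]]
      by (intro integrable_mult_right integrable_real_indicator) auto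
    show "AE x in lborel. (\<lambda>n. ?q n x) \<longlonglongrightarrow> (G x \<bullet> e) * p x"
      using s by (intro AE_I2 tendsto_mult_right C1c_difference_quotient[OF g]) auto
    show "AE x in lborel. norm (?q n x) \<le> C * norm e * P * indicator (cball 0 (\<rho> + norm e)) x" for n
    proof (rule AE_I2)
      fix x
      define h where "h = s / real (Suc n)"
      have h: "h \<noteq> 0" "\<bar>h\<bar> \<le> 1" using s by (auto simp: h_def)
      show "norm (?q n x) \<le> C * norm e * P * indicator (cball 0 (\<rho> + norm e)) x"
      proof (cases "norm x \<le> \<rho> + norm e")
        case True
        have "\<bar>g (x + h *\<^sub>R e) - g x\<bar> \<le> C * (\<bar>h\<bar> * norm e)" using b(4)[of "x + h *\<^sub>R e" x] by simp
        then have "\<bar>g (x + h *\<^sub>R e) - g x\<bar> / \<bar>h\<bar> \<le> C * norm e" using h by (simp add: divide_le_eq mult_ac)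
        then have "\<bar>g (x + h *\<^sub>R e) - g x\<bar> / \<bar>h\<bar> * \<bar>p x\<bar> \<le> C * norm e * P"
          using pb[of x] b(1) by (intro mult_mono) auto
        then show ?thesis using True unfolding h_def[symmetric] by (simp add: abs_mult)
      next
        case False
        have "\<bar>h\<bar> * norm e \<le> 1 * norm e" using h by (intro mult_right_mono) auto
        then have "norm (h *\<^sub>R e) \<le> norm e" by simp
        then have "norm (x + h *\<^sub>R e) > \<rho>" using False norm_diff_ineq[of x "h *\<^sub>R e"] by linarith
        moreover have "norm x > \<rho>" using False norm_ge_zero[of e] by linarith
        ultimately show ?thesis using b(3) False unfolding h_def[symmetric] by simp
      qed
    qed
  qed measurable
qed

text \<open>Difference quotients have integral zero by translation invariance; pass to the
  limit.\<close>

lemma C1c_integral_grad: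
  assumes g: "C1_compact_support g G" shows "(\<integral>x. G x \<bullet> e \<partial>lborel) = 0"
proof -
  have "(\<lambda>n. \<integral>x. (g (x + (1 / real (Suc n)) *\<^sub>R e) - g x) / (1 / real (Suc n)) * 1 \<partial>lborel) \<longlonglongrightarrow> (\<integral>x. (G x \<bullet> e) * 1 \<partial>lborel)"
    by (rule C1c_dominated_quotient[OF g, where P = 1]) auto
  moreover have "(\<integral>x. (g (x + (1 / real (Suc n)) *\<^sub>R e) - g x) / (1 / real (Suc n)) * 1 \<partial>lborel) = 0" for n
    using integrable_translation[OF C1cD(5)[OF g], of "(1 / real (Suc n)) *\<^sub>R e"] C1c_integrable(1)[OF g]
    by (simp del: of_nat_Suc)
  ultimately show ?thesis by (simp add: LIMSEQ_const_iff)
qed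

lemma C1c_mult:
  assumes g: "C1_compact_support g G" and k: "C1_compact_support k H"
  shows "C1_compact_support (\<lambda>x. g x * k x) (\<lambda>x. g x *\<^sub>R H x + k x *\<^sub>R G x)"
proof -
  have "((\<lambda>x. g x * k x) has_derivative (\<lambda>h. (g x *\<^sub>R H x + k x *\<^sub>R G x) \<bullet> h)) (at x)" for x
    by (rule has_derivative_eq_rhs[OF has_derivative_mult[OF C1cD(1)[OF g] C1cD(1)[OF k]]])
      (simp add: inner_add_left mult.commute)
  moreover have "\<exists>\<rho>. \<forall>x. norm x > \<rho> \<longrightarrow> g x * k x = 0" using g by (auto simp: C1_compact_support_def)
  ultimately show ?thesis using C1cD(2,3)[OF g] C1cD(2,3)[OF k]
    by (auto simp: C1_compact_support_def intro!: continuous_intros)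
qed

lemma C1c_translate:
  assumes g: "C1_compact_support g G" shows "C1_compact_support (\<lambda>x. g (x + c)) (\<lambda>x. G (x + c))"
proof -
  have "((\<lambda>x. g (x + c)) has_derivative (\<lambda>h. G (x + c) \<bullet> h)) (at x)" for x
    by (rule has_derivative_compose[where f = "\<lambda>x. x + c", OF _ C1cD(1)[OF g]]) (auto intro!: derivative_eq_intros)
  moreover have "continuous_on UNIV (\<lambda>x. G (x + c))"
    by (rule continuous_on_compose2[OF C1cD(2)[OF g]]) (auto intro!: continuous_intros)
  moreover obtain \<rho> where \<rho>: "\<And>x. norm x > \<rho> \<Longrightarrow> g x = 0" using g by (auto simp: C1_compact_support_def)
  have "g (x + c) = 0" if "norm x > \<rho> + norm c" for x
    using \<rho>[of "x + c"] that norm_diff_ineq[of x c] by linarith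
  ultimately show ?thesis unfolding C1_compact_support_def by blast
qed

lemma C1c_diff_scale:
  assumes g: "C1_compact_support g G" and k: "C1_compact_support k H"
  shows "C1_compact_support (\<lambda>x. (g x - k x) / c) (\<lambda>x. (1 / c) *\<^sub>R (G x - H x))"
proof -
  have "((\<lambda>x. (g x - k x) / c) has_derivative (\<lambda>h. ((1 / c) *\<^sub>R (G x - H x)) \<bullet> h)) (at x)" for x
  proof -
    have "((\<lambda>x. 1 / c * (g x - k x)) has_derivative (\<lambda>h. 1 / c * (G x \<bullet> h - H x \<bullet> h))) (at x)"
      by (intro has_derivative_mult_right has_derivative_diff C1cD(1)[OF g] C1cD(1)[OF k])
    then show ?thesis by (simp add: inner_diff_left)
  qed
  moreover obtain \<rho> \<rho>' where \<rho>: "\<And>x. norm x > \<rho> \<Longrightarrow> g x = 0" "\<And>x. norm x > \<rho>' \<Longrightarrow> k x = 0"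
    using g k by (auto simp: C1_compact_support_def)
  have "\<exists>\<rho>. \<forall>x. norm x > \<rho> \<longrightarrow> (g x - k x) / c = 0"
    by (rule exI[of _ "max \<rho> \<rho>'"]) (use \<rho> in auto)
  ultimately show ?thesis using C1cD(2)[OF g] C1cD(2)[OF k]
    by (auto simp: C1_compact_support_def intro!: continuous_intros)
qed

text \<open>The weak form of the symmetry of mixed derivatives. Replace the derivative of \<xi>
  along e by a difference quotient, integrate by parts along d, and move the translation onto A; no
  function is differentiated twice.\<close>

lemma C1c_skew:
  fixes d e :: "'a::euclidean_space"
  assumes A: "C1_compact_support A GA" and x: "C1_compact_support \<xi> GX"
  shows "(\<integral>x. (GA x \<bullet> d) * (GX x \<bullet> e) \<partial>lborel) = (\<integral>x. (GA x \<bullet> e) * (GX x \<bullet> d) \<partial>lborel)"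
proof -
  obtain C where C: "\<And>x. norm (GA x) \<le> C" using C1c_bounds[OF A] by metis
  obtain C' where C': "\<And>x. norm (GX x) \<le> C'" using C1c_bounds[OF x] by metis
  have bd: "\<bar>GA x \<bullet> d\<bar> \<le> C * norm d" for x
    by (rule order_trans[OF Cauchy_Schwarz_ineq2 mult_right_mono[OF C norm_ge_zero]])
  have bd': "\<bar>GX x \<bullet> d\<bar> \<le> C' * norm d" for x
    by (rule order_trans[OF Cauchy_Schwarz_ineq2 mult_right_mono[OF C' norm_ge_zero]])
  note [measurable] = C1cD(4)[OF A] C1cD(4)[OF x] C1cD(5)[OF A] C1cD(5)[OF x]
  let ?h = "\<lambda>n. 1 / real (Suc n)"
  have l1: "(\<lambda>n. \<integral>x. (\<xi> (x + (1 / real (Suc n)) *\<^sub>R e) - \<xi> x) / (1 / real (Suc n)) * (GA x \<bullet> d) \<partial>lborel) \<longlonglongrightarrow> (\<integral>x. (GX x \<bullet> e) * (GA x \<bullet> d) \<partial>lborel)"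
    by (rule C1c_dominated_quotient[OF x _ bd]) auto
  \<comment> \<open>The step is negative because moving the translation onto \<open>A\<close> turns
    x + h e into x - h e.\<close>
  have l2: "(\<lambda>n. \<integral>x. (A (x + (- 1 / real (Suc n)) *\<^sub>R e) - A x) / (- 1 / real (Suc n)) * (GX x \<bullet> d) \<partial>lborel) \<longlonglongrightarrow> (\<integral>x. (GA x \<bullet> e) * (GX x \<bullet> d) \<partial>lborel)"
    by (rule C1c_dominated_quotient[OF A _ bd']) auto
  have eq: "(\<integral>x. (\<xi> (x + (1 / real (Suc n)) *\<^sub>R e) - \<xi> x) / (1 / real (Suc n)) * (GA x \<bullet> d) \<partial>lborel)
     = (\<integral>x. (A (x + (- 1 / real (Suc n)) *\<^sub>R e) - A x) / (- 1 / real (Suc n)) * (GX x \<bullet> d) \<partial>lborel)" for n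
  proof -
    define h where "h = 1 / real (Suc n)"
    have h: "h \<noteq> 0" by (simp add: h_def)
    define q where "q x = (\<xi> (x + h *\<^sub>R e) - \<xi> x) / h" for x
    define Gq where "Gq x = (1 / h) *\<^sub>R (GX (x + h *\<^sub>R e) - GX x)" for x
    have q: "C1_compact_support q Gq" unfolding q_def Gq_def by (rule C1c_diff_scale[OF C1c_translate[OF x] x])
    have i1: "integrable lborel (\<lambda>x. A x * (GX (x + h *\<^sub>R e) \<bullet> d))" and i2: "integrable lborel (\<lambda>x. A x * (GX x \<bullet> d))"
      and i3: "integrable lborel (\<lambda>x. q x * (GA x \<bullet> d))"
    proof -
      have b: "integrable lborel (\<lambda>x. u x * p x)" if u: "C1_compact_support u U" and p: "p \<in> borel_measurable borel" "\<And>x. \<bar>p x\<bar> \<le> P" for u U p P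
      proof -
        obtain K \<rho> where K: "0 \<le> K" "\<And>x. \<bar>u x\<bar> \<le> K" "\<And>x. norm x > \<rho> \<Longrightarrow> u x = 0" using C1c_bounds[OF u] by metis
        show ?thesis
        proof (rule dens_integrable_bounded[of _ "K * P" \<rho>])
          show "(\<lambda>x. u x * p x) \<in> borel_measurable borel" using C1cD(5)[OF u] p(1) by measurable
          show "norm (u x * p x) \<le> K * P" for x unfolding real_norm_def abs_mult using K p(2)[of x] by (intro mult_mono) auto
        qed (use K in auto)
      qed
      show "integrable lborel (\<lambda>x. A x * (GX (x + h *\<^sub>R e) \<bullet> d))" by (rule b[OF A _ bd']) measurable
      show "integrable lborel (\<lambda>x. A x * (GX x \<bullet> d))" by (rule b[OF A _ bd']) measurable
      show "integrable lborel (\<lambda>x. q x * (GA x \<bullet> d))" by (rule b[OF q _ bd]) measurable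
    qed
    have "(\<integral>x. (q x *\<^sub>R GA x + A x *\<^sub>R Gq x) \<bullet> d \<partial>lborel) = 0"
      by (rule C1c_integral_grad[OF C1c_mult[OF q A]])
    also have "(\<lambda>x. (q x *\<^sub>R GA x + A x *\<^sub>R Gq x) \<bullet> d) = (\<lambda>x. q x * (GA x \<bullet> d) + 1 / h * (A x * (GX (x + h *\<^sub>R e) \<bullet> d) - A x * (GX x \<bullet> d)))"
      by (simp add: fun_eq_iff inner_add_left inner_diff_left Gq_def algebra_simps)
    finally have 1: "(\<integral>x. q x * (GA x \<bullet> d) \<partial>lborel) + 1 / h * ((\<integral>x. A x * (GX (x + h *\<^sub>R e) \<bullet> d) \<partial>lborel) - (\<integral>x. A x * (GX x \<bullet> d) \<partial>lborel)) = 0"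
      using i1 i2 i3 by simp
    let ?k = "\<lambda>x. A (x + (- h) *\<^sub>R e) * (GX x \<bullet> d)"
    have km: "?k \<in> borel_measurable borel" by measurable
    have 2: "(\<integral>x. A x * (GX (x + h *\<^sub>R e) \<bullet> d) \<partial>lborel) = integral\<^sup>L lborel ?k"
      using integrable_translation(2)[OF km, of "h *\<^sub>R e"] by simp
    have i4: "integrable lborel ?k" using integrable_translation(1)[OF km, of "h *\<^sub>R e"] i1 by simp
    have "(\<integral>x. (A (x + (- h) *\<^sub>R e) - A x) / (- h) * (GX x \<bullet> d) \<partial>lborel) = - (1 / h) * (\<integral>x. ?k x - A x * (GX x \<bullet> d) \<partial>lborel)"
      by (subst integral_mult_right_zero[symmetric]) (simp add: field_simps)
    also have "\<dots> = - (1 / h) * (integral\<^sup>L lborel ?k - (\<integral>x. A x * (GX x \<bullet> d) \<partial>lborel))"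
      by (subst Bochner_Integration.integral_diff[OF i4 i2]) simp
    also have "\<dots> = (\<integral>x. q x * (GA x \<bullet> d) \<partial>lborel)" using 1 2 by simp
    finally show ?thesis by (simp add: q_def h_def)
  qed
  have "(\<integral>x. (GX x \<bullet> e) * (GA x \<bullet> d) \<partial>lborel) = (\<integral>x. (GA x \<bullet> e) * (GX x \<bullet> d) \<partial>lborel)"
    using LIMSEQ_unique[OF l1[unfolded eq] l2] .
  then show ?thesis by (simp add: mult.commute)
qed

lemma test_function_C1c:
  fixes \<eta> :: "'a::euclidean_space \<Rightarrow> real"
  assumes "test_function \<eta>"
  obtains G where "C1_compact_support \<eta> G" "\<And>x e. partial e \<eta> x = G x \<bullet> e"
proof -
  have t: "C_k 1 \<eta>" and c: "compact (closure {x. \<eta> x \<noteq> 0})" using assms by (auto simp: test_function_def)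
  then have d: "\<And>x. \<eta> differentiable (at x)" and pc: "\<And>e. e \<in> Basis \<Longrightarrow> continuous_on UNIV (partial e \<eta>)" by auto
  define G where "G x = (\<Sum>e\<in>Basis. partial e \<eta> x *\<^sub>R e)" for x
  have fd: "frechet_derivative \<eta> (at x) h = G x \<bullet> h" for x h
  proof -
    have l: "linear (frechet_derivative \<eta> (at x))" using d by (rule linear_frechet_derivative)
    have "frechet_derivative \<eta> (at x) h = frechet_derivative \<eta> (at x) (\<Sum>e\<in>Basis. (h \<bullet> e) *\<^sub>R e)" by (simp add: euclidean_representation)
    also have "\<dots> = (\<Sum>e\<in>Basis. (h \<bullet> e) * partial e \<eta> x)"
      using l by (simp add: linear_sum linear_cmul partial_def)
    also have "\<dots> = G x \<bullet> h" 
      unfolding G_def inner_sum_left inner_scaleR_left by (intro sum.cong refl) (simp add: inner_commute mult.commute)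
    finally show ?thesis .
  qed
  have "C1_compact_support \<eta> G"
    unfolding C1_compact_support_def
  proof (intro conjI allI)
    show "(\<eta> has_derivative (\<lambda>h. G x \<bullet> h)) (at x)" for x
      using d[of x] unfolding frechet_derivative_works by (simp add: fd[abs_def] eta_contract_eq)
    show "continuous_on UNIV G" unfolding G_def using pc by (intro continuous_intros) auto
    have "bounded {x. \<eta> x \<noteq> 0}" using c by (meson bounded_closure_image bounded_subset closure_subset compact_imp_bounded)
    then obtain \<rho> where "\<And>x. \<eta> x \<noteq> 0 \<Longrightarrow> norm x \<le> \<rho>" by (auto simp: bounded_iff)
    then show "\<exists>\<rho>. \<forall>x. norm x > \<rho> \<longrightarrow> \<eta> x = 0" by (intro exI[of _ \<rho>]) force
  qed
  moreover have "partial e \<eta> x = G x \<bullet> e" for x e by (simp add: partial_def fd)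
  ultimately show ?thesis by (rule that)
qed

section \<open>The weak vorticity equation\<close>

lemma has_derivative_eventually_eq:
  assumes F: "(F has_derivative D) (at x)" and e: "\<forall>\<^sub>F y in nhds x. G y = F y"
  shows "(G has_derivative D) (at x)"
proof (rule has_derivative_transform_eventually[OF F])
  show "\<forall>\<^sub>F y in at x. F y = G y"
    using e unfolding eventually_at_filter by eventually_elim auto
  show "F x = G x" using eventually_nhds_x_imp_x[OF e] by simp
qed simp

text \<open>The normalization on the nonpositive half line makes the composition with the relative
  stream function vanish away from the vortices.\<close>

lemma continuous_antiderivative_nonneg:
  fixes p :: "real \<Rightarrow> real"
  assumes c: "continuous_on UNIV p" and p0: "\<And>s. s \<le> 0 \<Longrightarrow> p s = 0"
  obtains P where "\<And>s. (P has_real_derivative p s) (at s)" "\<And>s. s \<le> 0 \<Longrightarrow> P s = 0"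
proof -
  have "\<exists>P. \<forall>x :: real. (- \<infinity> :: ereal) < ereal x \<longrightarrow> ereal x < \<infinity> \<longrightarrow> (P has_vector_derivative p x) (at x)"
    by (rule einterval_antiderivative) (use c in \<open>auto simp: continuous_on_eq_continuous_at\<close>)
  then obtain P0 where P0: "\<And>x. (P0 has_real_derivative p x) (at x)"
    by (auto simp: has_real_derivative_iff_has_vector_derivative)
  define P where "P s = P0 s - P0 0" for s
  have P: "(P has_real_derivative p s) (at s)" for s
    unfolding P_def by (auto intro!: derivative_eq_intros P0)
  have "P s = 0" if "s \<le> 0" for s
  proof (cases "s = 0")
    case False
    then have "s < 0" using that by simp
    then obtain z where z: "s < z" "z < 0" "P 0 - P s = (0 - s) * p z" using MVT2[of s 0 P p] P by blast
    then show ?thesis using p0[of z] by (simp add: P_def)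
  qed (simp add: P_def)
  with P show ?thesis by (rule that)
qed

section \<open>Continuous approximations of the profile\<close>

context profile
begin

text \<open>The average of f over an interval of length 1 / (k + 1) ending at s. Looking backwards
  keeps it 0 for s \<le> 0 and, by monotonicity, below f s.\<close>

definition f_reg :: "nat \<Rightarrow> real \<Rightarrow> real" where
  "f_reg k s = real (Suc k) * (F s - F (s - 1 / real (Suc k)))"

lemma F_lipschitz: "\<bar>F u - F v\<bar> \<le> f T * \<bar>u - v\<bar>"
proof -
  have "F u - F v \<le> f T * \<bar>u - v\<bar>" for u v
  proof -
    have "F u - F v \<le> f u * (u - v)" using F_subgradient[of u v] by (simp add: algebra_simps)
    also have "\<dots> \<le> f u * \<bar>u - v\<bar>" using f_nonneg by (intro mult_left_mono) auto
    also have "\<dots> \<le> f T * \<bar>u - v\<bar>" using f_le_T by (intro mult_right_mono) auto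
    finally show ?thesis .
  qed
  from this[of u v] this[of v u] show ?thesis by (simp add: abs_le_iff abs_minus_commute)
qed

lemma F_continuous: "continuous_on UNIV F"
proof (rule continuous_at_imp_continuous_on, rule ballI)
  fix s
  have "((\<lambda>s'. f T * \<bar>s' - s\<bar>) \<longlongrightarrow> f T * \<bar>s - s\<bar>) (at s)" by (intro tendsto_intros)
  then have "((\<lambda>s'. f T * \<bar>s' - s\<bar>) \<longlongrightarrow> 0) (at s)" by simp
  then have "((\<lambda>s'. F s' - F s) \<longlongrightarrow> 0) (at s)"
    by (rule Lim_null_comparison[rotated]) (simp add: F_lipschitz)
  then show "isCont F s" unfolding isCont_def by (simp add: LIM_zero_iff)
qed

lemma f_reg_continuous: "continuous_on UNIV (f_reg k)"
  unfolding f_reg_def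
  by (intro continuous_intros continuous_on_compose2[OF F_continuous]) auto

lemma f_reg_bounds: "f (s - 1 / real (Suc k)) \<le> f_reg k s" "f_reg k s \<le> f s"
proof -
  define h where "h = 1 / real (Suc k)"
  have h: "real (Suc k) = 1 / h" "h > 0" by (simp_all add: h_def)
  have "f (s - h) * h \<le> F s - F (s - h)" using F_subgradient[of "s - h" s] by simp
  then show "f (s - 1 / real (Suc k)) \<le> f_reg k s" unfolding f_reg_def h_def[symmetric] h(1) using h(2) by (simp add: pos_le_divide_eq)
  have "F s - F (s - h) \<le> f s * h" using F_subgradient[of s "s - h"] by simp
  then show "f_reg k s \<le> f s" unfolding f_reg_def h_def[symmetric] h(1) using h(2) by (simp add: pos_divide_le_eq)
qed

lemma f_reg_range: "0 \<le> f_reg k s" "f_reg k s \<le> f T"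
  using f_reg_bounds[where s = s and k = k] f_nonneg[of "s - 1 / real (Suc k)"] f_le_T[of s] by auto

lemma f_reg_nonpos: "s \<le> 0 \<Longrightarrow> f_reg k s = 0"
  using f_reg_bounds(2)[where s = s and k = k] f_reg_range(1)[where s = s and k = k] f_nonpos[of s] by simp

lemma f_reg_tendsto: "isCont f s \<Longrightarrow> (\<lambda>k. f_reg k s) \<longlonglongrightarrow> f s"
proof (rule tendsto_sandwich[of "\<lambda>k. f (s - 1 / real (Suc k))" _ _ "\<lambda>k. f s"])
  assume c: "isCont f s"
  have "(\<lambda>k. s - 1 / real (Suc k)) \<longlonglongrightarrow> s - 0" by (intro tendsto_intros LIMSEQ_Suc[OF lim_1_over_n])
  then show "(\<lambda>k. f (s - 1 / real (Suc k))) \<longlonglongrightarrow> f s" by (auto intro: isCont_tendsto_compose[OF c])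
qed (use f_reg_bounds in auto)

end

text \<open>\<open>\<mu>_large\<close> beats the bound of \<open>green_far\<close>, so the relative
  stream function is negative in the half plane away from b1; on the axis, where \<Theta> vanishes,
  it equals - \<mu> < 0.\<close>

locale vortex_localized = vortex_steady +
  assumes Weq: "W = \<kappa> / (4 * pi * r)" and Rad_small: "4 * conc_radius\<^sup>2 * eps < r" and Rad_small': "(3 * conc_radius + 3) * eps \<le> r / 4"
    and \<mu>_large: "\<mu> > 3 * \<kappa>"
begin

definition \<phi> :: "plane \<Rightarrow> real" where "\<phi> = green \<zeta>"

definition \<zeta>' :: "plane \<Rightarrow> real" where "\<zeta>' = odd_ext \<zeta>"

text \<open>The stream function in the frame moving with the vortex pair, in which the flow is
  steady.\<close>

definition \<Theta> :: "plane \<Rightarrow> real" where "\<Theta> x = \<phi> x - W * fst x"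

definition G\<phi> :: "plane \<Rightarrow> plane" where "G\<phi> = grad_pot \<zeta>'"

definition G\<Theta> :: "plane \<Rightarrow> plane" where "G\<Theta> x = G\<phi> x - (W, 0)"

lemma \<zeta>_left: "fst x \<le> 0 \<Longrightarrow> \<zeta> x = 0"
  using \<zeta>_Dom[of x] r by (auto simp: Dom_def)

lemma \<zeta>'_eq: "fst x > 0 \<Longrightarrow> \<zeta>' x = \<zeta> x" "fst x < 0 \<Longrightarrow> \<zeta>' x = - \<zeta> (reflect x)" "fst x = 0 \<Longrightarrow> \<zeta>' x = 0"
  by (simp_all add: \<zeta>'_def odd_ext_def \<zeta>_left)

lemma \<zeta>'_dens: "bounded_density (lam * f T) (3 * r) \<zeta>'"
  unfolding bounded_density_def
proof (intro conjI allI impI)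
  show "\<zeta>' \<in> borel_measurable borel" unfolding \<zeta>'_def odd_ext_def using \<zeta>_meas by measurable
  show "\<bar>\<zeta>' x\<bar> \<le> lam * f T" for x
    using \<zeta>'_eq[of x] \<zeta>_nonneg \<zeta>_le[of x] \<zeta>_le[of "reflect x"] fT_nonneg
    by (cases "fst x" "0::real" rule: linorder_cases) auto
  show "\<zeta>' x = 0" if "norm x > 3 * r" for x
    using K_dens[OF \<zeta>K] that by (auto simp: \<zeta>'_def odd_ext_def bounded_density_def)
qed

lemma \<phi>_eq: "\<phi> = inv_neg_laplacian \<zeta>'"
  unfolding \<phi>_def \<zeta>'_def by (rule inv_neg_laplacian_odd_ext[OF K_dens[OF \<zeta>K], symmetric])

lemma \<phi>_deriv: "(\<phi> has_derivative (\<lambda>h. G\<phi> x \<bullet> h)) (at x)" "continuous_on UNIV G\<phi>"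
  unfolding \<phi>_eq G\<phi>_def by (rule inv_neg_laplacian_has_derivative[OF \<zeta>'_dens])+

lemma \<Theta>_deriv: "(\<Theta> has_derivative (\<lambda>h. G\<Theta> x \<bullet> h)) (at x)"
proof -
  have "((\<lambda>x. \<phi> x - W * fst x) has_derivative (\<lambda>h. G\<phi> x \<bullet> h - W * fst h)) (at x)"
    by (auto intro!: derivative_eq_intros \<phi>_deriv)
  then show ?thesis by (simp add: \<Theta>_def[abs_def] G\<Theta>_def inner_diff_left inner_prod_def algebra_simps)
qed

lemma \<Theta>_continuous: "continuous_on UNIV \<Theta>"
  by (rule continuous_at_imp_continuous_on) (use \<Theta>_deriv has_derivative_continuous in blast)

lemma G\<Theta>_continuous: "continuous_on UNIV G\<Theta>"
  unfolding G\<Theta>_def by (intro continuous_intros \<phi>_deriv)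

lemma \<Theta>_odd: "\<Theta> (reflect x) = - \<Theta> x"
  by (simp add: \<Theta>_def \<phi>_def)

lemma \<Theta>_far: "fst x > 0 \<Longrightarrow> dist x (r, 0) \<ge> r / 2 \<Longrightarrow> \<Theta> x - \<mu> < 0"
proof -
  assume x: "fst x > 0" "dist x (r, 0) \<ge> r / 2"
  have "\<phi> x \<le> 3 * \<kappa>" unfolding \<phi>_def by (rule green_far[OF Weq Rad_small Rad_small' x])
  moreover have "0 < W * fst x" using W x by simp
  ultimately show ?thesis using \<mu>_large by (simp add: \<Theta>_def)
qed

lemma Dom_near: "fst x > 0 \<Longrightarrow> dist x (r, 0) < r / 2 \<Longrightarrow> x \<in> Dom r"
  using dist_fst_le[of x "(r, 0)"] dist_snd_le[of x "(r, 0)"] r by (auto simp: Dom_def dist_real_def)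

text \<open>Maximality gives the equation in the rectangle; in the rest of the half plane the
  argument of f is negative and both sides are 0.\<close>

lemma \<zeta>_eq_right: "fst x > 0 \<Longrightarrow> \<zeta> x = lam * f (\<Theta> x - \<mu>)"
proof (cases "x \<in> Dom r")
  case True
  then show ?thesis using \<zeta>_eq by (simp add: \<Theta>_def \<phi>_def)
next
  case False
  assume x: "fst x > 0"
  then have "\<Theta> x - \<mu> < 0" using Dom_near[of x] False \<Theta>_far[of x] by force
  then show ?thesis using False by (simp add: \<zeta>_Dom f_nonpos)
qed

lemma far_right:
  assumes "\<forall>s\<le>0. p s = (0 :: real)" "fst x > 0" "dist x (r, 0) \<ge> r / 2"
  shows "p (\<Theta> x - \<mu>) = 0"
  using \<Theta>_far[of x] assms by simp

lemma far_left:
  assumes p: "\<forall>s\<le>0. p s = (0 :: real)" and x: "fst x \<le> 0" "dist x (- r, 0) \<ge> r / 2"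
  shows "p (- \<Theta> x - \<mu>) = 0"
proof (cases "fst x = 0")
  \<comment> \<open>On the axis oddness forces \<Theta> = 0, so the argument of \<open>p\<close> is
    - \<mu> < 0.\<close>
  case True
  then have "reflect x = x" by (simp add: reflect_def prod_eq_iff)
  then have "\<Theta> x = 0" using \<Theta>_odd[of x] by simp
  then show ?thesis using \<mu>_large \<kappa> p by simp
next
  case False
  have "dist (reflect x) (r, 0) = dist x (- r, 0)" by (simp add: dist_reflect)
  then have "\<Theta> (reflect x) - \<mu> < 0" using x False by (intro \<Theta>_far) auto
  then show ?thesis using p by (simp add: \<Theta>_odd)
qed

text \<open>With \<sigma> = 1 the even and with \<sigma> = - 1 the odd extension of p(\<Theta> -
  \<mu>), since \<Theta> is odd. Differentiating P(- \<Theta> - \<mu>) produces a minus sign, so an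
  even extension of a primitive has an odd extension as factor of its gradient.\<close>

definition sgn_comp :: "(real \<Rightarrow> real) \<Rightarrow> real \<Rightarrow> plane \<Rightarrow> real" where
  "sgn_comp p \<sigma> x = (if fst x > 0 then p (\<Theta> x - \<mu>) else \<sigma> * p (- \<Theta> x - \<mu>))"

text \<open>Near the axis, and away from both vortices, such compositions vanish identically, which glues
  the two half planes.\<close>

lemma sgn_comp_cases:
  assumes p: "\<forall>s\<le>0. p s = 0"
  obtains (right) "\<forall>\<^sub>F y in nhds x. sgn_comp p \<sigma> y = p (\<Theta> y - \<mu>)" "fst x > 0"
    | (left) "\<forall>\<^sub>F y in nhds x. sgn_comp p \<sigma> y = \<sigma> * p (- \<Theta> y - \<mu>)" "fst x < 0"
    | (axis) "\<forall>\<^sub>F y in nhds x. sgn_comp p \<sigma> y = 0" "fst x = 0"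
proof -
  consider "fst x > 0" | "fst x < 0" | "fst x = 0" by linarith
  then show ?thesis
  proof cases
    case 1
    have "open {y::plane. fst y > 0}" by (intro open_Collect_less continuous_intros)
    then have "\<forall>\<^sub>F y in nhds x. y \<in> {y::plane. fst y > 0}" using 1 by (intro eventually_nhds_in_open) auto
    then have "\<forall>\<^sub>F y in nhds x. sgn_comp p \<sigma> y = p (\<Theta> y - \<mu>)" by eventually_elim (simp add: sgn_comp_def)
    then show ?thesis using 1 by (rule right)
  next
    case 2
    have "open {y::plane. fst y < 0}" by (intro open_Collect_less continuous_intros)
    then have "\<forall>\<^sub>F y in nhds x. y \<in> {y::plane. fst y < 0}" using 2 by (intro eventually_nhds_in_open) auto
    then have "\<forall>\<^sub>F y in nhds x. sgn_comp p \<sigma> y = \<sigma> * p (- \<Theta> y - \<mu>)" by eventually_elim (simp add: sgn_comp_def)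
    then show ?thesis using 2 by (rule left)
  next
    case 3
    have "open {y::plane. dist y (r, 0) > r / 2 \<and> dist y (- r, 0) > r / 2}"
      by (intro open_Collect_conj open_Collect_less continuous_intros)
    moreover have "dist x (r, 0) > r / 2 \<and> dist x (- r, 0) > r / 2"
      using dist_fst_le[of x "(r, 0)"] dist_fst_le[of x "(- r, 0)"] 3 r by (auto simp: dist_real_def)
    ultimately have "\<forall>\<^sub>F y in nhds x. y \<in> {y::plane. dist y (r, 0) > r / 2 \<and> dist y (- r, 0) > r / 2}"
      by (intro eventually_nhds_in_open) auto
    then have "\<forall>\<^sub>F y in nhds x. sgn_comp p \<sigma> y = 0"
    proof eventually_elim
      fix y :: plane assume y: "y \<in> {y::plane. dist y (r, 0) > r / 2 \<and> dist y (- r, 0) > r / 2}"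
      then show "sgn_comp p \<sigma> y = 0"
        using far_right[OF p, of y] far_left[OF p, of y] by (auto simp: sgn_comp_def)
    qed
    then show ?thesis using 3 by (rule axis)
  qed
qed

lemma sgn_comp_bounded_support:
  assumes p: "\<forall>s\<le>0. p s = 0" and x: "norm x > 2 * r"
  shows "sgn_comp p \<sigma> x = 0"
proof -
  have "norm (r, 0 :: real) = r" "norm (- r, 0 :: real) = r" using r by (auto simp: norm_Pair)
  then have "dist x (r, 0) \<ge> r / 2" "dist x (- r, 0) \<ge> r / 2"
    using x r norm_triangle_ineq2[of x "(r, 0)"] norm_triangle_ineq2[of x "(- r, 0)"] unfolding dist_norm by linarith+
  then show ?thesis using far_right[OF p, of x] far_left[OF p, of x] by (auto simp: sgn_comp_def)
qed

lemma sgn_comp_C1c: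
  assumes P: "\<And>s. (P has_real_derivative p s) (at s)" and P0: "\<forall>s\<le>0. P s = 0"
    and p: "continuous_on UNIV p" and p0: "\<forall>s\<le>0. p s = 0"
  shows "C1_compact_support (sgn_comp P 1) (\<lambda>x. sgn_comp p (- 1) x *\<^sub>R G\<Theta> x)"
  unfolding C1_compact_support_def
proof (intro conjI allI)
  have isp: "isCont p s" for s using p by (simp add: continuous_on_eq_continuous_at)
  have ist: "isCont \<Theta> x" for x using \<Theta>_continuous by (simp add: continuous_on_eq_continuous_at)
  show "(sgn_comp P 1 has_derivative (\<lambda>h. (sgn_comp p (- 1) x *\<^sub>R G\<Theta> x) \<bullet> h)) (at x)" for x
  proof (rule sgn_comp_cases[OF P0, of 1 x])
    assume right: "\<forall>\<^sub>F y in nhds x. sgn_comp P (1) y = P (\<Theta> y - \<mu>)" "fst x > 0"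
    have "((\<lambda>y. P (\<Theta> y - \<mu>)) has_derivative (\<lambda>h. p (\<Theta> x - \<mu>) * (G\<Theta> x \<bullet> h))) (at x)"
      by (rule has_derivative_eq_rhs[OF has_derivative_compose[OF has_derivative_diff[OF \<Theta>_deriv has_derivative_const] P[unfolded has_field_derivative_def]]]) simp
    then have "(sgn_comp P 1 has_derivative (\<lambda>h. p (\<Theta> x - \<mu>) * (G\<Theta> x \<bullet> h))) (at x)"
      using right(1) by (intro has_derivative_eventually_eq[where G = "sgn_comp P 1"]) auto
    then show ?thesis using right(2) by (simp add: sgn_comp_def)
  next
    assume left: "\<forall>\<^sub>F y in nhds x. sgn_comp P (1) y = (1) * P (- \<Theta> y - \<mu>)" "fst x < 0"
    have "((\<lambda>y. P (- \<Theta> y - \<mu>)) has_derivative (\<lambda>h. p (- \<Theta> x - \<mu>) * (- (G\<Theta> x \<bullet> h)))) (at x)"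
      by (rule has_derivative_eq_rhs[OF has_derivative_compose[OF has_derivative_diff[OF has_derivative_minus[OF \<Theta>_deriv] has_derivative_const] P[unfolded has_field_derivative_def]]]) simp
    then have "(sgn_comp P 1 has_derivative (\<lambda>h. p (- \<Theta> x - \<mu>) * (- (G\<Theta> x \<bullet> h)))) (at x)"
      using left(1) by (intro has_derivative_eventually_eq[where G = "sgn_comp P 1"]) auto
    then show ?thesis using left(2) by (simp add: sgn_comp_def)
  next
    assume axis: "\<forall>\<^sub>F y in nhds x. sgn_comp P (1) y = 0" "fst x = 0"
    have "(sgn_comp P 1 has_derivative (\<lambda>h. 0)) (at x)"
      using axis(1) by (intro has_derivative_eventually_eq[where G = "sgn_comp P 1"]) auto
    moreover have "dist x (- r, 0) \<ge> r / 2" using dist_fst_le[of x "(- r, 0)"] axis(2) r by (auto simp: dist_real_def)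
    then have "sgn_comp p (- 1) x = 0" using far_left[OF p0, of x] axis(2) by (simp add: sgn_comp_def)
    ultimately show ?thesis by simp
  qed
  have "isCont (sgn_comp p (- 1)) x" for x
  proof (rule sgn_comp_cases[OF p0, of "- 1" x])
    assume right: "\<forall>\<^sub>F y in nhds x. sgn_comp p (- 1) y = p (\<Theta> y - \<mu>)" "fst x > 0"
    have "isCont (\<lambda>y. p (\<Theta> y - \<mu>)) x" by (intro isCont_o2[OF _ isp] continuous_intros ist)
    then show ?thesis using isCont_cong[OF right(1)] by simp
  next
    assume left: "\<forall>\<^sub>F y in nhds x. sgn_comp p (- 1) y = (- 1) * p (- \<Theta> y - \<mu>)" "fst x < 0"
    have "isCont (\<lambda>y. - 1 * p (- \<Theta> y - \<mu>)) x" by (intro continuous_mult continuous_const isCont_o2[OF _ isp] continuous_intros ist)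
    then show ?thesis using isCont_cong[OF left(1)] by simp
  next
    assume axis: "\<forall>\<^sub>F y in nhds x. sgn_comp p (- 1) y = 0" "fst x = 0"
    then show ?thesis using isCont_cong[OF axis(1)] by simp
  qed
  then have "continuous_on UNIV (sgn_comp p (- 1))" by (simp add: continuous_on_eq_continuous_at)
  then show "continuous_on UNIV (\<lambda>x. sgn_comp p (- 1) x *\<^sub>R G\<Theta> x)"
    by (intro continuous_on_scaleR G\<Theta>_continuous)
  show "\<exists>\<rho>. \<forall>x. norm x > \<rho> \<longrightarrow> sgn_comp P 1 x = 0"
    using sgn_comp_bounded_support[OF P0] by (intro exI[of _ "2 * r"]) auto
qed

end

lemma continuous_compact_support_bounded:
  fixes u :: "'a::euclidean_space \<Rightarrow> real"
  assumes "continuous_on UNIV u" "\<And>x. norm x > \<rho> \<Longrightarrow> u x = 0"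
  obtains C where "0 \<le> C" "\<And>x. \<bar>u x\<bar> \<le> C"
proof -
  have "compact (u ` cball 0 \<rho>)" by (intro compact_continuous_image continuous_on_subset[OF assms(1)]) auto
  then obtain C where C: "\<And>x. x \<in> cball 0 \<rho> \<Longrightarrow> norm (u x) \<le> C" unfolding bounded_iff
    by (metis bounded_iff compact_imp_bounded imageI)
  have "\<bar>u x\<bar> \<le> \<bar>C\<bar>" for x using C[of x] assms(2)[of x] by (cases "norm x \<le> \<rho>") auto
  then show ?thesis using that[of "\<bar>C\<bar>"] by auto
qed

lemma
  assumes g: "C1_compact_support g G"
  shows C1c_slice_fst: "C1_compact_support (\<lambda>y. g (y, t)) (\<lambda>y. fst (G (y, t)))"
    and C1c_slice_snd: "C1_compact_support (\<lambda>t. g (y, t)) (\<lambda>t. snd (G (y, t)))"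
proof -
  obtain \<rho> where \<rho>: "\<And>x. norm x > \<rho> \<Longrightarrow> g x = 0" using g by (auto simp: C1_compact_support_def)
  have "((\<lambda>y. g (y, t)) has_derivative (\<lambda>h. fst (G (y, t)) \<bullet> h)) (at y)" for y t
    by (rule has_derivative_eq_rhs[OF has_derivative_compose[where f = "\<lambda>y. (y, t)", OF _ C1cD(1)[OF g]]])
      (auto intro!: derivative_eq_intros simp: inner_prod_def fun_eq_iff)
  moreover have "continuous_on UNIV (\<lambda>y. fst (G (y, t)))"
    by (intro continuous_intros continuous_on_compose2[OF C1cD(2)[OF g]]) auto
  moreover have "norm y > \<rho> \<Longrightarrow> g (y, t) = 0" for y using \<rho>[of "(y, t)"] norm_fst_le[of y t] by simp
  ultimately show "C1_compact_support (\<lambda>y. g (y, t)) (\<lambda>y. fst (G (y, t)))" unfolding C1_compact_support_def by blast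
  have "((\<lambda>t. g (y, t)) has_derivative (\<lambda>h. snd (G (y, t)) \<bullet> h)) (at t)" for y t
    by (rule has_derivative_eq_rhs[OF has_derivative_compose[where f = "\<lambda>t. (y, t)", OF _ C1cD(1)[OF g]]])
      (auto intro!: derivative_eq_intros simp: inner_prod_def fun_eq_iff)
  moreover have "continuous_on UNIV (\<lambda>t. snd (G (y, t)))"
    by (intro continuous_intros continuous_on_compose2[OF C1cD(2)[OF g]]) auto
  moreover have "norm t > \<rho> \<Longrightarrow> g (y, t) = 0" for t using \<rho>[of "(y, t)"] norm_snd_le[of t y] by simp
  ultimately show "C1_compact_support (\<lambda>t. g (y, t)) (\<lambda>t. snd (G (y, t)))" unfolding C1_compact_support_def by blast
qed

text \<open>The passage between the fixed and the moving frame in space-time: at time t it is a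
  translation of x2 by c t.\<close>

definition shear :: "real \<Rightarrow> plane \<times> real \<Rightarrow> plane \<times> real" where
  "shear c p = ((fst (fst p), snd (fst p) + c * snd p), snd p)"

lemma shear_measurable: "shear c \<in> borel_measurable borel"
  unfolding shear_def by (intro borel_measurable_continuous_onI continuous_intros)

text \<open>For each fixed time the map is a translation of the plane, so Tonelli over time reduces
  the claim to translation invariance.\<close>

lemma shear_distr: "distr lborel borel (shear c) = lborel"
proof (rule measure_eqI)
  fix A assume "A \<in> sets (distr lborel borel (shear c))"
  then have A[measurable]: "A \<in> sets borel" by simp
  note sm = shear_measurable[of c]
  have im: "(\<lambda>p. indicator A (shear c p) :: ennreal) \<in> borel_measurable borel"
    by (rule measurable_compose[OF sm]) simp
  have "emeasure (distr lborel borel (shear c)) A = (\<integral>\<^sup>+p. indicator A (shear c p) \<partial>lborel)"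
  proof -
    have sm': "shear c \<in> lborel \<rightarrow>\<^sub>M borel" using sm by simp
    have "emeasure (distr lborel borel (shear c)) A = (\<integral>\<^sup>+p. indicator A p \<partial>distr lborel borel (shear c))" by simp
    also have "\<dots> = (\<integral>\<^sup>+p. indicator A (shear c p) \<partial>lborel)" by (rule nn_integral_distr[OF sm']) simp
    finally show ?thesis .
  qed
  also have "\<dots> = (\<integral>\<^sup>+t. \<integral>\<^sup>+x. indicator A (shear c (x, t)) \<partial>lborel \<partial>lborel)"
    using im by (subst lborel_prod[symmetric], subst lborel_pair.nn_integral_snd[symmetric]) (simp_all add: lborel_prod)
  also have "\<dots> = (\<integral>\<^sup>+t. \<integral>\<^sup>+x. indicator A (x, t) \<partial>lborel \<partial>lborel)"
  proof (rule nn_integral_cong)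
    fix t
    have "(\<lambda>x. indicator A (x, t) :: ennreal) \<in> borel_measurable borel"
      by (rule measurable_compose[where N = borel]) (auto intro!: borel_measurable_continuous_onI continuous_intros)
    from nn_integral_signed_translation[of 1 1 _ 0 "c * t", OF _ _ this]
    show "(\<integral>\<^sup>+x. indicator A (shear c (x, t)) \<partial>lborel) = (\<integral>\<^sup>+x. indicator A (x, t) \<partial>lborel)"
      by (simp add: shear_def add.commute)
  qed
  also have "\<dots> = (\<integral>\<^sup>+p. indicator A p \<partial>lborel)"
    using A by (subst (2) lborel_prod[symmetric], subst lborel_pair.nn_integral_snd[symmetric]) (simp_all add: lborel_prod)
  also have "\<dots> = emeasure lborel A" by simp
  finally show "emeasure (distr lborel borel (shear c)) A = emeasure lborel A" .
qed simp

text \<open>The transpose of the linear map \<open>shear c\<close>; it carries the gradient of g to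
  that of the composition of g with the shear.\<close>

definition shear_adj :: "real \<Rightarrow> plane \<times> real \<Rightarrow> plane \<times> real" where
  "shear_adj c q = (fst q, snd q + c * snd (fst q))"

lemma C1c_shear:
  assumes g: "C1_compact_support g G"
  shows "C1_compact_support (\<lambda>p. g (shear c p)) (\<lambda>p. shear_adj c (G (shear c p)))"
proof -
  obtain \<rho> where \<rho>: "\<And>x. norm x > \<rho> \<Longrightarrow> g x = 0" using g by (auto simp: C1_compact_support_def)
  have sd: "(shear c has_derivative shear c) (at p)" for p
    unfolding shear_def[abs_def] by (auto intro!: derivative_eq_intros)
  have "((\<lambda>p. g (shear c p)) has_derivative (\<lambda>h. shear_adj c (G (shear c p)) \<bullet> h)) (at p)" for p
    by (rule has_derivative_eq_rhs[OF has_derivative_compose[OF sd C1cD(1)[OF g]]])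
      (simp add: shear_def shear_adj_def inner_prod_def fun_eq_iff algebra_simps)
  moreover have "continuous_on UNIV (\<lambda>p. shear_adj c (G (shear c p)))"
    unfolding shear_adj_def shear_def
    by (intro continuous_intros continuous_on_compose2[OF C1cD(2)[OF g]]) auto
  moreover have "g (shear c p) = 0" if p: "norm p > (1 + \<bar>c\<bar>) * \<rho>" for p
  proof -
    have e: "p = shear c p - ((0, c * snd p), 0)" by (simp add: shear_def prod_eq_iff)
    have "norm p \<le> norm (shear c p) + norm ((0 :: real, c * snd p), 0 :: real)" by (subst e) (rule norm_triangle_ineq4)
    also have "norm ((0 :: real, c * snd p), 0 :: real) = \<bar>c\<bar> * \<bar>snd p\<bar>" by (simp add: norm_Pair abs_mult)
    also have "\<bar>snd p\<bar> \<le> norm (shear c p)" using norm_snd_le[of "snd (shear c p)" "fst (shear c p)"] by (simp add: shear_def)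
    finally have "norm p \<le> (1 + \<bar>c\<bar>) * norm (shear c p)" by (simp add: distrib_right mult_left_mono)
    then have "(1 + \<bar>c\<bar>) * \<rho> < (1 + \<bar>c\<bar>) * norm (shear c p)" using p by linarith
    then have "\<rho> < norm (shear c p)" by (simp add: mult_less_cancel_left_pos add_pos_nonneg)
    then show ?thesis by (rule \<rho>)
  qed
  ultimately show ?thesis unfolding C1_compact_support_def by blast
qed

context vortex_localized
begin

lemma \<zeta>'_sgn_comp: "\<zeta>' x = lam * sgn_comp f (- 1) x"
proof -
  consider "fst x > 0" | "fst x < 0" | "fst x = 0" by linarith
  then show ?thesis
  proof cases
    case 1
    then show ?thesis by (simp add: \<zeta>'_eq(1) sgn_comp_def \<zeta>_eq_right)
  next
    case 2
    then show ?thesis using \<zeta>_eq_right[of "reflect x"] by (simp add: \<zeta>'_eq(2) sgn_comp_def \<Theta>_odd)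
  next
    case 3
    have "dist x (- r, 0) \<ge> r / 2" using dist_fst_le[of x "(- r, 0)"] 3 r by (auto simp: dist_real_def)
    then show ?thesis using far_left[of f x] 3 by (simp add: \<zeta>'_eq(3) sgn_comp_def f_nonpos)
  qed
qed

text \<open>Inside the rectangle and its mirror image the relative stream function meets the jumps
  of f on a null set only; elsewhere both sides are 0.\<close>

lemma sgn_comp_f_reg_tendsto: "AE x in lborel. (\<lambda>k. sgn_comp (f_reg k) (- 1) x) \<longlonglongrightarrow> sgn_comp f (- 1) x"
proof -
  have ae: "AE x in lborel. x \<in> Dom r \<longrightarrow> isCont f (\<Theta> x - \<mu>)"
    using AE_isCont_bath[OF green_K_measurable[OF \<zeta>K] green_K_sdec[OF \<zeta>K] csd_pos, of \<mu>] by (simp add: \<Theta>_def \<phi>_def)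
  have ae': "AE x in lborel. reflect x \<in> Dom r \<longrightarrow> isCont f (\<Theta> (reflect x) - \<mu>)"
    using AE_signed_translation[OF _ _ ae, of "-1" 1 0 0] by (simp add: reflect_def)
  have lim: "(\<lambda>k. f_reg k (\<Theta> y - \<mu>)) \<longlonglongrightarrow> f (\<Theta> y - \<mu>)"
    if "fst y > 0" "y \<in> Dom r \<longrightarrow> isCont f (\<Theta> y - \<mu>)" for y
  proof (cases "y \<in> Dom r")
    case True
    then show ?thesis using that by (intro f_reg_tendsto) simp
  next
    case False
    then have "\<Theta> y - \<mu> < 0" using Dom_near[of y] \<Theta>_far[of y] that by force
    then show ?thesis by (simp add: f_reg_nonpos f_nonpos)
  qed
  from ae ae' show ?thesis
  proof eventually_elim
    fix x assume x: "x \<in> Dom r \<longrightarrow> isCont f (\<Theta> x - \<mu>)" "reflect x \<in> Dom r \<longrightarrow> isCont f (\<Theta> (reflect x) - \<mu>)"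
    consider "fst x > 0" | "fst x < 0" | "fst x = 0" by linarith
    then show "(\<lambda>k. sgn_comp (f_reg k) (- 1) x) \<longlonglongrightarrow> sgn_comp f (- 1) x"
    proof cases
      case 1
      then show ?thesis using lim[OF 1 x(1)] by (simp add: sgn_comp_def)
    next
      case 2
      then have "(\<lambda>k. f_reg k (\<Theta> (reflect x) - \<mu>)) \<longlonglongrightarrow> f (\<Theta> (reflect x) - \<mu>)" by (intro lim x) simp
      then show ?thesis using 2 by (simp add: sgn_comp_def \<Theta>_odd tendsto_minus)
    next
      case 3
      have "dist x (- r, 0) \<ge> r / 2" using dist_fst_le[of x "(- r, 0)"] 3 r by (auto simp: dist_real_def)
      then show ?thesis using far_left[of f x] far_left[of "f_reg _" x] 3 by (simp add: sgn_comp_def f_nonpos f_reg_nonpos)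
    qed
  qed
qed

lemma sgn_comp_measurable:
  assumes [measurable]: "p \<in> borel_measurable borel"
  shows "sgn_comp p \<sigma> \<in> borel_measurable borel"
proof -
  have [measurable]: "\<Theta> \<in> borel_measurable borel" "fst \<in> borel_measurable (borel :: plane measure)"
    by (intro borel_measurable_continuous_onI \<Theta>_continuous continuous_intros)+
  show ?thesis unfolding sgn_comp_def by measurable
qed

text \<open>The inner product of z with the velocity in the moving frame, which is the rotated
  gradient of \<Theta>.\<close>

definition skew :: "plane \<Rightarrow> plane \<Rightarrow> real" where
  "skew x z = (G\<Theta> x \<bullet> (0, 1)) * (z \<bullet> (1, 0)) - (G\<Theta> x \<bullet> (1, 0)) * (z \<bullet> (0, 1))"

text \<open>For \<open>f_reg k\<close> in place of f the factor times \<open>G\<Theta>\<close> is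
  the gradient of a compactly supported C1 function, so \<open>C1c_skew\<close> with the two
  coordinate directions gives 0. Dominated convergence then replaces \<open>f_reg k\<close> by
  f.\<close>

lemma steady_weak:
  assumes x: "C1_compact_support \<xi> GX"
  shows "(\<integral>x. \<zeta>' x * skew x (GX x) \<partial>lborel) = 0"
proof -
  obtain \<rho> where \<rho>: "\<And>x. norm x > \<rho> \<Longrightarrow> GX x = 0" using C1c_bounds[OF x] by metis
  have prod: "continuous_on UNIV (\<lambda>x. (G\<Theta> x \<bullet> d) * (GX x \<bullet> e))" for d e
    by (intro continuous_intros G\<Theta>_continuous C1cD(2)[OF x])
  have S: "continuous_on UNIV (\<lambda>x. skew x (GX x))" unfolding skew_def by (intro continuous_intros prod)
  have S0: "norm x > \<rho> \<Longrightarrow> skew x (GX x) = 0" for x by (simp add: skew_def \<rho>)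
  obtain C where C: "0 \<le> C" "\<And>x. \<bar>skew x (GX x)\<bar> \<le> C" using continuous_compact_support_bounded[OF S S0] by metis
  have Sm: "(\<lambda>x. skew x (GX x)) \<in> borel_measurable borel" by (rule borel_measurable_continuous_onI[OF S])
  have frm: "f_reg k \<in> borel_measurable borel" for k by (rule borel_measurable_continuous_onI[OF f_reg_continuous])
  have cb: "\<bar>sgn_comp (f_reg k) (- 1) x\<bar> \<le> f T" for k x using f_reg_range by (auto simp: sgn_comp_def)
  have zero: "(\<integral>x. sgn_comp (f_reg k) (- 1) x * skew x (GX x) \<partial>lborel) = 0" for k
  proof -
    obtain P where P: "\<And>s. (P has_real_derivative f_reg k s) (at s)" "\<And>s. s \<le> 0 \<Longrightarrow> P s = 0"
      using continuous_antiderivative_nonneg[OF f_reg_continuous[of k] f_reg_nonpos] by metis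
    have A: "C1_compact_support (sgn_comp P 1) (\<lambda>x. sgn_comp (f_reg k) (- 1) x *\<^sub>R G\<Theta> x)"
      by (rule sgn_comp_C1c) (use P f_reg_continuous f_reg_nonpos in auto)
    have i: "integrable lborel (\<lambda>x. sgn_comp (f_reg k) (- 1) x * ((G\<Theta> x \<bullet> d) * (GX x \<bullet> e)))" for d e
    proof -
      obtain K where K: "0 \<le> K" "\<And>x. \<bar>(G\<Theta> x \<bullet> d) * (GX x \<bullet> e)\<bar> \<le> K"
        using continuous_compact_support_bounded[OF prod[of d e], of \<rho>] \<rho> by (metis inner_zero_left mult_zero_right)
      show ?thesis
      proof (rule dens_integrable_bounded[of _ "f T * K" \<rho>])
        show "(\<lambda>x. sgn_comp (f_reg k) (- 1) x * ((G\<Theta> x \<bullet> d) * (GX x \<bullet> e))) \<in> borel_measurable borel"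
          by (intro borel_measurable_times sgn_comp_measurable frm borel_measurable_continuous_onI[OF prod, simplified])
        show "norm (sgn_comp (f_reg k) (- 1) x * ((G\<Theta> x \<bullet> d) * (GX x \<bullet> e))) \<le> f T * K" for x
          unfolding real_norm_def abs_mult[of "sgn_comp (f_reg k) (- 1) x"] using cb K f_nonneg by (intro mult_mono) auto
      qed (simp add: \<rho>)
    qed
    have "(\<integral>x. sgn_comp (f_reg k) (- 1) x * ((G\<Theta> x \<bullet> (0, 1)) * (GX x \<bullet> (1, 0))) \<partial>lborel)
        = (\<integral>x. sgn_comp (f_reg k) (- 1) x * ((G\<Theta> x \<bullet> (1, 0)) * (GX x \<bullet> (0, 1))) \<partial>lborel)"
      using C1c_skew[OF A x, of "(0, 1)" "(1, 0)"] by (simp add: mult.assoc)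
    then show ?thesis
      unfolding skew_def right_diff_distrib Bochner_Integration.integral_diff[OF i i] by simp
  qed
  have "(\<lambda>k. \<integral>x. sgn_comp (f_reg k) (- 1) x * skew x (GX x) \<partial>lborel) \<longlonglongrightarrow> (\<integral>x. sgn_comp f (- 1) x * skew x (GX x) \<partial>lborel)"
  proof (rule integral_dominated_convergence[where w = "\<lambda>x. f T * \<bar>skew x (GX x)\<bar>"])
    show "(\<lambda>x. sgn_comp f (- 1) x * skew x (GX x)) \<in> borel_measurable lborel"
      using sgn_comp_measurable[OF f_measurable] Sm by simp
    show "(\<lambda>x. sgn_comp (f_reg k) (- 1) x * skew x (GX x)) \<in> borel_measurable lborel" for k
      using sgn_comp_measurable[OF frm] Sm by simp
    have "integrable lborel (\<lambda>x. skew x (GX x))"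
      by (rule dens_integrable_bounded[OF Sm]) (use C S0 in auto)
    then show "integrable lborel (\<lambda>x. f T * \<bar>skew x (GX x)\<bar>)" by simp
    show "AE x in lborel. (\<lambda>k. sgn_comp (f_reg k) (- 1) x * skew x (GX x)) \<longlonglongrightarrow> sgn_comp f (- 1) x * skew x (GX x)"
      using sgn_comp_f_reg_tendsto by eventually_elim (intro tendsto_intros)
    show "AE x in lborel. norm (sgn_comp (f_reg k) (- 1) x * skew x (GX x)) \<le> f T * \<bar>skew x (GX x)\<bar>" for k
      unfolding real_norm_def abs_mult by (intro AE_I2 mult_right_mono cb) simp
  qed
  then have "(\<integral>x. sgn_comp f (- 1) x * skew x (GX x) \<partial>lborel) = 0" unfolding zero by (simp add: LIMSEQ_const_iff)
  then show ?thesis unfolding \<zeta>'_sgn_comp by (simp add: mult.assoc)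
qed

definition \<omega> :: "plane \<Rightarrow> real \<Rightarrow> real" where "\<omega> x t = \<zeta>' (fst x, snd x + W * t)"

definition \<Psi> :: "plane \<Rightarrow> real \<Rightarrow> real" where "\<Psi> x t = \<phi> (fst x, snd x + W * t)"

lemma \<Psi>_deriv: "((\<lambda>y. \<Psi> y t) has_derivative (\<lambda>h. G\<phi> (fst x, snd x + W * t) \<bullet> h)) (at x)"
  unfolding \<Psi>_def
  by (rule has_derivative_eq_rhs[OF has_derivative_compose[where f = "\<lambda>x. (fst x, snd x + W * t)", OF _ \<phi>_deriv(1)]])
    (auto intro!: derivative_eq_intros)

lemma perp_grad_\<Psi>: "perp_grad (\<lambda>y. \<Psi> y t) x = (G\<phi> (fst x, snd x + W * t) \<bullet> (0, 1), - (G\<phi> (fst x, snd x + W * t) \<bullet> (1, 0)))"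
  unfolding perp_grad_def partial_def frechet_derivative_at[OF \<Psi>_deriv, symmetric] ..

text \<open>In the moving frame the vorticity does not depend on time. The time derivative of the
  test function integrates to 0 along each time line, and the spatial part is
  \<open>steady_weak\<close> on each time slice.\<close>

lemma weak_transport_\<omega>: "weak_transport \<omega> (\<lambda>x t. perp_grad (\<lambda>y. \<Psi> y t) x)"
  unfolding weak_transport_def
proof (intro allI impI)
  fix \<eta> :: "plane \<times> real \<Rightarrow> real" assume "test_function \<eta>"
  then obtain G where G: "C1_compact_support \<eta> G" and pG: "\<And>x e. partial e \<eta> x = G x \<bullet> e" by (rule test_function_C1c) blast
  define \<theta> where "\<theta> p = \<eta> (shear (- W) p)" for p
  define H where "H p = shear_adj (- W) (G (shear (- W) p))" for p
  have \<theta>: "C1_compact_support \<theta> H" unfolding \<theta>_def H_def by (rule C1c_shear[OF G])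
  obtain C \<rho> where H: "0 \<le> C" "0 \<le> \<rho>" "\<And>p. norm (H p) \<le> C" "\<And>p. norm p > \<rho> \<Longrightarrow> H p = 0" using C1c_bounds[OF \<theta>] by metis
  define J1 where "J1 p = \<zeta>' (fst p) * (H p \<bullet> ((0, 0), 1))" for p
  define J2 where "J2 p = \<zeta>' (fst p) * skew (fst p) (fst (H p))" for p
  have zm[measurable]: "\<zeta>' \<in> borel_measurable borel" by (rule dens_measurable[OF \<zeta>'_dens])
  have zfm: "(\<lambda>p::plane \<times> real. \<zeta>' (fst p)) \<in> borel_measurable borel"
    by (rule measurable_compose[OF _ zm]) (intro borel_measurable_continuous_onI continuous_intros)
  have b: "integrable lborel (\<lambda>p. \<zeta>' (fst p) * u p)" if u: "continuous_on UNIV u" "\<And>p. norm p > \<rho> \<Longrightarrow> u p = 0" for u :: "plane \<times> real \<Rightarrow> real"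
  proof -
    obtain K where K: "0 \<le> K" "\<And>p. \<bar>u p\<bar> \<le> K" using continuous_compact_support_bounded[OF u] by metis
    show ?thesis
    proof (rule dens_integrable_bounded[of _ "lam * f T * K" \<rho>])
      show "(\<lambda>p. \<zeta>' (fst p) * u p) \<in> borel_measurable borel"
        by (intro borel_measurable_times zfm borel_measurable_continuous_onI[OF u(1)])
      show "norm (\<zeta>' (fst p) * u p) \<le> lam * f T * K" for p
        unfolding real_norm_def abs_mult using dens_bound[OF \<zeta>'_dens, of "fst p"] K fT_nonneg by (intro mult_mono) auto
    qed (simp add: u(2))
  qed
  have c1: "continuous_on UNIV (\<lambda>p. H p \<bullet> ((0, 0), 1))" by (intro continuous_intros C1cD(2)[OF \<theta>])
  have c2: "continuous_on UNIV (\<lambda>p. skew (fst p) (fst (H p)))"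
    unfolding skew_def by (intro continuous_intros C1cD(2)[OF \<theta>] continuous_on_compose2[OF G\<Theta>_continuous]) auto
  have i1: "integrable lborel J1" unfolding J1_def by (rule b[OF c1]) (simp add: H(4))
  have i2: "integrable lborel J2" unfolding J2_def by (rule b[OF c2]) (simp add: H(4) skew_def)
  have i1': "integrable (lborel \<Otimes>\<^sub>M lborel) J1" and i2': "integrable (lborel \<Otimes>\<^sub>M lborel) J2" using i1 i2 by (simp_all add: lborel_prod)
  have "integral\<^sup>L lborel J1 = (\<integral>y. \<integral>t. J1 (y, t) \<partial>lborel \<partial>lborel)"
    using lborel_pair.integral_fst'[OF i1'] by (simp add: lborel_prod)
  also have "\<dots> = 0"
  proof -
    have "(\<integral>t. J1 (y, t) \<partial>lborel) = 0" for y
    proof -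
      have "(\<integral>t. snd (H (y, t)) \<bullet> 1 \<partial>lborel) = 0" by (rule C1c_integral_grad[OF C1c_slice_snd[OF \<theta>]])
      then show ?thesis by (simp add: J1_def inner_prod_def)
    qed
    then show ?thesis by simp
  qed
  finally have z1: "integral\<^sup>L lborel J1 = 0" .
  have "integral\<^sup>L lborel J2 = (\<integral>t. \<integral>y. J2 (y, t) \<partial>lborel \<partial>lborel)"
    using lborel_pair.integral_snd[of "\<lambda>y t. J2 (y, t)"] i2' by (simp add: lborel_prod split_def)
  also have "\<dots> = 0"
  proof -
    have "(\<integral>y. J2 (y, t) \<partial>lborel) = 0" for t
      using steady_weak[OF C1c_slice_fst[OF \<theta>, of t]] by (simp add: J2_def)
    then show ?thesis by simp
  qed
  finally have z2: "integral\<^sup>L lborel J2 = 0" .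
  define J where "J p = J1 p + J2 p" for p
  have J: "integrable lborel J" "integral\<^sup>L lborel J = 0" unfolding J_def using i1 i2 z1 z2 by simp_all
  have Jm: "J \<in> borel_measurable borel" using borel_measurable_integrable[OF J(1)] by simp
  have sm: "shear W \<in> lborel \<rightarrow>\<^sub>M borel" using shear_measurable[of W] by simp
  have "has_bochner_integral lborel (\<lambda>p. J (shear W p)) 0"
    using integrable_distr_eq[OF sm Jm] integral_distr[OF sm Jm] J by (simp add: shear_distr has_bochner_integral_iff)
  moreover have "(\<lambda>p. J (shear W p)) = (\<lambda>(x, t). \<omega> x t * (partial ((0, 0), 1) \<eta> (x, t)
           + perp_grad (\<lambda>y. \<Psi> y t) x \<bullet> (partial ((1, 0), 0) \<eta> (x, t), partial ((0, 1), 0) \<eta> (x, t))))"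
  proof (rule ext)
    \<comment> \<open>The shear turns the time derivative into one with an extra term in W and the
      x2-derivative; it cancels against the contribution of - (W, 0) in
      \<open>G\<Theta>\<close>.\<close>
    fix p :: "plane \<times> real"
    have "shear (- W) (shear W p) = p" by (simp add: shear_def prod_eq_iff)
    then show "J (shear W p) = (case p of (x, t) \<Rightarrow> \<omega> x t * (partial ((0, 0), 1) \<eta> (x, t)
           + perp_grad (\<lambda>y. \<Psi> y t) x \<bullet> (partial ((1, 0), 0) \<eta> (x, t), partial ((0, 1), 0) \<eta> (x, t))))"
      unfolding split_def perp_grad_\<Psi> pG J_def J1_def J2_def H_def \<omega>_def skew_def G\<Theta>_def
      by (simp add: shear_adj_def shear_def inner_prod_def algebra_simps)
  qed
  ultimately show "has_bochner_integral lborel (\<lambda>(x, t). \<omega> x t * (partial ((0, 0), 1) \<eta> (x, t)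
           + perp_grad (\<lambda>y. \<Psi> y t) x \<bullet> (partial ((1, 0), 0) \<eta> (x, t), partial ((0, 1), 0) \<eta> (x, t)))) 0" by simp
qed

end

section \<open>Assembling the solution\<close>

lemma ess_support_subset:
  assumes "closed C" "\<And>x. g x \<noteq> 0 \<Longrightarrow> x \<in> C"
  shows "ess_support g \<subseteq> C"
proof -
  have "open (- C) \<and> (AE x in lborel. x \<in> - C \<longrightarrow> g x = 0)"
    using assms by (auto intro!: AE_I2)
  then show ?thesis unfolding ess_support_def by blast
qed

lemma dens_ess_bounded_compact_support:
  assumes d: "bounded_density B \<rho> g"
  shows "ess_bounded_compact_support g"
  unfolding ess_bounded_compact_support_def
proof
  show "ess_bounded g" unfolding ess_bounded_def using d by (auto simp: bounded_density_def)
  have "ess_support g \<subseteq> cball 0 \<rho>"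
    by (rule ess_support_subset) (use d in \<open>auto simp: bounded_density_def not_less[symmetric]\<close>)
  moreover have "closed (ess_support g)" unfolding ess_support_def by (auto intro!: open_Union)
  ultimately show "compact (ess_support g)"
    by (meson bounded_cball bounded_subset compact_eq_bounded_closed)
qed

context vortex_localized
begin

lemma \<zeta>'_translate_dens: "ess_bounded_compact_support (\<lambda>x. \<omega> x t)"
proof (rule dens_ess_bounded_compact_support[where B = "lam * f T" and \<rho> = "3 * r + \<bar>W * t\<bar>"])
  have m: "(\<lambda>x::plane. (fst x, snd x + W * t)) \<in> borel_measurable borel" by (intro borel_measurable_continuous_onI continuous_intros)
  have "\<omega> x t = 0" if "norm x > 3 * r + \<bar>W * t\<bar>" for x
  proof -
    have "norm x \<le> norm (fst x, snd x + W * t) + norm (0 :: real, W * t)"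
      using norm_triangle_ineq4[of "(fst x, snd x + W * t)" "(0, W * t)"] by simp
    then have "norm (fst x, snd x + W * t) > 3 * r" using that by (simp add: norm_Pair)
    then show ?thesis using \<zeta>'_dens by (simp add: \<omega>_def bounded_density_def)
  qed
  then show "bounded_density (lam * f T) (3 * r + \<bar>W * t\<bar>) (\<lambda>x. \<omega> x t)"
    unfolding bounded_density_def using dens_bound[OF \<zeta>'_dens] measurable_compose[OF m dens_measurable[OF \<zeta>'_dens]]
    by (auto simp: \<omega>_def)
qed

lemma euler: "euler_vorticity_stream \<omega> \<Psi>"
  unfolding euler_vorticity_stream_def
proof (intro conjI allI)
  have m: "(\<lambda>p::plane \<times> real. (fst (fst p), snd (fst p) + W * snd p)) \<in> borel_measurable borel"
    by (intro borel_measurable_continuous_onI continuous_intros)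
  show "ess_bounded (\<lambda>(x, t). \<omega> x t)"
    unfolding ess_bounded_def \<omega>_def split_def
  proof
    show "(\<lambda>p. \<zeta>' (fst (fst p), snd (fst p) + W * snd p)) \<in> borel_measurable lborel"
      using measurable_compose[OF m dens_measurable[OF \<zeta>'_dens]] by simp
    show "\<exists>M. AE p in lborel. \<bar>\<zeta>' (fst (fst p), snd (fst p) + W * snd p)\<bar> \<le> M"
      using dens_bound[OF \<zeta>'_dens] by (intro exI[of _ "lam * f T"] AE_I2)
  qed
  show "ess_bounded_compact_support (\<lambda>x. \<omega> x t)" for t by (rule \<zeta>'_translate_dens)
  show "\<Psi> x t = inv_neg_laplacian (\<lambda>y. \<omega> y t) x" for x t
    using inv_neg_laplacian_signed_translation[OF \<zeta>'_dens, of 1 1 0 "W * t" x]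
    by (simp add: \<Psi>_def \<omega>_def \<phi>_eq add.commute)
  show "(\<lambda>y. \<Psi> y t) differentiable (at x)" for x t
    using \<Psi>_deriv by (rule differentiableI)
  show "weak_transport \<omega> (\<lambda>x t. perp_grad (\<lambda>y. \<Psi> y t) x)" by (rule weak_transport_\<omega>)
qed

lemma stream_le_T_right: "fst x > 0 \<Longrightarrow> \<Theta> x - \<mu> \<le> T"
proof (cases "x \<in> Dom r")
  case True
  then show ?thesis using stream_le_T[OF True] by (simp add: \<Theta>_def \<phi>_def)
next
  case False
  assume "fst x > 0"
  then have "\<Theta> x - \<mu> < 0" using Dom_near[of x] False \<Theta>_far[of x] by force
  then show ?thesis using T_ge_1 by simp
qed

lemma \<zeta>'_support: "\<zeta>' x \<noteq> 0 \<Longrightarrow> dist x (r, 0) < (3 * conc_radius + 3) * eps \<or> dist x (- r, 0) < (3 * conc_radius + 3) * eps"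
proof -
  assume "\<zeta>' x \<noteq> 0"
  then have "\<zeta> x > 0 \<or> \<zeta> (reflect x) > 0" using \<zeta>_nonneg[of x] \<zeta>_nonneg[of "reflect x"] by (auto simp: \<zeta>'_def odd_ext_def less_le)
  moreover have "dist (reflect x) (r, 0) = dist x (- r, 0)" by (simp add: dist_reflect)
  ultimately show ?thesis using support_location[OF Weq Rad_small, of x] support_location[OF Weq Rad_small, of "reflect x"] by auto
qed

text \<open>The essential support lies in every closed set that contains the nonzero points, which
  gives closed discs; the enlargement from 3 to 4 makes them open.\<close>

lemma ess_support_\<zeta>': "ess_support \<zeta>' \<subseteq> ball (r, 0) ((3 * conc_radius + 4) * eps) \<union> ball (- r, 0) ((3 * conc_radius + 4) * eps)"
proof -
  have "ess_support \<zeta>' \<subseteq> cball (r, 0) ((3 * conc_radius + 3) * eps) \<union> cball (- r, 0) ((3 * conc_radius + 3) * eps)"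
  proof (rule ess_support_subset)
    show "x \<in> cball (r, 0) ((3 * conc_radius + 3) * eps) \<union> cball (- r, 0) ((3 * conc_radius + 3) * eps)" if "\<zeta>' x \<noteq> 0" for x
      using \<zeta>'_support[OF that] by (auto simp: dist_commute)
  qed auto
  moreover have "(3 * conc_radius + 3) * eps < (3 * conc_radius + 4) * eps" using eps_pos by simp
  ultimately show ?thesis by force
qed

lemma \<zeta>'_symmetric: "\<zeta>' (x1, x2) = - \<zeta>' (- x1, x2)" "\<zeta>' (x1, x2) = \<zeta>' (x1, - x2)"
  using steiner_sym_even[OF \<zeta>_steiner] by (simp_all add: \<zeta>'_def odd_ext_def)

text \<open>A reflection moves the negative half onto \<zeta>, tested with g at mirror points.
  Either half then has mass \<kappa> at points where g is within e of its value at the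
  centre.\<close>

lemma integral_\<zeta>'_close:
  fixes g :: "plane \<Rightarrow> real"
  assumes g: "continuous_on UNIV g" and e: "0 \<le> e"
    and c1: "\<And>x. dist x (r, 0) < (3 * conc_radius + 3) * eps \<Longrightarrow> \<bar>g x - g (r, 0)\<bar> \<le> e"
    and c2: "\<And>x. dist x (- r, 0) < (3 * conc_radius + 3) * eps \<Longrightarrow> \<bar>g x - g (- r, 0)\<bar> \<le> e"
  shows "\<bar>(\<integral>x. g x * \<zeta>' x \<partial>lborel) - (\<kappa> * g (r, 0) - \<kappa> * g (- r, 0))\<bar> \<le> 2 * \<kappa> * e"
proof -
  have cr: "continuous_on UNIV reflect" unfolding reflect_def by (intro continuous_intros)
  have gr: "continuous_on UNIV (\<lambda>x. g (reflect x))" by (rule continuous_on_compose2[OF g cr]) auto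
  have i: "integrable lborel (\<lambda>x. h x * \<zeta> x)" if h: "continuous_on UNIV h" for h :: "plane \<Rightarrow> real"
  proof -
    have "compact (h ` Dom r)" by (intro compact_continuous_image continuous_on_subset[OF h] Dom_compact) auto
    then obtain C where "\<forall>x\<in>Dom r. \<bar>h x\<bar> \<le> C" by (force simp: bounded_iff dest: compact_imp_bounded)
    then show ?thesis by (intro integrable_K_mult[OF \<zeta>K borel_measurable_continuous_onI[OF h]])
  qed
  have near: "\<bar>(\<integral>x. h x * \<zeta> x \<partial>lborel) - \<kappa> * h0\<bar> \<le> \<kappa> * e"
    if h: "continuous_on UNIV h" and c: "\<And>x. \<zeta> x > 0 \<Longrightarrow> \<bar>h x - h0\<bar> \<le> e" for h :: "plane \<Rightarrow> real" and h0
  proof -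
    have "(\<integral>x. h x * \<zeta> x \<partial>lborel) - \<kappa> * h0 = (\<integral>x. h x * \<zeta> x - h0 * \<zeta> x \<partial>lborel)"
      using i[OF h] \<zeta>_int \<zeta>_mass by simp
    also have "\<bar>\<dots>\<bar> \<le> (\<integral>x. e * \<zeta> x \<partial>lborel)"
    proof (rule integral_norm_bound_AE[where 'b = real, unfolded real_norm_def])
      show "AE x in lborel. \<bar>h x * \<zeta> x - h0 * \<zeta> x\<bar> \<le> e * \<zeta> x"
      proof (rule AE_I2)
        fix x
        show "\<bar>h x * \<zeta> x - h0 * \<zeta> x\<bar> \<le> e * \<zeta> x"
        proof (cases "\<zeta> x = 0")
          case False
          then have "\<zeta> x > 0" using \<zeta>_nonneg[of x] by simp
          then have "\<bar>h x - h0\<bar> * \<zeta> x \<le> e * \<zeta> x" by (intro mult_right_mono c) auto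
          then show ?thesis using \<zeta>_nonneg[of x] by (simp add: left_diff_distrib[symmetric] abs_mult)
        qed simp
      qed
    qed (use i[OF h] \<zeta>_int in auto)
    also have "\<dots> = \<kappa> * e" by (simp add: \<zeta>_mass)
    finally show ?thesis .
  qed
  have loc: "dist x (r, 0) < (3 * conc_radius + 3) * eps" if "\<zeta> x > 0" for x by (rule support_location[OF Weq Rad_small that])
  have 1: "\<bar>(\<integral>x. g x * \<zeta> x \<partial>lborel) - \<kappa> * g (r, 0)\<bar> \<le> \<kappa> * e" by (rule near[OF g c1[OF loc]])
  have 2: "\<bar>(\<integral>x. g (reflect x) * \<zeta> x \<partial>lborel) - \<kappa> * g (- r, 0)\<bar> \<le> \<kappa> * e"
  proof (rule near[OF gr])
    fix x assume "\<zeta> x > 0"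
    from loc[OF this] show "\<bar>g (reflect x) - g (- r, 0)\<bar> \<le> e" by (intro c2) (simp add: dist_reflect)
  qed
  have rm: "(\<lambda>x. g (reflect x) * \<zeta> x) \<in> borel_measurable borel"
    using borel_measurable_continuous_onI[OF gr] \<zeta>_meas by simp
  have r1: "(\<integral>x. g x * \<zeta> (reflect x) \<partial>lborel) = (\<integral>x. g (reflect x) * \<zeta> x \<partial>lborel)"
    using integral_signed_translation[OF _ _ rm, of "-1" 1 0 0] by (simp add: reflect_def)
  have r2: "integrable lborel (\<lambda>x. g x * \<zeta> (reflect x))"
    using integrable_signed_translation[OF _ _ rm, of "-1" 1 0 0] i[OF gr] by (simp add: reflect_def)
  have "(\<integral>x. g x * \<zeta>' x \<partial>lborel) = (\<integral>x. g x * \<zeta> x \<partial>lborel) - (\<integral>x. g (reflect x) * \<zeta> x \<partial>lborel)"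
    unfolding r1[symmetric] \<zeta>'_def odd_ext_def right_diff_distrib by (rule Bochner_Integration.integral_diff[OF i[OF g] r2])
  then show ?thesis using 1 2 by linarith
qed

lemma \<mu>_asymptotic: "\<bar>\<mu> - \<kappa> / (4 * pi) * ln lam\<bar> \<le> multiplier_const + (16 * f T + \<bar>\<kappa> * ln (6 * r)\<bar>)"
proof -
  have l: "ln (1 / eps) = ln lam / 2" using lam by (simp add: eps_def ln_sqrt)
  have e: "\<kappa> / (2 * pi) * ln (1 / eps) = \<kappa> / (4 * pi) * ln lam" unfolding l by simp
  have "0 \<le> multiplier_const" using r W T_ge_1 by (simp add: multiplier_const_def)
  moreover have "0 \<le> 16 * f T + \<bar>\<kappa> * ln (6 * r)\<bar>" using f_nonneg[of T] by simp
  ultimately show ?thesis using \<mu>_lower \<mu>_upper unfolding e by linarith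
qed

end

text \<open>\<open>R0\<close> and \<open>D0\<close> are the locale constants written out before
  \<open>lam\<close> is chosen. Their independence of \<open>lam\<close> lets the smallness
  conditions be imposed through \<open>lam\<close> and makes the final bounds uniform.\<close>

lemma vortex_localized_exists:
  assumes p: "profile f T" and f1: "f 1 > 0" and r: "r > 0" and \<kappa>: "\<kappa> > 0" and W: "W = \<kappa> / (4 * pi * r)"
    and T: "1 + 6 * sqrt (\<kappa> / (4 * f 1)) * (16 * f T + \<kappa>) + 2 * \<kappa> + 2 * r * W \<le> T"
  obtains R0 D0 lam0 where "lam0 > 0" "R0 > 0"
    "\<And>lam. lam > lam0 \<Longrightarrow> \<exists>\<zeta> \<mu>. vortex_localized f T r \<kappa> W lam \<zeta> \<mu>
       \<and> vortex_steady.conc_radius f T r \<kappa> W = R0 \<and> vortex_steady.multiplier_const f T r \<kappa> W = D0"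
proof -
  interpret P: profile f T by (rule p)
  define A where "A = sqrt (\<kappa> / (4 * f 1))"
  define D0 where "D0 = \<bar>\<kappa> / (2 * pi) * ln (r / (3 * A))\<bar> + 3 * r * W + 2 + T"
  define R0 where "R0 = exp (4 * (2 * pi * D0 + \<bar>\<kappa> * ln (6 * r)\<bar> + 16 * f T + 1) / \<kappa>)"
  have Wp: "W > 0" using \<kappa> r by (simp add: W)
  have fT: "f T > 0" using P.f_le_T[of 1] f1 by linarith
  have t0: "((\<lambda>lam. c * (1 / sqrt lam)) \<longlongrightarrow> 0) at_top" for c :: real
    by (intro tendsto_mult_right_zero tendsto_divide_0[OF tendsto_const] filterlim_at_top_imp_at_infinity sqrt_at_top)
  have ev: "\<forall>\<^sub>F lam in at_top. lam > 0 \<and> \<kappa> < lam * f T * (2 * r\<^sup>2) \<and> 6 * A * (1 / sqrt lam) < r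
    \<and> 4 * R0\<^sup>2 * (1 / sqrt lam) < r \<and> (3 * R0 + 3) * (1 / sqrt lam) < r / 4
    \<and> (3 * \<kappa> + D0) * (4 * pi / \<kappa>) < ln lam"
  proof (intro eventually_conj)
    show "\<forall>\<^sub>F lam in at_top. (0::real) < lam" by (rule eventually_gt_at_top)
    show "\<forall>\<^sub>F lam in at_top. \<kappa> < lam * f T * (2 * r\<^sup>2)"
      using eventually_gt_at_top[of "\<kappa> / (f T * (2 * r\<^sup>2))"]
      by eventually_elim (use fT r in \<open>simp add: divide_less_eq mult_ac\<close>)
    show "\<forall>\<^sub>F lam in at_top. 6 * A * (1 / sqrt lam) < r" by (rule order_tendstoD(2)[OF t0 r])
    show "\<forall>\<^sub>F lam in at_top. 4 * R0\<^sup>2 * (1 / sqrt lam) < r" by (rule order_tendstoD(2)[OF t0 r])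
    show "\<forall>\<^sub>F lam in at_top. (3 * R0 + 3) * (1 / sqrt lam) < r / 4" by (rule order_tendstoD(2)[OF t0]) (use r in simp)
    \<comment> \<open>Since \<mu> is at least \<kappa> / (4 \<pi>) ln lam - \<open>D0\<close>, this
      secures \<mu> > 3 \<kappa>.\<close>
    show "\<forall>\<^sub>F lam in at_top. (3 * \<kappa> + D0) * (4 * pi / \<kappa>) < ln (lam::real)"
      using ln_at_top unfolding filterlim_at_top_dense by blast
  qed
  then obtain N where N: "\<And>lam. lam \<ge> N \<Longrightarrow> lam > 0 \<and> \<kappa> < lam * f T * (2 * r\<^sup>2) \<and> 6 * A * (1 / sqrt lam) < r
    \<and> 4 * R0\<^sup>2 * (1 / sqrt lam) < r \<and> (3 * R0 + 3) * (1 / sqrt lam) < r / 4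
    \<and> (3 * \<kappa> + D0) * (4 * pi / \<kappa>) < ln lam" unfolding eventually_at_top_linorder by blast
  show ?thesis
  proof (rule that[of "max 1 N" R0 D0])
    fix lam assume "lam > max 1 N"
    then have l: "lam > 0" "\<kappa> < lam * f T * (2 * r\<^sup>2)" "6 * A * (1 / sqrt lam) < r"
      "4 * R0\<^sup>2 * (1 / sqrt lam) < r" "(3 * R0 + 3) * (1 / sqrt lam) < r / 4" "(3 * \<kappa> + D0) * (4 * pi / \<kappa>) < ln lam"
      using N[of lam] by auto
    interpret V: vortex f T r \<kappa> W lam by unfold_locales (use r \<kappa> Wp l in auto)
    interpret VP: vortex_patch f T r \<kappa> W lam by unfold_locales (use f1 l in \<open>auto simp: A_def\<close>)
    obtain \<zeta> \<mu> where z: "\<zeta> \<in> V.K" "\<zeta> = V.bathtub (green \<zeta>) \<mu>" "\<And>\<eta>. \<eta> \<in> V.K \<Longrightarrow> V.En \<eta> \<le> V.En \<zeta>"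
      using V.ex_steady_maximizer by blast
    interpret VS: vortex_steady f T r \<kappa> W lam \<zeta> \<mu>
      by unfold_locales (use z T in \<open>auto simp: VP.a_def\<close>)
    have D: "VS.multiplier_const = D0" by (simp add: VS.multiplier_const_def D0_def VP.a_def A_def)
    have R: "VS.conc_radius = R0" by (simp add: VS.conc_radius_def R0_def VS.concentration_const_def D)
    have le: "ln (1 / V.eps) = ln lam / 2" using l by (simp add: V.eps_def ln_sqrt)
    have e: "\<kappa> / (2 * pi) * ln (1 / V.eps) = \<kappa> / (4 * pi) * ln lam" unfolding le by simp
    have "3 * \<kappa> + D0 < \<kappa> / (4 * pi) * ln lam" using l(6) \<kappa> by (simp add: field_simps)
    then have mu: "3 * \<kappa> < \<mu>" using VS.\<mu>_lower unfolding e D by linarith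
    have "vortex_localized f T r \<kappa> W lam \<zeta> \<mu>"
      by (unfold_locales, unfold R V.eps_def) (rule W, rule l(4), rule less_imp_le[OF l(5)], rule mu)
    with D R show "\<exists>\<zeta> \<mu>. vortex_localized f T r \<kappa> W lam \<zeta> \<mu>
       \<and> vortex_steady.conc_radius f T r \<kappa> W = R0 \<and> vortex_steady.multiplier_const f T r \<kappa> W = D0" by blast
  qed (auto simp: R0_def)
qed

theorem theorem1p1:
  fixes r \<kappa> W :: real and b1 b2 :: "real \<times> real" and f :: "real \<Rightarrow> real"
  assumes "r > 0" and "\<kappa> > 0" and "W = \<kappa> / (4 * pi * r)"
    and "b1 = (r, 0)" and "b2 = (- r, 0)"
    and "bounded (range f)" and "mono f"
    and "\<And>s. s \<le> 0 \<Longrightarrow> f s = 0" and "\<And>s. s > 0 \<Longrightarrow> f s > 0"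
  shows "\<exists>lam0 > 0.
    \<exists>(\<omega> :: real \<Rightarrow> real \<times> real \<Rightarrow> real \<Rightarrow> real) (\<Psi> :: real \<Rightarrow> real \<times> real \<Rightarrow> real \<Rightarrow> real)
     (\<zeta> :: real \<Rightarrow> real \<times> real \<Rightarrow> real) (\<phi> :: real \<Rightarrow> real \<times> real \<Rightarrow> real) (\<mu> :: real \<Rightarrow> real).
      (\<forall>lam > lam0.
         euler_vorticity_stream (\<omega> lam) (\<Psi> lam) \<and>
         \<mu> lam \<ge> 0 \<and>
         ess_bounded_compact_support (\<zeta> lam) \<and>
         \<phi> lam = inv_neg_laplacian (\<zeta> lam) \<and>
         (\<forall>x1 x2 t. \<omega> lam (x1, x2) t = \<zeta> lam (x1, x2 + W * t)) \<and>
         (\<forall>x1 x2 t. \<Psi> lam (x1, x2) t = \<phi> lam (x1, x2 + W * t)) \<and>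
         (\<forall>t. AE (x1, x2) in lborel. x1 > 0 \<longrightarrow>
            \<omega> lam (x1, x2) t = lam * f (\<phi> lam (x1, x2 + W * t) - W * x1 - \<mu> lam))) \<and>
      converges_as_measures \<zeta> (\<lambda>g. \<kappa> * g b1 - \<kappa> * g b2) \<and>
      (\<exists>L > 0. \<forall>lam > lam0.
         ess_support (\<zeta> lam) \<subseteq>
           ball b1 (L * lam powr (- 1 / 2)) \<union> ball b2 (L * lam powr (- 1 / 2))) \<and>
      (\<forall>lam > lam0. AE (x1, x2) in lborel.
         \<zeta> lam (x1, x2) = - \<zeta> lam (- x1, x2) \<and>
         \<zeta> lam (x1, x2) = \<zeta> lam (x1, - x2)) \<and>
      (\<lambda>lam. \<mu> lam - \<kappa> / (4 * pi) * ln lam) \<in> O[at_top](\<lambda>_. 1)"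
proof -
  obtain M where M: "\<And>s. \<bar>f s\<bar> \<le> M" using \<open>bounded (range f)\<close> by (auto simp: bounded_iff)
  \<comment> \<open>\<open>T_large\<close> involves the value of the truncated profile at T, which
    is at most \<open>M\<close> whatever T is. The absolute value and the summand 1 ensure T \<ge>
    1.\<close>
  define T where "T = \<bar>1 + 6 * sqrt (\<kappa> / (4 * f 1)) * (16 * M + \<kappa>) + 2 * \<kappa> + 2 * r * W\<bar> + 1"
  define fT where "fT s = f (min s T)" for s
  have T1: "1 \<le> T" by (simp add: T_def)
  have f1: "fT 1 = f 1" using T1 by (simp add: fT_def)
  have f1p: "f 1 > 0" using assms(9) by simp
  then have f1p': "fT 1 > 0" using f1 by simp
  have p: "profile fT T"
  proof
    show "mono fT" unfolding fT_def by (intro monoI monoD[OF \<open>mono f\<close>]) (auto simp: min_def)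
    show "fT s = 0" if "s \<le> 0" for s using that assms(8)[of "min s T"] by (simp add: fT_def)
    show "fT s = fT T" if "T \<le> s" for s using that by (simp add: fT_def)
  qed (rule T1)
  have "sqrt (\<kappa> / (4 * f 1)) * (16 * fT T + \<kappa>) \<le> sqrt (\<kappa> / (4 * f 1)) * (16 * M + \<kappa>)"
    using M[of T] f1p \<open>\<kappa> > 0\<close> by (intro mult_left_mono) (auto simp: fT_def abs_le_iff)
  then have TT: "1 + 6 * sqrt (\<kappa> / (4 * fT 1)) * (16 * fT T + \<kappa>) + 2 * \<kappa> + 2 * r * W \<le> T"
    unfolding f1 T_def by linarith
  obtain R0 D0 lam0 where lam0: "lam0 > 0" and R0: "R0 > 0" and
    ex: "\<And>lam. lam > lam0 \<Longrightarrow> \<exists>\<zeta> \<mu>. vortex_localized fT T r \<kappa> W lam \<zeta> \<mu>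
       \<and> vortex_steady.conc_radius fT T r \<kappa> W = R0 \<and> vortex_steady.multiplier_const fT T r \<kappa> W = D0"
    by (rule vortex_localized_exists[OF p f1p' assms(1) assms(2) assms(3) TT]) blast
  obtain Z \<mu> where Z: "\<And>lam. lam > lam0 \<Longrightarrow> vortex_localized fT T r \<kappa> W lam (Z lam) (\<mu> lam)"
    using ex by metis
  \<comment> \<open>Neither constant takes \<open>lam\<close> as an argument, so a single instance
    determines both.\<close>
  have conc_radius: "vortex_steady.conc_radius fT T r \<kappa> W = R0" and multiplier_const: "vortex_steady.multiplier_const fT T r \<kappa> W = D0"
    using ex[of "lam0 + 1"] by auto
  define \<zeta> where "\<zeta> lam = odd_ext (Z lam)" for lam
  define \<phi> where "\<phi> lam = inv_neg_laplacian (\<zeta> lam)" for lam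
  define \<omega> where "\<omega> lam x t = \<zeta> lam (fst x, snd x + W * t)" for lam x t
  define \<Psi> where "\<Psi> lam x t = \<phi> lam (fst x, snd x + W * t)" for lam x t
  have b: "b1 = (r, 0)" "b2 = (- r, 0)" by (rule assms)+
  have sq: "1 / sqrt lam = lam powr (- 1 / 2)" if "lam > lam0" for lam
    using that lam0 powr_minus_divide[of lam "1 / 2"] powr_half_sqrt[of lam] by simp
  have main: "euler_vorticity_stream (\<omega> lam) (\<Psi> lam) \<and> \<mu> lam \<ge> 0 \<and> ess_bounded_compact_support (\<zeta> lam)
      \<and> (\<forall>x. fst x > 0 \<longrightarrow> \<zeta> lam x = lam * f (\<phi> lam x - W * fst x - \<mu> lam))
      \<and> ess_support (\<zeta> lam) \<subseteq> ball b1 ((3 * R0 + 4) * lam powr (- 1 / 2)) \<union> ball b2 ((3 * R0 + 4) * lam powr (- 1 / 2))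
      \<and> (\<forall>x1 x2. \<zeta> lam (x1, x2) = - \<zeta> lam (- x1, x2) \<and> \<zeta> lam (x1, x2) = \<zeta> lam (x1, - x2))
      \<and> \<bar>\<mu> lam - \<kappa> / (4 * pi) * ln lam\<bar> \<le> D0 + (16 * fT T + \<bar>\<kappa> * ln (6 * r)\<bar>)"
    if lam: "lam > lam0" for lam
  proof -
    interpret V: vortex_localized fT T r \<kappa> W lam "Z lam" "\<mu> lam" by (rule Z[OF lam])
    have z: "V.\<zeta>' = \<zeta> lam" by (simp add: V.\<zeta>'_def \<zeta>_def)
    have ph: "V.\<phi> = \<phi> lam" by (simp add: V.\<phi>_eq \<phi>_def z)
    have "V.\<omega> = \<omega> lam" "V.\<Psi> = \<Psi> lam" by (auto simp: fun_eq_iff V.\<omega>_def \<omega>_def V.\<Psi>_def \<Psi>_def z ph)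
    then have "euler_vorticity_stream (\<omega> lam) (\<Psi> lam)" using V.euler by simp
    moreover have "\<mu> lam \<ge> 0" using V.\<mu>_large \<open>\<kappa> > 0\<close> by simp
    moreover have "ess_bounded_compact_support (\<zeta> lam)" using dens_ess_bounded_compact_support[OF V.\<zeta>'_dens] by (simp add: z)
    moreover have "\<zeta> lam x = lam * f (\<phi> lam x - W * fst x - \<mu> lam)" if x: "fst x > 0" for x
    proof -
      have "\<zeta> lam x = lam * fT (V.\<Theta> x - \<mu> lam)" using V.\<zeta>'_eq(1)[OF x] V.\<zeta>_eq_right[OF x] by (simp add: z)
      \<comment> \<open>The truncation is undone here: the argument never exceeds T.\<close>
      also have "fT (V.\<Theta> x - \<mu> lam) = f (V.\<Theta> x - \<mu> lam)" using V.stream_le_T_right[OF x] by (simp add: fT_def min_absorb1)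
      finally show ?thesis by (simp add: V.\<Theta>_def ph)
    qed
    moreover have "ess_support (\<zeta> lam) \<subseteq> ball b1 ((3 * R0 + 4) * lam powr (- 1 / 2)) \<union> ball b2 ((3 * R0 + 4) * lam powr (- 1 / 2))"
      using V.ess_support_\<zeta>' unfolding z conc_radius b V.eps_def sq[OF lam] .
    moreover have "\<zeta> lam (x1, x2) = - \<zeta> lam (- x1, x2) \<and> \<zeta> lam (x1, x2) = \<zeta> lam (x1, - x2)" for x1 x2
      using V.\<zeta>'_symmetric[of x1 x2] by (simp add: z)
    moreover have "\<bar>\<mu> lam - \<kappa> / (4 * pi) * ln lam\<bar> \<le> D0 + (16 * fT T + \<bar>\<kappa> * ln (6 * r)\<bar>)"
      using V.\<mu>_asymptotic unfolding multiplier_const .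
    ultimately show ?thesis by blast
  qed
  have mE: "euler_vorticity_stream (\<omega> lam) (\<Psi> lam)" and m0: "\<mu> lam \<ge> 0" and mB: "ess_bounded_compact_support (\<zeta> lam)"
    and mF: "fst x > 0 \<Longrightarrow> \<zeta> lam x = lam * f (\<phi> lam x - W * fst x - \<mu> lam)"
    and mS: "ess_support (\<zeta> lam) \<subseteq> ball b1 ((3 * R0 + 4) * lam powr (- 1 / 2)) \<union> ball b2 ((3 * R0 + 4) * lam powr (- 1 / 2))"
    and mY: "\<zeta> lam (x1, x2) = - \<zeta> lam (- x1, x2) \<and> \<zeta> lam (x1, x2) = \<zeta> lam (x1, - x2)"
    and mA: "\<bar>\<mu> lam - \<kappa> / (4 * pi) * ln lam\<bar> \<le> D0 + (16 * fT T + \<bar>\<kappa> * ln (6 * r)\<bar>)"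
    if "lam > lam0" for lam x x1 x2
    using main[OF that] by blast+
  have conv: "converges_as_measures \<zeta> (\<lambda>g. \<kappa> * g b1 - \<kappa> * g b2)"
    unfolding converges_as_measures_def
  proof (intro allI impI)
    fix g :: "plane \<Rightarrow> real" assume "continuous_on UNIV g \<and> bounded (range g)"
    then have g: "continuous_on UNIV g" and ic: "isCont g b1" "isCont g b2"
      by (auto simp: continuous_on_eq_continuous_at)
    show "((\<lambda>lam. \<integral>x. g x * \<zeta> lam x \<partial>lborel) \<longlongrightarrow> \<kappa> * g b1 - \<kappa> * g b2) at_top"
    proof (rule tendstoI)
      fix e :: real assume e: "e > 0"
      \<comment> \<open>The integral is within 2 \<kappa> e' of its limit, which is half of
        \<open>e\<close>.\<close>
      define e' where "e' = e / (4 * \<kappa>)"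
      have e': "e' > 0" using e \<open>\<kappa> > 0\<close> by (simp add: e'_def)
      obtain d1 where d1: "d1 > 0" "\<And>x. dist x b1 < d1 \<Longrightarrow> \<bar>g x - g b1\<bar> < e'"
        using ic(1) e' unfolding continuous_at_eps_delta dist_real_def by metis
      obtain d2 where d2: "d2 > 0" "\<And>x. dist x b2 < d2 \<Longrightarrow> \<bar>g x - g b2\<bar> < e'"
        using ic(2) e' unfolding continuous_at_eps_delta dist_real_def by metis
      have "((\<lambda>lam. (3 * R0 + 3) * (1 / sqrt lam)) \<longlongrightarrow> 0) at_top"
        by (intro tendsto_mult_right_zero tendsto_divide_0[OF tendsto_const] filterlim_at_top_imp_at_infinity sqrt_at_top)
      then have "\<forall>\<^sub>F lam in at_top. (3 * R0 + 3) * (1 / sqrt lam) < min d1 d2"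
        by (rule order_tendstoD(2)) (use d1 d2 in simp)
      then show "\<forall>\<^sub>F lam in at_top. dist (\<integral>x. g x * \<zeta> lam x \<partial>lborel) (\<kappa> * g b1 - \<kappa> * g b2) < e"
        using eventually_gt_at_top[of lam0]
      proof eventually_elim
        fix lam assume small: "(3 * R0 + 3) * (1 / sqrt lam) < min d1 d2" and lam: "lam0 < lam"
        interpret V: vortex_localized fT T r \<kappa> W lam "Z lam" "\<mu> lam" by (rule Z[OF lam])
        have z: "V.\<zeta>' = \<zeta> lam" by (simp add: V.\<zeta>'_def \<zeta>_def)
        have "\<bar>(\<integral>x. g x * \<zeta> lam x \<partial>lborel) - (\<kappa> * g (r, 0) - \<kappa> * g (- r, 0))\<bar> \<le> 2 * \<kappa> * e'"
        proof (rule V.integral_\<zeta>'_close[OF g, of e', unfolded z conc_radius V.eps_def])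
          show "0 \<le> e'" using e' by simp
          show "\<bar>g x - g (r, 0)\<bar> \<le> e'" if "dist x (r, 0) < (3 * R0 + 3) * (1 / sqrt lam)" for x
            using d1(2)[of x] that small by (simp add: b)
          show "\<bar>g x - g (- r, 0)\<bar> \<le> e'" if "dist x (- r, 0) < (3 * R0 + 3) * (1 / sqrt lam)" for x
            using d2(2)[of x] that small by (simp add: b)
        qed
        also have "2 * \<kappa> * e' < e" using e \<open>\<kappa> > 0\<close> by (simp add: e'_def)
        finally show "dist (\<integral>x. g x * \<zeta> lam x \<partial>lborel) (\<kappa> * g b1 - \<kappa> * g b2) < e"
          by (simp add: dist_real_def b)
      qed
    qed
  qed
  have asym: "(\<lambda>lam. \<mu> lam - \<kappa> / (4 * pi) * ln lam) \<in> O[at_top](\<lambda>_. 1)"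
    by (rule bigoI[where c = "D0 + (16 * fT T + \<bar>\<kappa> * ln (6 * r)\<bar>)"])
      (use eventually_gt_at_top[of lam0] in eventually_elim, use mA in simp)
  show ?thesis
  proof (rule exI[of _ lam0], intro conjI lam0, rule exI[of _ \<omega>], rule exI[of _ \<Psi>], rule exI[of _ \<zeta>],
      rule exI[of _ \<phi>], rule exI[of _ \<mu>], intro conjI allI impI)
    fix lam assume lam: "lam > lam0"
    show "euler_vorticity_stream (\<omega> lam) (\<Psi> lam)" by (rule mE[OF lam])
    show "\<mu> lam \<ge> 0" by (rule m0[OF lam])
    show "ess_bounded_compact_support (\<zeta> lam)" by (rule mB[OF lam])
    show "\<phi> lam = inv_neg_laplacian (\<zeta> lam)" by (rule \<phi>_def)
    show "\<omega> lam (x1, x2) t = \<zeta> lam (x1, x2 + W * t)" "\<Psi> lam (x1, x2) t = \<phi> lam (x1, x2 + W * t)" for x1 x2 t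
      by (simp_all add: \<omega>_def \<Psi>_def)
    show "AE (x1, x2) in lborel. x1 > 0 \<longrightarrow> \<omega> lam (x1, x2) t = lam * f (\<phi> lam (x1, x2 + W * t) - W * x1 - \<mu> lam)" for t
    proof (rule AE_I2, unfold split_def, rule impI)
      fix x :: plane assume "fst x > 0"
      then show "\<omega> lam (fst x, snd x) t = lam * f (\<phi> lam (fst x, snd x + W * t) - W * fst x - \<mu> lam)"
        using mF[OF lam, of "(fst x, snd x + W * t)"] by (simp add: \<omega>_def)
    qed
    show "AE (x1, x2) in lborel. \<zeta> lam (x1, x2) = - \<zeta> lam (- x1, x2) \<and> \<zeta> lam (x1, x2) = \<zeta> lam (x1, - x2)"
      by (rule AE_I2, unfold split_def, rule mY[OF lam])
  next
    show "converges_as_measures \<zeta> (\<lambda>g. \<kappa> * g b1 - \<kappa> * g b2)" by (rule conv)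
    show "\<exists>L>0. \<forall>lam>lam0. ess_support (\<zeta> lam) \<subseteq> ball b1 (L * lam powr (- 1 / 2)) \<union> ball b2 (L * lam powr (- 1 / 2))"
      using mS R0 by (intro exI[of _ "3 * R0 + 4"] conjI allI impI) auto
    show "(\<lambda>lam. \<mu> lam - \<kappa> / (4 * pi) * ln lam) \<in> O[at_top](\<lambda>_. 1)" by (rule asym)
  qed
qed

end
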